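(* Let $X$ and $Y$ be Banach spaces over $\mathbb{K}$ ($\mathbb{K}=\mathbb{R}$ or $\mathbb{C}$), let $N\in\mathbb{N}$, and suppose that the dual $X'$ is separable and has the approximation property. Then for each $u\in(\tilde{\otimes}_{\pi_s}^{N,s}X)\,\tilde{\otimes}_{\pi}\,Y$ there exists a ($\mathbb{K}$-valued) regular Borel measure $\mu_u$ on the compact space $(B_{X''},w^* )\times(B_{Y''},w^* )$ such that $\|\mu_u\|\le\|u\|_{\pi}$ and $$\langle u,P\rangle=\int_{B_{X''}\times B_{Y''}}\overline{P}(x'')(y'')\,d\mu_u(x'',y'')$$ for all $P\in\mathcal{P}(^NX;Y')$, where $\overline{P}$ is the Aron-Berner extension of $P$.
   Context: $X'$, $X''$ denote the topological dual and bidual, $B_X$ the closed unit ball; $\|\mu\|$ is the total variation norm of $\mu$. $\mathcal{P}(^NX;Y)$ is the Banach space of continuous $N$-homogeneous polynomials $P:X\to Y$ (i.e. $P(x)=\Phi(x,\dots,x)$ for some continuous $N$-linear $\Phi:X\times\cdots\times X\to Y$) with norm $\|P\|=\sup_{x\in B_X}\|P(x)\|$. On the symmetric tensor product $\otimes^{N,s}X$ the symmetric projective norm is $\pi_s(v)=\inf\{\sum_{j=1}^m|\lambda_j|\|x_j\|^N : v=\sum_{j=1}^m\lambda_jx_j^N,\ \lambda_j\in\mathbb{K},\ x_j\in X\}$, where $x^N=x\otimes\cdots\otimes x$; its completion is $\tilde{\otimes}_{\pi_s}^{N,s}X$. $(\tilde{\otimes}_{\pi_s}^{N,s}X)\tilde{\otimes}_{\pi}Y$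 is the completed projective tensor product, with norm $\|\cdot\|_\pi$. There is an isometric identification $\mathcal{P}(^NX;Y')=\big((\tilde{\otimes}_{\pi_s}^{N,s}X)\tilde{\otimes}_{\pi}Y\big)'$ given by $\langle u,P\rangle=\sum_{k=1}^\infty\sum_{j=1}^\infty\lambda_{k,j}P(x_{k,j})(y_k)$ for $u=\sum_{k=1}^\infty v_k\otimes y_k$, with $y_k\in Y$ and $v_k=\sum_{j=1}^\infty\lambda_{k,j}x_{k,j}^N\in\tilde{\otimes}_{\pi_s}^{N,s}X$. Aron-Berner extension: for a continuous $N$-linear map $\Phi:X\times\cdots\times X\to Z$ its canonical (Arens) extension $\overline\Phi:X''\times\cdots\times X''\to Z''$ is $\overline{\Phi}(x_1'',\dots,x_N'')=w^*\text{-}\lim_{\alpha_1}\cdots\lim_{\alpha_N}\Phi(x_{1,\alpha_1},\dots,x_{N,\alpha_N})$, where $(x_{j,\alpha_j})_{\alpha_j}\subset X$ is a net $w^*$-convergent to $x_j''$ (iterated limits). For $P\in\mathcal{P}(^NX;Z)$ with associated symmetric $N$-linear map $\Phi$, $\overline{P}(x'')=\overline{\Phi}(x'',\dots,x'')$, so $\overline P\in\mathcal{P}(^NX'';Z'')$. With $Z=Y'$, $\overline{P}(x'')\in Y'''$ is evaluated at $y''\in Y''$. *)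

theory Defs
  imports "HOL-Analysis.Analysis"
begin

text \<open>The scalar field: a copy of the reals or of the complex numbers. (The sorts
  \<^class>\<open>banach\<close> and \<^class>\<open>second_countable_topology\<close> follow from the axiom; they are
  listed so that Bochner integrals of scalar functions can be formed.)\<close>

class real_or_complex = real_normed_field + banach + second_countable_topology +
  assumes real_or_complex:
    "(\<exists>h :: 'a \<Rightarrow> real. bij h \<and> (\<forall>x y. h (x + y) = h x + h y) \<and> (\<forall>x y. h (x * y) = h x * h y) \<and>
        (\<forall>r. h (r *\<^sub>R 1) = of_real r) \<and> (\<forall>x. norm (h x) = norm x)) \<or>
     (\<exists>h :: 'a \<Rightarrow> complex. bij h \<and> (\<forall>x y. h (x + y) = h x + h y) \<and> (\<forall>x y. h (x * y) = h x * h y) \<and>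
        (\<forall>r. h (r *\<^sub>R 1) = of_real r) \<and> (\<forall>x. norm (h x) = norm x))"

instance real :: real_or_complex
  by standard (rule disjI1, rule exI[of _ "\<lambda>x. x"], simp add: bij_def inj_def surj_def)

instance complex :: real_or_complex
  by standard (rule disjI2, rule exI[of _ "\<lambda>x. x"], simp add: bij_def inj_def surj_def scaleR_conv_of_real)

text \<open>A Banach space over the scalar field is a type of class \<^class>\<open>banach\<close> whose real scalar
  multiplication extends to a scalar multiplication \<open>s\<close> over \<open>'k\<close> compatible with the norm.\<close>

locale banach_space_over = vector_space s
  for s :: "'k::real_or_complex \<Rightarrow> 'a::banach \<Rightarrow> 'a" +
  assumes scale_of_real: "s (of_real r) x = r *\<^sub>R x"
    and norm_scale: "norm (s c x) = norm c * norm x"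

subsection \<open>Dual and bidual\<close>

text \<open>The dual consists of those elements of the real Banach space of bounded real-linear maps
  into \<open>'k\<close> that are \<open>'k\<close>-linear; its norm is the norm of that type.\<close>

definition dual_space :: "('k::real_or_complex \<Rightarrow> 'a::banach \<Rightarrow> 'a) \<Rightarrow> ('a \<Rightarrow>\<^sub>L 'k) set" where
  "dual_space s = {f. Vector_Spaces.linear s (*) (blinfun_apply f)}"

definition dual_scale :: "'k::real_or_complex \<Rightarrow> ('a::banach \<Rightarrow>\<^sub>L 'k) \<Rightarrow> ('a \<Rightarrow>\<^sub>L 'k)" where
  "dual_scale c f = Blinfun (\<lambda>x. c * blinfun_apply f x)"

text \<open>Elements of the bidual are functionals on the carrier \<^term>\<open>dual_space s\<close>, extended by \<open>0\<close>
  outside it. Consequently the (product) topology of the function type induces exactly the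
  weak-star topology on \<open>bidual\<close>.\<close>

definition bidual :: "('k::real_or_complex \<Rightarrow> 'a::banach \<Rightarrow> 'a) \<Rightarrow> (('a \<Rightarrow>\<^sub>L 'k) \<Rightarrow> 'k) set" where
  "bidual s = {\<xi>.
     (\<forall>f\<in>dual_space s. \<forall>g\<in>dual_space s. \<xi> (f + g) = \<xi> f + \<xi> g) \<and>
     (\<forall>c. \<forall>f\<in>dual_space s. \<xi> (dual_scale c f) = c * \<xi> f) \<and>
     (\<exists>C. \<forall>f\<in>dual_space s. norm (\<xi> f) \<le> C * norm f) \<and>
     (\<forall>f. f \<notin> dual_space s \<longrightarrow> \<xi> f = 0)}"

definition bidual_norm ::
    "('k::real_or_complex \<Rightarrow> 'a::banach \<Rightarrow> 'a) \<Rightarrow> (('a \<Rightarrow>\<^sub>L 'k) \<Rightarrow> 'k) \<Rightarrow> real" where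
  "bidual_norm s \<xi> = (SUP f\<in>{f \<in> dual_space s. norm f \<le> 1}. norm (\<xi> f))"

definition bidual_ball :: "('k::real_or_complex \<Rightarrow> 'a::banach \<Rightarrow> 'a) \<Rightarrow> (('a \<Rightarrow>\<^sub>L 'k) \<Rightarrow> 'k) set" where
  "bidual_ball s = {\<xi> \<in> bidual s. bidual_norm s \<xi> \<le> 1}"

subsection \<open>Separability and the approximation property of a subspace \<open>V\<close>\<close>

definition separable_set :: "'v::topological_space set \<Rightarrow> bool" where
  "separable_set V \<longleftrightarrow> (\<exists>D. countable D \<and> D \<subseteq> V \<and> V \<subseteq> closure D)"

definition finite_rank_operators ::
    "('k::real_or_complex \<Rightarrow> 'v::real_normed_vector \<Rightarrow> 'v) \<Rightarrow> 'v set \<Rightarrow> ('v \<Rightarrow> 'v) set" where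
  "finite_rank_operators t V = {T.
     (\<forall>x\<in>V. \<forall>y\<in>V. T (x + y) = T x + T y) \<and>
     (\<forall>c. \<forall>x\<in>V. T (t c x) = t c (T x)) \<and>
     (\<exists>C. \<forall>x\<in>V. norm (T x) \<le> C * norm x) \<and>
     (\<exists>B. finite B \<and> B \<subseteq> V \<and> T ` V \<subseteq> module.span t B)}"

definition approximation_property ::
    "('k::real_or_complex \<Rightarrow> 'v::real_normed_vector \<Rightarrow> 'v) \<Rightarrow> 'v set \<Rightarrow> bool" where
  "approximation_property t V \<longleftrightarrow>
     (\<forall>K \<epsilon>. compact K \<and> K \<subseteq> V \<and> 0 < \<epsilon> \<longrightarrow>
        (\<exists>T\<in>finite_rank_operators t V. \<forall>x\<in>K. norm (T x - x) < \<epsilon>))"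

subsection \<open>Multilinear maps and homogeneous polynomials\<close>

text \<open>\<open>N\<close>-linear maps are functions on lists; only their values on lists of length \<open>N\<close> matter.\<close>

definition multilinear_map ::
    "('k::real_or_complex \<Rightarrow> 'a::banach \<Rightarrow> 'a) \<Rightarrow> ('k \<Rightarrow> 'z::ab_group_add \<Rightarrow> 'z) \<Rightarrow> nat \<Rightarrow>
       ('a list \<Rightarrow> 'z) \<Rightarrow> bool" where
  "multilinear_map s t N \<Phi> \<longleftrightarrow>
     (\<forall>xs i. length xs = N \<longrightarrow> i < N \<longrightarrow> Vector_Spaces.linear s t (\<lambda>x. \<Phi> (xs[i := x])))"

text \<open>Continuous \<open>N\<close>-linear maps into the subspace \<open>Z\<close> of \<open>'z\<close>.\<close>

definition continuous_multilinear_map ::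
    "('k::real_or_complex \<Rightarrow> 'a::banach \<Rightarrow> 'a) \<Rightarrow> ('k \<Rightarrow> 'z::real_normed_vector \<Rightarrow> 'z) \<Rightarrow> 'z set \<Rightarrow> nat \<Rightarrow>
       ('a list \<Rightarrow> 'z) \<Rightarrow> bool" where
  "continuous_multilinear_map s t Z N \<Phi> \<longleftrightarrow>
     multilinear_map s t N \<Phi> \<and>
     (\<forall>xs. length xs = N \<longrightarrow> \<Phi> xs \<in> Z) \<and>
     (\<exists>C. \<forall>xs. length xs = N \<longrightarrow> norm (\<Phi> xs) \<le> C * prod_list (map norm xs))"

definition homogeneous_polynomials ::
    "('k::real_or_complex \<Rightarrow> 'a::banach \<Rightarrow> 'a) \<Rightarrow> ('k \<Rightarrow> 'z::real_normed_vector \<Rightarrow> 'z) \<Rightarrow> 'z set \<Rightarrow> nat \<Rightarrow>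
       ('a \<Rightarrow> 'z) set" where
  "homogeneous_polynomials s t Z N =
     {P. \<exists>\<Phi>. continuous_multilinear_map s t Z N \<Phi> \<and> (\<forall>x. P x = \<Phi> (replicate N x))}"

text \<open>By polarization the following map is unique on lists of length \<open>N\<close>.\<close>

definition associated_symmetric_map ::
    "('k::real_or_complex \<Rightarrow> 'a::banach \<Rightarrow> 'a) \<Rightarrow> ('k \<Rightarrow> 'z::real_normed_vector \<Rightarrow> 'z) \<Rightarrow> 'z set \<Rightarrow> nat \<Rightarrow>
       ('a \<Rightarrow> 'z) \<Rightarrow> ('a list \<Rightarrow> 'z)" where
  "associated_symmetric_map s t Z N P = (SOME \<Phi>.
     continuous_multilinear_map s t Z N \<Phi> \<and>
     (\<forall>xs ys. length xs = N \<and> mset xs = mset ys \<longrightarrow> \<Phi> xs = \<Phi> ys) \<and>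
     (\<forall>x. P x = \<Phi> (replicate N x)))"

subsection \<open>Aron-Berner extension\<close>

text \<open>The trace on the space of the weak-star neighbourhoods of \<open>\<xi>\<close>. A net in the space is
  weak-star convergent to \<open>\<xi>\<close> iff it converges along this filter, so limits along it are the limits
  along all such nets.\<close>

definition weak_star_filter ::
    "('k::real_or_complex \<Rightarrow> 'a::banach \<Rightarrow> 'a) \<Rightarrow> (('a \<Rightarrow>\<^sub>L 'k) \<Rightarrow> 'k) \<Rightarrow> 'a filter" where
  "weak_star_filter s \<xi> = (INF f\<in>dual_space s. filtercomap (blinfun_apply f) (nhds (\<xi> f)))"

text \<open>\<open>iterated_limit [F\<^sub>1, \<dots>, F\<^sub>N] g\<close> is the limit along \<open>F\<^sub>1\<close> of \<open>\<dots>\<close> of the limit along \<open>F\<^sub>N\<close>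
  of \<open>g [x\<^sub>1, \<dots>, x\<^sub>N]\<close>; the innermost limit is the one in the last variable.\<close>

fun iterated_limit :: "'a filter list \<Rightarrow> ('a list \<Rightarrow> 'k::t2_space) \<Rightarrow> 'k" where
  "iterated_limit [] g = g []"
| "iterated_limit (F # Fs) g = Lim F (\<lambda>x. iterated_limit Fs (\<lambda>xs. g (x # xs)))"

text \<open>A weak-star limit in the bidual of \<open>Z\<close> is taken pointwise on the dual of \<open>Z\<close>; \<open>\<zeta>\<close> below
  stands for an element of that dual.\<close>

definition arens_extension ::
    "('k::real_or_complex \<Rightarrow> 'a::banach \<Rightarrow> 'a) \<Rightarrow> ('a list \<Rightarrow> 'z) \<Rightarrow>
       (('a \<Rightarrow>\<^sub>L 'k) \<Rightarrow> 'k) list \<Rightarrow> ('z \<Rightarrow> 'k) \<Rightarrow> 'k" where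
  "arens_extension s \<Phi> \<xi>s \<zeta> = iterated_limit (map (weak_star_filter s) \<xi>s) (\<lambda>xs. \<zeta> (\<Phi> xs))"

definition aron_berner ::
    "('k::real_or_complex \<Rightarrow> 'a::banach \<Rightarrow> 'a) \<Rightarrow> ('k \<Rightarrow> 'z::real_normed_vector \<Rightarrow> 'z) \<Rightarrow> 'z set \<Rightarrow> nat \<Rightarrow>
       ('a \<Rightarrow> 'z) \<Rightarrow> (('a \<Rightarrow>\<^sub>L 'k) \<Rightarrow> 'k) \<Rightarrow> ('z \<Rightarrow> 'k) \<Rightarrow> 'k" where
  "aron_berner s t Z N P \<xi> =
     arens_extension s (associated_symmetric_map s t Z N P) (replicate N \<xi>)"

subsection \<open>Tensor products\<close>

text \<open>Algebraic tensor products are realized in the algebraic dual of the space of (not necessarily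
  continuous) multilinear forms: an elementary tensor is evaluation of forms. The values at
  functions that are not multilinear are set to \<open>0\<close>.\<close>

definition tensor_power ::
    "('k::real_or_complex \<Rightarrow> 'a::banach \<Rightarrow> 'a) \<Rightarrow> nat \<Rightarrow> 'a \<Rightarrow> ('a list \<Rightarrow> 'k) \<Rightarrow> 'k" where
  "tensor_power s N x = (\<lambda>\<phi>. if multilinear_map s (*) N \<phi> then \<phi> (replicate N x) else 0)"

definition sym_tensor_sum ::
    "('k::real_or_complex \<Rightarrow> 'a::banach \<Rightarrow> 'a) \<Rightarrow> nat \<Rightarrow> ('k \<times> 'a) list \<Rightarrow> ('a list \<Rightarrow> 'k) \<Rightarrow> 'k" where
  "sym_tensor_sum s N ts = (\<lambda>\<phi>. \<Sum>(c, x)\<leftarrow>ts. c * tensor_power s N x \<phi>)"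

definition sym_tensors ::
    "('k::real_or_complex \<Rightarrow> 'a::banach \<Rightarrow> 'a) \<Rightarrow> nat \<Rightarrow> (('a list \<Rightarrow> 'k) \<Rightarrow> 'k) set" where
  "sym_tensors s N = range (sym_tensor_sum s N)"

definition sym_proj_norm ::
    "('k::real_or_complex \<Rightarrow> 'a::banach \<Rightarrow> 'a) \<Rightarrow> nat \<Rightarrow> (('a list \<Rightarrow> 'k) \<Rightarrow> 'k) \<Rightarrow> real" where
  "sym_proj_norm s N v =
     Inf {(\<Sum>(c, x)\<leftarrow>ts. norm c * norm x ^ N) | ts. v = sym_tensor_sum s N ts}"

definition bilinear_form ::
    "('k::real_or_complex \<Rightarrow> 'e::banach \<Rightarrow> 'e) \<Rightarrow> ('k \<Rightarrow> 'f::banach \<Rightarrow> 'f) \<Rightarrow> ('e \<Rightarrow> 'f \<Rightarrow> 'k) \<Rightarrow> bool" where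
  "bilinear_form s t B \<longleftrightarrow>
     (\<forall>y. Vector_Spaces.linear s (*) (\<lambda>x. B x y)) \<and> (\<forall>x. Vector_Spaces.linear t (*) (B x))"

definition elementary_tensor ::
    "('k::real_or_complex \<Rightarrow> 'e::banach \<Rightarrow> 'e) \<Rightarrow> ('k \<Rightarrow> 'f::banach \<Rightarrow> 'f) \<Rightarrow> 'e \<Rightarrow> 'f \<Rightarrow>
       ('e \<Rightarrow> 'f \<Rightarrow> 'k) \<Rightarrow> 'k" where
  "elementary_tensor s t x y = (\<lambda>B. if bilinear_form s t B then B x y else 0)"

definition tensor_sum ::
    "('k::real_or_complex \<Rightarrow> 'e::banach \<Rightarrow> 'e) \<Rightarrow> ('k \<Rightarrow> 'f::banach \<Rightarrow> 'f) \<Rightarrow> ('e \<times> 'f) list \<Rightarrow>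
       ('e \<Rightarrow> 'f \<Rightarrow> 'k) \<Rightarrow> 'k" where
  "tensor_sum s t ts = (\<lambda>B. \<Sum>(x, y)\<leftarrow>ts. elementary_tensor s t x y B)"

definition tensors ::
    "('k::real_or_complex \<Rightarrow> 'e::banach \<Rightarrow> 'e) \<Rightarrow> ('k \<Rightarrow> 'f::banach \<Rightarrow> 'f) \<Rightarrow>
       (('e \<Rightarrow> 'f \<Rightarrow> 'k) \<Rightarrow> 'k) set" where
  "tensors s t = range (tensor_sum s t)"

definition proj_norm ::
    "('k::real_or_complex \<Rightarrow> 'e::banach \<Rightarrow> 'e) \<Rightarrow> ('k \<Rightarrow> 'f::banach \<Rightarrow> 'f) \<Rightarrow>
       (('e \<Rightarrow> 'f \<Rightarrow> 'k) \<Rightarrow> 'k) \<Rightarrow> real" where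
  "proj_norm s t z = Inf {(\<Sum>(x, y)\<leftarrow>ts. norm x * norm y) | ts. z = tensor_sum s t ts}"

text \<open>The Banach space \<open>'e\<close> with scalar multiplication \<open>t\<close>, together with \<open>\<iota>\<close>, is a completion of the
  space \<open>V\<close> (with pointwise operations) normed by \<open>nrm\<close>. Completions are determined only up to
  isometric isomorphism; statements about them are made for every completion.\<close>

definition is_completion ::
    "('i \<Rightarrow> 'k::real_or_complex) set \<Rightarrow> (('i \<Rightarrow> 'k) \<Rightarrow> real) \<Rightarrow>
       ('k \<Rightarrow> 'e::banach \<Rightarrow> 'e) \<Rightarrow> (('i \<Rightarrow> 'k) \<Rightarrow> 'e) \<Rightarrow> bool" where
  "is_completion V nrm t \<iota> \<longleftrightarrow>
     banach_space_over t \<and>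
     (\<forall>u\<in>V. \<forall>v\<in>V. \<iota> (\<lambda>i. u i + v i) = \<iota> u + \<iota> v) \<and>
     (\<forall>c. \<forall>v\<in>V. \<iota> (\<lambda>i. c * v i) = t c (\<iota> v)) \<and>
     (\<forall>v\<in>V. norm (\<iota> v) = nrm v) \<and>
     closure (\<iota> ` V) = UNIV"

text \<open>The duality between the completed tensor product (with structure maps \<open>\<iota>\<close>, \<open>\<kappa>\<close> into the two
  completions \<open>'e\<close> and \<open>'g\<close>) and polynomials, through any representation
  \<open>u = \<Sum>\<^sub>k v\<^sub>k \<otimes> y\<^sub>k\<close> with \<open>v\<^sub>k = \<Sum>\<^sub>j c\<^sub>k\<^sub>j x\<^sub>k\<^sub>j\<^sup>N\<close>; the value does not depend on
  the representation.\<close>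

definition tensor_pairing ::
    "('k::real_or_complex \<Rightarrow> 'a::banach \<Rightarrow> 'a) \<Rightarrow> ('k \<Rightarrow> 'b::banach \<Rightarrow> 'b) \<Rightarrow> ('k \<Rightarrow> 'e::banach \<Rightarrow> 'e) \<Rightarrow> nat \<Rightarrow>
       ((('a list \<Rightarrow> 'k) \<Rightarrow> 'k) \<Rightarrow> 'e) \<Rightarrow> ((('e \<Rightarrow> 'b \<Rightarrow> 'k) \<Rightarrow> 'k) \<Rightarrow> 'g::banach) \<Rightarrow>
       'g \<Rightarrow> ('a \<Rightarrow> 'b \<Rightarrow>\<^sub>L 'k) \<Rightarrow> 'k" where
  "tensor_pairing sX sY sE N \<iota> \<kappa> u P = (THE p. \<exists>v y c x w.
     (\<lambda>k. \<kappa> (elementary_tensor sE sY (v k) (y k))) sums u \<and>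
     (\<forall>k. (\<lambda>j. sE (c k j) (\<iota> (tensor_power sX N (x k j)))) sums v k) \<and>
     (\<forall>k. (\<lambda>j. c k j * blinfun_apply (P (x k j)) (y k)) sums w k) \<and>
     w sums p)"

subsection \<open>Scalar-valued measures\<close>

definition scalar_measure :: "'c measure \<Rightarrow> ('c set \<Rightarrow> 'k::real_or_complex) \<Rightarrow> bool" where
  "scalar_measure M \<mu> \<longleftrightarrow>
     \<mu> {} = 0 \<and>
     (\<forall>A :: nat \<Rightarrow> 'c set. range A \<subseteq> sets M \<and> disjoint_family A \<longrightarrow> (\<lambda>i. \<mu> (A i)) sums \<mu> (\<Union>i. A i))"

definition variation :: "'c measure \<Rightarrow> ('c set \<Rightarrow> 'k::real_or_complex) \<Rightarrow> 'c set \<Rightarrow> ennreal" where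
  "variation M \<mu> E =
     (SUP A \<in> {A :: nat \<Rightarrow> 'c set. range A \<subseteq> sets M \<and> disjoint_family A \<and> (\<Union>i. A i) = E}.
        \<Sum>i. ennreal (norm (\<mu> (A i))))"

definition variation_measure :: "'c measure \<Rightarrow> ('c set \<Rightarrow> 'k::real_or_complex) \<Rightarrow> 'c measure" where
  "variation_measure M \<mu> = measure_of (space M) (sets M) (variation M \<mu>)"

definition total_variation_norm :: "'c measure \<Rightarrow> ('c set \<Rightarrow> 'k::real_or_complex) \<Rightarrow> ennreal" where
  "total_variation_norm M \<mu> = variation M \<mu> (space M)"

text \<open>Integration through the polar decomposition \<open>d\<mu> = h d|\<mu>|\<close>, \<open>|h| = 1\<close>. Integrability
  (in particular Borel measurability) of \<open>f\<close> is part of the relation.\<close>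

definition has_scalar_integral ::
    "'c measure \<Rightarrow> ('c set \<Rightarrow> 'k::real_or_complex) \<Rightarrow> ('c \<Rightarrow> 'k) \<Rightarrow> 'k \<Rightarrow> bool" where
  "has_scalar_integral M \<mu> f I \<longleftrightarrow>
     (\<exists>h \<in> borel_measurable M.
        (\<forall>z\<in>space M. norm (h z) = 1) \<and>
        (\<forall>E\<in>sets M. \<mu> E = (\<integral>z. indicator E z *\<^sub>R h z \<partial>variation_measure M \<mu>)) \<and>
        integrable (variation_measure M \<mu>) (\<lambda>z. f z * h z) \<and>
        I = (\<integral>z. f z * h z \<partial>variation_measure M \<mu>))"

text \<open>Regular Borel measures on a set \<open>K\<close> with its subspace topology.\<close>

definition regular_borel_measure_on ::
    "'c::topological_space set \<Rightarrow> ('c set \<Rightarrow> 'k::real_or_complex) \<Rightarrow> bool" where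
  "regular_borel_measure_on K \<mu> \<longleftrightarrow>
     scalar_measure (restrict_space borel K) \<mu> \<and>
     (\<forall>E\<in>sets (restrict_space borel K). \<forall>\<epsilon>>0. \<exists>C U.
        compact C \<and> C \<subseteq> E \<and> openin (top_of_set K) U \<and> E \<subseteq> U \<and>
        variation (restrict_space borel K) \<mu> (U - C) < ennreal \<epsilon>)"

end

theory Submission
  imports Defs
begin

text \<open>
  Approximate \<open>u\<close> by finite sums of tensors \<open>c x\<^sup>N \<otimes> y\<close> whose total weight
  \<open>\<Sum> |c| \<parallel>x\<parallel>\<^sup>N \<parallel>y\<parallel>\<close> tends to \<open>\<parallel>u\<parallel>\<close>. Normalising the vectors and moving the phase of
  \<open>c\<close> into \<open>y\<close> turns each sum into a positive discrete measure on the product of the bidual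
  balls. A weak-star cluster point \<open>\<mu>\<close> has mass at most \<open>\<parallel>u\<parallel>\<close> and represents \<open>u\<close> on the
  polynomials \<open>f\<^sub>1 \<cdots> f\<^sub>N \<phi>\<close> with \<open>f\<^sub>i\<close> in the dual of \<open>X\<close> and \<open>\<phi>\<close> in the dual of \<open>Y\<close>,
  whose extensions are weak-star continuous.

  For general \<open>P\<close> the arguments of the symmetric map are extended one at a time. With the inner
  ones already extended, the outermost one sees a bounded map from the compact space into the
  separable dual of \<open>X\<close>, measurable at each point of \<open>X\<close>; it expands as \<open>\<Sum> 1\<^bsub>E n\<^esub> e\<^sub>n\<close>
  with \<open>\<Sum> \<mu>(E\<^sub>n) \<parallel>e\<^sub>n\<parallel> < \<infinity>\<close>. The desired identity then says that two nuclear operators on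
  the dual of \<open>X\<close> have the same trace, while the identity known by induction says that they are
  the same operator. The approximation property, used only on a compact set absorbing the
  \<open>e\<^sub>n\<close>, closes the gap.
\<close>

section \<open>A regular Borel measure from a finitely additive content\<close>

locale finitely_additive_content =
  fixes K :: "'c::topological_space set" and m :: "'c set \<Rightarrow> real"
  assumes hausdorff: "Hausdorff_space (euclidean :: 'c topology)"
    and compact_K: "compact K"
    and m_nonneg: "0 \<le> m A"
    and m_Un: "A \<inter> B = {} \<Longrightarrow> m (A \<union> B) = m A + m B"
    and m_off: "m (- K) = 0"
begin

lemma m_mono: "A \<subseteq> B \<Longrightarrow> m A \<le> m B"
  using m_Un[of A "B - A"] m_nonneg[of "B - A"] by (simp add: Un_absorb1)

lemma m_Un_le: "m (A \<union> B) \<le> m A + m B"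
  using m_Un[of A "B - A"] m_mono[of "B - A" B] by simp

lemma m_empty: "m {} = 0"
  using m_mono[of "{}" "- K"] m_off m_nonneg[of "{}"] by simp

lemma m_UN_le: "finite I \<Longrightarrow> m (\<Union>i\<in>I. A i) \<le> (\<Sum>i\<in>I. m (A i))"
proof (induction I rule: finite_induct)
  case empty then show ?case by (simp add: m_empty)
next
  case (insert i I)
  then show ?case using m_Un_le[of "A i" "\<Union>i\<in>I. A i"] by simp
qed

lemma compact_closed: "compact C \<Longrightarrow> closed (C :: 'c set)"
  using compactin_imp_closedin[OF hausdorff, of C] by simp

lemma compact_separation:
  fixes C D :: "'c set"
  assumes "compact C" "compact D" "C \<inter> D = {}"
  obtains U V where "open U" "open V" "C \<subseteq> U" "D \<subseteq> V" "U \<inter> V = {}"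
  using Hausdorff_space_compact_separation[OF hausdorff, of C D] assms
  by (auto simp: disjnt_def)

lemma compact_split2:
  fixes C :: "'c set"
  assumes C: "compact C" "C \<subseteq> U \<union> V" "open U" "open V"
  obtains D E where "compact D" "compact E" "D \<subseteq> U" "E \<subseteq> V" "C = D \<union> E"
proof -
  have "compact (C - U)" "compact (C - V)" "(C - U) \<inter> (C - V) = {}"
    using C by (auto intro: compact_diff)
  then obtain U' V' where *: "open U'" "open V'" "C - U \<subseteq> U'" "C - V \<subseteq> V'" "U' \<inter> V' = {}"
    by (rule compact_separation)
  show ?thesis
  proof (rule that[of "C - U'" "C - V'"])
    show "compact (C - U')" "compact (C - V')" using C * by (auto intro: compact_diff)
  qed (use * in auto)
qed

lemma compact_split:
  assumes "finite I" "compact (C :: 'c set)" "C \<subseteq> (\<Union>i\<in>I. U i)" "\<And>i. i \<in> I \<Longrightarrow> open (U i)"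
  shows "\<exists>D. (\<forall>i\<in>I. compact (D i) \<and> D i \<subseteq> U i) \<and> C = (\<Union>i\<in>I. D i)"
  using assms
proof (induction I arbitrary: C rule: finite_induct)
  case empty then show ?case by simp
next
  case (insert i I)
  have "open (U i)" "open (\<Union>i\<in>I. U i)" using insert by auto
  then obtain D E where DE: "compact D" "compact E" "D \<subseteq> U i" "E \<subseteq> (\<Union>i\<in>I. U i)" "C = D \<union> E"
    using compact_split2[of C "U i" "\<Union>i\<in>I. U i"] insert.prems by auto
  obtain D' where D': "\<forall>i\<in>I. compact (D' i) \<and> D' i \<subseteq> U i" "E = (\<Union>i\<in>I. D' i)"
    using insert.IH[of E] DE insert.prems by auto
  have "(\<Union>j\<in>I. (D'(i := D)) j) = (\<Union>j\<in>I. D' j)"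
    using insert.hyps by (intro SUP_cong) auto
  then show ?case
    using DE D' insert.hyps by (intro exI[of _ "D'(i := D)"]) auto
qed

definition inner_content :: "'c set \<Rightarrow> ennreal" where
  "inner_content U = (SUP C\<in>{C. compact C \<and> C \<subseteq> U}. ennreal (m C))"

definition outer_content :: "'c set \<Rightarrow> ennreal" where
  "outer_content A = (INF U\<in>{U. open U \<and> A \<subseteq> U}. inner_content U)"

lemma inner_content_mono: "U \<subseteq> V \<Longrightarrow> inner_content U \<le> inner_content V"
  unfolding inner_content_def by (intro SUP_subset_mono) auto

lemma inner_content_upper: "compact C \<Longrightarrow> C \<subseteq> U \<Longrightarrow> ennreal (m C) \<le> inner_content U"
  unfolding inner_content_def by (intro SUP_upper) auto

lemma inner_content_le: "inner_content U \<le> ennreal (m U)"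
  unfolding inner_content_def by (intro SUP_least) (auto intro!: ennreal_leI m_mono)

lemma outer_content_open: "open U \<Longrightarrow> outer_content U = inner_content U"
  unfolding outer_content_def
  by (intro antisym INF_lower2[of U] INF_greatest) (auto intro: inner_content_mono)

lemma outer_content_mono: "A \<subseteq> B \<Longrightarrow> outer_content A \<le> outer_content B"
  unfolding outer_content_def by (intro INF_superset_mono) auto

lemma inner_content_UN_le:
  fixes U :: "nat \<Rightarrow> 'c set"
  assumes U: "\<And>i. open (U i)"
  shows "inner_content (\<Union>i. U i) \<le> (\<Sum>i. inner_content (U i))"
  unfolding inner_content_def[of "\<Union>i. U i"]
proof (rule SUP_least, clarify)
  fix C :: "'c set" assume C: "compact C" "C \<subseteq> (\<Union>i. U i)"
  then obtain I where I: "finite I" "C \<subseteq> (\<Union>i\<in>I. U i)"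
    using compactE_image[of C UNIV U] U by metis
  then obtain D where D: "\<forall>i\<in>I. compact (D i) \<and> D i \<subseteq> U i" "C = (\<Union>i\<in>I. D i)"
    using compact_split[OF I(1) C(1) I(2)] U by auto
  have "ennreal (m C) \<le> ennreal (\<Sum>i\<in>I. m (D i))"
    using m_UN_le[OF I(1), of D] D(2) by (simp add: ennreal_leI)
  also have "\<dots> = (\<Sum>i\<in>I. ennreal (m (D i)))"
    by (simp add: m_nonneg sum_ennreal)
  also have "\<dots> \<le> (\<Sum>i\<in>I. inner_content (U i))"
    using D by (intro sum_mono inner_content_upper) auto
  also have "\<dots> \<le> (\<Sum>i. inner_content (U i))"
    using I by (intro sum_le_suminf) auto
  finally show "ennreal (m C) \<le> (\<Sum>i. inner_content (U i))" .
qed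

lemma inner_content_finite: "inner_content U < \<infinity>"
  using inner_content_le[of U] by (simp add: ennreal_less_top le_less_trans less_top)

lemma outer_content_finite: "outer_content A < \<infinity>"
  using outer_content_mono[of A UNIV] inner_content_finite[of UNIV]
  by (simp add: outer_content_open)

lemma outer_content_approx:
  assumes "0 < (e::real)"
  shows "\<exists>U. open U \<and> A \<subseteq> U \<and> inner_content U \<le> outer_content A + ennreal e"
proof -
  have "outer_content A < outer_content A + ennreal e"
    using assms outer_content_finite[of A] by (simp add: ennreal_add_left_cancel_less)
  then show ?thesis
    unfolding outer_content_def[of A] by (subst (asm) INF_less_iff) (auto intro: less_imp_le)
qed

lemma outer_content_UN_le:
  fixes A :: "nat \<Rightarrow> 'c set"
  shows "outer_content (\<Union>i. A i) \<le> (\<Sum>i. outer_content (A i))"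
proof (rule ennreal_le_epsilon)
  fix e :: real assume e: "0 < e"
  have ex: "\<exists>U. open U \<and> A i \<subseteq> U \<and> inner_content U \<le> outer_content (A i) + ennreal (e * (1/2)^Suc i)" for i
  proof -
    have "0 < e * (1/2)^Suc i" using e by simp
    then show ?thesis by (rule outer_content_approx)
  qed
  obtain U where U0: "\<forall>i. open (U i) \<and> A i \<subseteq> U i \<and>
      inner_content (U i) \<le> outer_content (A i) + ennreal (e * (1/2)^Suc i)"
    using choice[OF allI[OF ex]] ..
  have U: "open (U i)" "A i \<subseteq> U i"
      "inner_content (U i) \<le> outer_content (A i) + ennreal (e * (1/2)^Suc i)" for i
    using U0[rule_format, of i] by simp_all
  have "outer_content (\<Union>i. A i) \<le> outer_content (\<Union>i. U i)"
    by (intro outer_content_mono UN_mono U) simp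
  also have "\<dots> = inner_content (\<Union>i. U i)" using U by (intro outer_content_open) auto
  also have "\<dots> \<le> (\<Sum>i. inner_content (U i))" by (rule inner_content_UN_le) (rule U)
  also have "\<dots> \<le> (\<Sum>i. outer_content (A i) + ennreal (e * (1/2)^Suc i))"
    by (intro suminf_le U) auto
  also have "\<dots> = (\<Sum>i. outer_content (A i)) + (\<Sum>i. ennreal (e * (1/2)^Suc i))"
    by (intro suminf_add[symmetric]) auto
  also have "(\<Sum>i. ennreal (e * (1/2)^Suc i)) = ennreal e"
  proof -
    have "(\<lambda>i. e * (1/2)^Suc i) sums (e * 1)"
      by (intro sums_mult power_half_series)
    then show ?thesis using e by (intro suminf_ennreal_eq) auto
  qed
  finally show "outer_content (\<Union>i. A i) \<le> (\<Sum>i. outer_content (A i)) + ennreal e" .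
qed

lemma outer_content_Un_le: "outer_content (A \<union> B) \<le> outer_content A + outer_content B"
proof -
  have empty: "outer_content {} = 0"
    using inner_content_le[of "{}"] by (simp add: outer_content_open m_empty)
  have *: "(\<Sum>i. outer_content ((\<lambda>i. if i = 0 then A else if i = 1 then B else {}) i))
      = (\<Sum>i<2. outer_content ((\<lambda>i::nat. if i = 0 then A else if i = 1 then B else {}) i))"
    by (rule suminf_finite) (auto simp: empty)
  have "A \<union> B = (\<Union>i::nat. if i = 0 then A else if i = 1 then B else {})"
    by (auto split: if_splits)
  then show ?thesis
    using outer_content_UN_le[of "\<lambda>i. if i = 0 then A else if i = 1 then B else {}"] *
    by (simp add: numeral_2_eq_2)
qed

lemma outer_measure_space_outer_content: "outer_measure_space (Pow UNIV) outer_content"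
proof -
  have "outer_content {} = 0"
    using inner_content_le[of "{}"] by (simp add: outer_content_open m_empty)
  then show ?thesis
    unfolding outer_measure_space_def positive_def increasing_def countably_subadditive_def
    using outer_content_mono outer_content_UN_le by simp
qed

lemma open_in_lambda_system:
  assumes V: "open V"
  shows "V \<in> lambda_system UNIV (Pow UNIV) outer_content"
proof -
  interpret sigma_algebra UNIV "Pow (UNIV::'c set)" by (rule sigma_algebra_Pow)
  have sub: "inner_content (U \<inter> V) + outer_content (U - V) \<le> inner_content U" if U: "open U" for U
  proof -
    have ne: "{C. compact C \<and> C \<subseteq> W} \<noteq> {}" for W :: "'c set" by (auto intro: exI[of _ "{}"])
    have "ennreal (m C) + outer_content (U - V) \<le> inner_content U" if C: "compact C" "C \<subseteq> U \<inter> V" for C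
    proof -
      have op: "open (U - C)" using U C compact_closed by auto
      have "ennreal (m C) + ennreal (m D) \<le> inner_content U" if D: "compact D" "D \<subseteq> U - C" for D
      proof -
        have "ennreal (m C) + ennreal (m D) = ennreal (m (C \<union> D))"
          using D by (subst m_Un) (auto simp: m_nonneg)
        also have "\<dots> \<le> inner_content U"
          using C D by (intro inner_content_upper) (auto simp: compact_Un)
        finally show ?thesis .
      qed
      then have "ennreal (m C) + inner_content (U - C) \<le> inner_content U"
        unfolding inner_content_def[of "U - C"]
        by (subst ennreal_SUP_add_right[OF ne]) (auto intro!: SUP_least)
      moreover have "outer_content (U - V) \<le> inner_content (U - C)"
        using C outer_content_mono[of "U - V" "U - C"] op by (auto simp: outer_content_open)
      ultimately show ?thesis
        by (meson add_left_mono order_trans)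
    qed
    then have "(SUP C\<in>{C. compact C \<and> C \<subseteq> U \<inter> V}. ennreal (m C) + outer_content (U - V)) \<le> inner_content U"
      by (auto intro!: SUP_least)
    then show ?thesis
      unfolding inner_content_def[of "U \<inter> V"]
      by (subst (asm) ennreal_SUP_add_left[OF ne]) auto
  qed
  have "outer_content (A \<inter> V) + outer_content (A - V) \<le> outer_content A" for A
    unfolding outer_content_def[of A]
  proof (rule INF_greatest, clarify)
    fix U assume U: "open U" "A \<subseteq> U"
    have "outer_content (A \<inter> V) \<le> inner_content (U \<inter> V)"
      using U V outer_content_mono[of "A \<inter> V" "U \<inter> V"] by (auto simp: outer_content_open open_Int)
    moreover have "outer_content (A - V) \<le> outer_content (U - V)"
      using U by (auto intro: outer_content_mono)
    ultimately show "outer_content (A \<inter> V) + outer_content (A - V) \<le> inner_content U"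
      using sub[OF U(1)] by (meson add_mono order_trans)
  qed
  moreover have "outer_content A \<le> outer_content (A \<inter> V) + outer_content (A - V)" for A
    using outer_content_Un_le[of "A \<inter> V" "A - V"] by (simp add: Int_Diff_Un)
  ultimately show ?thesis
    unfolding lambda_system_eq by (auto intro: antisym)
qed

definition content_measure :: "'c measure" where
  "content_measure = measure_of UNIV (sets borel) outer_content"

lemma space_content_measure [simp]: "space content_measure = UNIV"
  and sets_content_measure [simp, measurable_cong]: "sets content_measure = sets borel"
  using sets.sigma_sets_eq[of "borel::'c measure"]
  by (simp_all add: content_measure_def)

lemma emeasure_content_measure:
  assumes "A \<in> sets borel"
  shows "emeasure content_measure A = outer_content A"
proof (rule emeasure_measure_of[OF content_measure_def])
  interpret sigma_algebra UNIV "Pow (UNIV::'c set)" by (rule sigma_algebra_Pow)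
  have L: "measure_space UNIV (lambda_system UNIV (Pow UNIV) outer_content) outer_content"
    by (rule caratheodory_lemma) (rule outer_measure_space_outer_content)
  then interpret L: sigma_algebra UNIV "lambda_system UNIV (Pow UNIV) outer_content"
    by (simp add: measure_space_def)
  have "sets (borel::'c measure) \<subseteq> lambda_system UNIV (Pow UNIV) outer_content"
    unfolding borel_def using L.sigma_sets_subset[of "Collect open"] open_in_lambda_system by auto
  then have "measure_space UNIV (sets borel) outer_content"
    using measure_down[OF L] sets.sigma_algebra_axioms[of "borel::'c measure"] by simp
  then show "countably_additive (sets content_measure) outer_content"
    "positive (sets content_measure) outer_content"
    by (simp_all add: measure_space_def)
qed (use assms in auto)

lemma emeasure_content_measure_open: "open U \<Longrightarrow> emeasure content_measure U = inner_content U"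
  by (simp add: emeasure_content_measure outer_content_open)

lemma emeasure_content_measure_off: "emeasure content_measure (- K) = 0"
  using inner_content_le[of "- K"] compact_closed[OF compact_K] m_off
  by (simp add: emeasure_content_measure_open open_Compl)

lemma finite_measure_content_measure: "finite_measure content_measure"
  by (rule finite_measureI) (use inner_content_finite[of UNIV] in \<open>simp add: emeasure_content_measure_open less_top[symmetric]\<close>)

lemma content_measure_space: "emeasure content_measure UNIV = ennreal (m K)"
proof -
  have "m UNIV = m K" using m_Un[of K "- K"] m_off by simp
  then have "inner_content UNIV = ennreal (m K)"
    using inner_content_le[of UNIV] inner_content_upper[OF compact_K, of UNIV] by (simp add: antisym)
  then show ?thesis by (simp add: emeasure_content_measure_open)
qed

lemma K_borel [measurable]: "K \<in> sets borel"
  using compact_closed[OF compact_K] by (rule borel_closed)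

lemma measure_content_measure_open_le:
  "open U \<Longrightarrow> measure content_measure U \<le> m U"
  using emeasure_content_measure_open[of U] inner_content_le[of U] m_nonneg[of U]
  by (metis enn2real_ennreal enn2real_mono ennreal_less_top measure_def)

lemma content_measure_regular:
  assumes E: "E \<in> sets borel" "E \<subseteq> K" and e: "0 < e"
  shows "\<exists>C U. compact C \<and> C \<subseteq> E \<and> open U \<and> E \<subseteq> U \<and> measure content_measure (U - C) < e"
proof -
  interpret finite_measure content_measure by (rule finite_measure_content_measure)
  have out: "\<exists>U. open U \<and> A \<subseteq> U \<and> measure content_measure (U - A) \<le> e / 3" if A: "A \<in> sets borel" for A
  proof -
    obtain U where U: "open U" "A \<subseteq> U" "inner_content U \<le> outer_content A + ennreal (e/3)"
      using outer_content_approx[of "e/3" A] e by (meson zero_less_divide_iff zero_less_numeral)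
    then have "emeasure content_measure U \<le> emeasure content_measure A + ennreal (e/3)"
      using A by (simp add: emeasure_content_measure outer_content_open)
    then have "measure content_measure U \<le> measure content_measure A + e/3"
      using e unfolding emeasure_eq_measure
      by (simp flip: ennreal_plus)
    then show ?thesis
      using U A finite_measure_Diff[of U A] by (intro exI[of _ U]) auto
  qed
  obtain U where U: "open U" "E \<subseteq> U" "measure content_measure (U - E) \<le> e / 3" using out E by blast
  obtain V where V: "open V" "K - E \<subseteq> V" "measure content_measure (V - (K - E)) \<le> e / 3"
    using out[of "K - E"] E by auto
  have "compact (K - V)" using compact_K V by (auto intro: compact_diff)
  moreover have "K - V \<subseteq> E" using V by auto
  moreover have "measure content_measure (U - (K - V)) \<le> measure content_measure ((U - E) \<union> (V - (K - E)))"
    using E V U by (intro finite_measure_mono) auto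
  moreover have "\<dots> \<le> e / 3 + e / 3"
    using E U V measure_Un_le[of "U - E" content_measure "V - (K - E)"] by auto
  ultimately show ?thesis using U e by (intro exI[of _ "K - V"] exI[of _ U]) auto
qed

text \<open>The integral is compared with a layer-cake sum. Only one inequality is available here, as the
  measure of an open set is merely bounded by its content; passing to \<open>B - f\<close> gives the other.\<close>

lemma integral_content_measure_le:
  fixes f :: "'c \<Rightarrow> real"
  assumes f: "continuous_on UNIV f" and B: "0 \<le> B" and fB: "\<And>z. z \<in> K \<Longrightarrow> 0 \<le> f z \<and> f z \<le> B"
    and I: "\<And>n. 0 < n \<Longrightarrow> (\<Sum>i<n. m {z. f z > real (Suc i) * (B / n)}) * (B / n) \<le> I"
  shows "(\<integral>z. f z * indicator K z \<partial>content_measure) \<le> I"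
proof -
  interpret finite_measure content_measure by (rule finite_measure_content_measure)
  let ?M = "measure content_measure UNIV"
  have fm[measurable]: "f \<in> borel_measurable borel" using f by (rule borel_measurable_continuous_onI)
  have le: "(\<integral>z. f z * indicator K z \<partial>content_measure) \<le> B * ?M / real n + I" if n: "0 < n" for n :: nat
  proof -
    let ?U = "\<lambda>i. {z. f z > real (Suc i) * (B / n)}"
    have op: "open (?U i)" for i
      using f by (intro open_Collect_less) auto
    have pt: "f z * indicator K z \<le> B / n + (\<Sum>i<n. indicator (?U i) z) * (B / n)" for z
    proof (cases "z \<in> K \<and> 0 < B")
      case True
      define k where "k = nat (\<lceil>f z * n / B\<rceil> - 1)"
      have fz: "0 \<le> f z" "f z \<le> B" using fB True by auto
      have kn: "real k < f z * n / B \<or> k = 0" unfolding k_def by linarith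
      have kn2: "f z * n / B \<le> real k + 1" unfolding k_def using fz True by linarith
      have "k \<le> n"
      proof -
        have "f z * n / B \<le> n" using fz True n by (simp add: field_simps mult_right_mono)
        then show ?thesis using kn by linarith
      qed
      have "{..<k} \<subseteq> {i. i < n \<and> z \<in> ?U i}"
      proof clarsimp
        fix i assume i: "i < k"
        have "real (Suc i) \<le> real k" using i by simp
        also have "\<dots> < f z * n / B" using kn i by auto
        finally have "(1 + real i) * B < f z * n" using True by (simp add: field_simps)
        then show "i < n \<and> (1 + real i) * B / real n < f z" using i \<open>k \<le> n\<close> n by (simp add: field_simps)
      qed
      then have "card {..<k} \<le> card {i. i < n \<and> z \<in> ?U i}"
        by (intro card_mono) auto
      then have "real k \<le> (\<Sum>i<n. indicator (?U i) z)"
        by (simp add: indicator_def sum.If_cases Int_def lessThan_def)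
      then have "f z * n / B \<le> (\<Sum>i<n. indicator (?U i) z) + 1" using kn2 by linarith
      then show ?thesis using True n by (simp add: field_simps)
    next
      case False
      then have "f z * indicator K z \<le> 0" using fB[of z] B by (auto simp: indicator_def)
      moreover have "0 \<le> B / n + (\<Sum>i<n. indicator (?U i) z) * (B / n)"
        using B by (intro add_nonneg_nonneg mult_nonneg_nonneg sum_nonneg) auto
      ultimately show ?thesis by linarith
    qed
    have "(\<integral>z. f z * indicator K z \<partial>content_measure)
        \<le> (\<integral>z. B / n + (\<Sum>i<n. indicator (?U i) z) * (B / n) \<partial>content_measure)"
    proof (rule integral_mono[OF _ _ pt])
      show "integrable content_measure (\<lambda>z. f z * indicator K z)"
        using fB B by (intro integrable_const_bound[of _ B]) (auto simp: indicator_def)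
      show "integrable content_measure (\<lambda>z. B / n + (\<Sum>i<n. indicator (?U i) z) * (B / n))"
        using op by (auto intro!: integrable_real_indicator simp: less_top[symmetric])
    qed
    also have "\<dots> = B / n * ?M + (\<Sum>i<n. measure content_measure (?U i)) * (B / n)"
      using op by (subst Bochner_Integration.integral_add) (auto intro!: integrable_real_indicator simp: less_top[symmetric])
    also have "\<dots> \<le> B / n * ?M + (\<Sum>i<n. m (?U i)) * (B / n)"
      using op B by (intro add_left_mono mult_right_mono sum_mono measure_content_measure_open_le) auto
    also have "\<dots> \<le> B / n * ?M + I" using I[OF n] by simp
    finally show ?thesis by simp
  qed
  have "(\<lambda>n. B * ?M / real n + I) \<longlonglongrightarrow> 0 + I"
    by (intro tendsto_add tendsto_const lim_const_over_n)
  then show ?thesis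
    using le by (intro LIMSEQ_le_const[of _ I]) (auto intro: exI[of _ 1])
qed

end

lemma layer_sum_le:
  assumes "0 \<le> (h::real)" "0 \<le> t"
  shows "(\<Sum>i<n. if t > real (Suc i) * h then 1 else 0) * h \<le> t"
proof (induction n)
  case (Suc n)
  show ?case
  proof (cases "t > real (Suc n) * h")
    case True
    have "(\<Sum>i<Suc n. if t > real (Suc i) * h then 1 else 0) \<le> (\<Sum>i<Suc n. 1 :: real)"
      by (rule sum_mono) auto
    then have "(\<Sum>i<Suc n. if t > real (Suc i) * h then 1 else 0) * h \<le> real (Suc n) * h"
      using assms(1) by (intro mult_right_mono) auto
    then show ?thesis using True by linarith
  next
    case False
    then show ?thesis using Suc by simp
  qed
qed (use assms in simp)

definition point_sum :: "(real \<times> 'c) list \<Rightarrow> ('c \<Rightarrow> 'v::real_vector) \<Rightarrow> 'v" where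
  "point_sum ps f = (\<Sum>(a, z)\<leftarrow>ps. a *\<^sub>R f z)"

lemma point_sum_add: "point_sum ps (\<lambda>z. f z + g z) = point_sum ps f + point_sum ps g"
  and point_sum_diff: "point_sum ps (\<lambda>z. f z - g z) = point_sum ps f - point_sum ps g"
  and point_sum_mult: "point_sum ps (\<lambda>z. f' z * c) = point_sum ps f' * (c::real)"
  unfolding point_sum_def
  by (induction ps) (auto simp: algebra_simps)

lemma point_sum_zero: "point_sum ps (\<lambda>z. 0) = 0"
  unfolding point_sum_def by (induction ps) auto

lemma point_sum_sum: "point_sum ps (\<lambda>z. \<Sum>i\<in>I. f i z) = (\<Sum>i\<in>I. point_sum ps (f i))"
  by (induction I rule: infinite_finite_induct) (simp_all add: point_sum_add point_sum_zero)

lemma point_sum_mono: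
  "(\<And>a z. (a, z) \<in> set ps \<Longrightarrow> 0 \<le> a \<and> f z \<le> g z) \<Longrightarrow> point_sum ps f \<le> (point_sum ps g :: real)"
  unfolding point_sum_def by (induction ps) (auto intro!: add_mono mult_left_mono)

lemma point_sum_linear: "linear l \<Longrightarrow> l (point_sum ps f) = point_sum ps (\<lambda>z. l (f z))"
  unfolding point_sum_def by (induction ps) (auto simp: linear_0 linear_add linear_scale)

lemma weak_star_cluster_measure:
  fixes K :: "'c::topological_space set" and ps :: "nat \<Rightarrow> (real \<times> 'c) list"
  assumes haus: "Hausdorff_space (euclidean :: 'c topology)" and K: "compact K"
    and ps: "\<And>k a z. (a, z) \<in> set (ps k) \<Longrightarrow> 0 \<le> a \<and> z \<in> K"
    and mass: "\<And>k. point_sum (ps k) (\<lambda>_. 1) \<le> c + 1 / real (Suc k)"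
  obtains M :: "'c measure" where "sets M = sets borel" "finite_measure M" "measure M UNIV \<le> c"
    "emeasure M (- K) = 0" "K \<in> sets borel"
    "\<And>A \<epsilon>. A \<in> sets borel \<Longrightarrow> A \<subseteq> K \<Longrightarrow> 0 < \<epsilon> \<Longrightarrow>
      \<exists>C U. compact C \<and> C \<subseteq> A \<and> open U \<and> A \<subseteq> U \<and> measure M (U - C) < \<epsilon>"
    "\<And>(f :: 'c \<Rightarrow> real) B I. continuous_on UNIV f \<Longrightarrow> \<forall>z\<in>K. \<bar>f z\<bar> \<le> B \<Longrightarrow>
      (\<lambda>k. point_sum (ps k) f) \<longlonglongrightarrow> I \<Longrightarrow> (\<integral>z. f z * indicator K z \<partial>M) = I"
proof -
  define \<phi> where "\<phi> k A = point_sum (ps k) (indicator A :: 'c \<Rightarrow> real)" for k and A :: "'c set"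
  have nn: "0 \<le> \<phi> k A" for k A
    unfolding \<phi>_def point_sum_def using ps by (intro sum_list_nonneg) (fastforce simp: indicator_def)
  have \<phi>_le: "\<phi> k A \<le> c + 1 / real (Suc k)" for k A
    unfolding \<phi>_def using ps by (intro order_trans[OF point_sum_mono mass]) (auto simp: indicator_def)
  have \<phi>_le': "\<phi> k A \<le> c + 1" for k A
    using \<phi>_le[of k A] by (rule order_trans) (simp add: field_simps)
  let ?U = "PiE UNIV (\<lambda>_. {0..c + 1}) :: ('c set \<Rightarrow> real) set"
  have "compactin (product_topology (\<lambda>i. euclidean) UNIV) ?U"
    by (subst compactin_PiE) simp
  then have "compact ?U" by (simp add: euclidean_product_topology)
  moreover have "filtermap \<phi> sequentially \<noteq> bot" by (simp add: filtermap_bot_iff)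
  moreover have "eventually (\<lambda>x. x \<in> ?U) (filtermap \<phi> sequentially)"
    using nn \<phi>_le' by (simp add: eventually_filtermap PiE_iff)
  ultimately obtain m where mU: "m \<in> ?U" and m: "inf (nhds m) (filtermap \<phi> sequentially) \<noteq> bot"
    unfolding compact_filter by blast
  define H where "H = inf (filtercomap \<phi> (nhds m)) sequentially"
  have H: "H \<noteq> bot"
  proof
    assume "H = bot"
    then have "eventually (\<lambda>_. False) H" by simp
    then obtain Q R where QR: "eventually Q (filtercomap \<phi> (nhds m))" "eventually R sequentially" "\<And>x. Q x \<Longrightarrow> R x \<Longrightarrow> False"
      unfolding H_def eventually_inf by blast
    obtain Q' where Q': "eventually Q' (nhds m)" "\<And>x. Q' (\<phi> x) \<Longrightarrow> Q x"
      using QR(1) unfolding eventually_filtercomap by blast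
    have "eventually (\<lambda>y. \<exists>x. y = \<phi> x \<and> R x) (filtermap \<phi> sequentially)"
      unfolding eventually_filtermap using QR(2) by eventually_elim blast
    then have "eventually (\<lambda>_. False) (inf (nhds m) (filtermap \<phi> sequentially))"
      unfolding eventually_inf using Q' QR(3) by blast
    then show False using m by simp
  qed
  have H_seq: "H \<le> sequentially" by (simp add: H_def)
  have lim: "((\<lambda>k. \<phi> k A) \<longlongrightarrow> m A) H" for A
  proof -
    have \<phi>m: "filterlim \<phi> (nhds m) H" unfolding filterlim_iff_le_filtercomap H_def by simp
    show ?thesis
    proof (rule topological_tendstoI)
      fix S :: "real set" assume S: "open S" "m A \<in> S"
      have "open ((\<lambda>g. g A) -` S)"
        using S(1) continuous_on_product_coordinates by (rule open_vimage)
      then have "eventually (\<lambda>g. g A \<in> S) (nhds m)"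
        using S(2) unfolding eventually_nhds by (intro exI[of _ "(\<lambda>g. g A) -` S"]) auto
      then show "eventually (\<lambda>k. \<phi> k A \<in> S) H"
        using \<phi>m unfolding filterlim_iff by blast
    qed
  qed
  interpret finitely_additive_content K m
  proof
    show "0 \<le> m A" for A using mU by (auto simp: PiE_iff)
    show "m (A \<union> B) = m A + m B" if "A \<inter> B = {}" for A B
    proof -
      have "\<phi> k (A \<union> B) = \<phi> k A + \<phi> k B" for k
        unfolding \<phi>_def point_sum_add[symmetric] using that
        by (intro arg_cong[where f="point_sum _"] ext) (auto simp: indicator_def)
      then have "((\<lambda>k. \<phi> k (A \<union> B)) \<longlongrightarrow> m A + m B) H"
        by (simp add: tendsto_add lim)
      then show ?thesis using tendsto_unique[OF H lim] by blast
    qed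
    have "\<phi> k (- K) = 0" for k
    proof -
      have "\<phi> k (- K) \<le> point_sum (ps k) (\<lambda>_. 0)"
        unfolding \<phi>_def by (intro point_sum_mono) (use ps in auto)
      also have "\<dots> = 0" by (rule point_sum_zero)
      finally show ?thesis using nn[of k "- K"] by simp
    qed
    then show "m (- K) = 0" using tendsto_unique[OF H lim[of "- K"]] by simp
  qed (use haus K in auto)
  interpret finite_measure content_measure by (rule finite_measure_content_measure)
  have mK: "measure content_measure UNIV = m K"
    using content_measure_space m_nonneg[of K] by (simp add: measure_def)
  have \<phi>K: "\<phi> k K = point_sum (ps k) (\<lambda>_. 1)" for k
    unfolding \<phi>_def point_sum_def
    by (intro arg_cong[where f=sum_list] map_cong refl) (use ps in \<open>auto simp: indicator_def\<close>)
  have upper: "(\<integral>z. f z * indicator K z \<partial>content_measure) \<le> I"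
    if f: "continuous_on UNIV f" and B: "0 \<le> B" and fB: "\<And>z. z \<in> K \<Longrightarrow> 0 \<le> f z \<and> f z \<le> B"
      and I: "((\<lambda>k. point_sum (ps k) f) \<longlongrightarrow> I) H" for f :: "'c \<Rightarrow> real" and B I
  proof (rule integral_content_measure_le[OF f B fB])
    fix n :: nat assume n: "0 < n"
    let ?S = "\<lambda>i. {z. f z > real (Suc i) * (B / n)}"
    show "(\<Sum>i<n. m (?S i)) * (B / n) \<le> I"
    proof (rule tendsto_le[OF H I])
      show "((\<lambda>k. (\<Sum>i<n. \<phi> k (?S i)) * (B / n)) \<longlongrightarrow> (\<Sum>i<n. m (?S i)) * (B / n)) H"
        by (intro tendsto_mult tendsto_sum lim tendsto_const)
      show "\<forall>\<^sub>F k in H. (\<Sum>i<n. \<phi> k (?S i)) * (B / n) \<le> point_sum (ps k) f"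
      proof (intro always_eventually allI)
        fix k
        have "(\<Sum>i<n. \<phi> k (?S i)) * (B / n) = point_sum (ps k) (\<lambda>z. (\<Sum>i<n. indicator (?S i) z) * (B / n))"
          unfolding \<phi>_def by (simp only: point_sum_mult point_sum_sum)
        also have "\<dots> \<le> point_sum (ps k) f"
        proof (rule point_sum_mono)
          fix a z assume "(a, z) \<in> set (ps k)"
          then have "0 \<le> a" "z \<in> K" using ps by auto
          moreover have "(\<Sum>i<n. indicator (?S i) z) = (\<Sum>i<n. if f z > real (Suc i) * (B / n) then 1 else (0::real))"
            by (intro sum.cong refl) (simp add: indicator_def)
          ultimately show "0 \<le> a \<and> (\<Sum>i<n. indicator (?S i) z) * (B / n) \<le> f z"
            using layer_sum_le[of "B / n" "f z" n] fB[of z] B by (simp only:) simp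
        qed
        finally show "(\<Sum>i<n. \<phi> k (?S i)) * (B / n) \<le> point_sum (ps k) f" .
      qed
    qed
  qed simp_all
  show ?thesis
  proof (rule that[of content_measure])
    show "measure content_measure UNIV \<le> c"
      unfolding mK
    proof (rule tendsto_le[OF H _ lim])
      have "(\<lambda>k. c + 1 / real (Suc k)) \<longlonglongrightarrow> c + 0"
        by (intro tendsto_add tendsto_const LIMSEQ_Suc[OF lim_1_over_n])
      then show "((\<lambda>k. c + 1 / real (Suc k)) \<longlongrightarrow> c) H"
        using tendsto_mono[OF H_seq] by simp
    qed (intro always_eventually allI \<phi>_le)
    show "emeasure content_measure (- K) = 0" by (rule emeasure_content_measure_off)
    show "\<exists>C U. compact C \<and> C \<subseteq> A \<and> open U \<and> A \<subseteq> U \<and> measure content_measure (U - C) < \<epsilon>"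
      if "A \<in> sets borel" "A \<subseteq> K" "0 < \<epsilon>" for A \<epsilon>
      by (rule content_measure_regular[OF that])
    show "(\<integral>z. f z * indicator K z \<partial>content_measure) = I"
      if f: "continuous_on UNIV f" and fB: "\<forall>z\<in>K. \<bar>f z\<bar> \<le> B"
        and I: "(\<lambda>k. point_sum (ps k) f) \<longlonglongrightarrow> I" for f :: "'c \<Rightarrow> real" and B I
    proof -
      define D where "D = \<bar>B\<bar>"
      have D: "0 \<le> D" "\<And>z. z \<in> K \<Longrightarrow> \<bar>f z\<bar> \<le> D" using fB by (simp_all add: D_def) (meson abs_ge_self order_trans)
      have [measurable]: "f \<in> borel_measurable borel" using f by (rule borel_measurable_continuous_onI)
      have if1: "integrable content_measure (\<lambda>z. f z * indicator K z)"
        using D by (intro integrable_const_bound[of _ D]) (auto simp: indicator_def)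
      have i1: "integrable content_measure (\<lambda>z. D * indicator K z)"
        by (intro integrable_mult_right integrable_real_indicator) (auto simp: less_top[symmetric])
      have iK: "(\<integral>z. D * indicator K z \<partial>content_measure) = D * m K"
      proof -
        have "measure content_measure K = measure content_measure UNIV"
          using finite_measure_compl[of "- K"] emeasure_content_measure_off
          by (simp add: measure_def Compl_eq_Diff_UNIV[symmetric])
        then show ?thesis by (simp add: mK)
      qed
      have IH: "((\<lambda>k. point_sum (ps k) f) \<longlongrightarrow> I) H" using tendsto_mono[OF H_seq I] .
      have c1: "((\<lambda>k. point_sum (ps k) (\<lambda>_. D)) \<longlongrightarrow> D * m K) H"
      proof -
        have "point_sum (ps k) (\<lambda>_. D) = D * \<phi> k K" for k
          using point_sum_mult[of "ps k" "\<lambda>_. 1" D] by (simp add: \<phi>K mult.commute)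
        then show ?thesis by (simp add: tendsto_mult lim)
      qed
      have "(\<integral>z. (f z + D) * indicator K z \<partial>content_measure) \<le> I + D * m K"
      proof (rule upper[where B="2 * D"])
        show "((\<lambda>k. point_sum (ps k) (\<lambda>z. f z + D)) \<longlongrightarrow> I + D * m K) H"
          unfolding point_sum_add by (intro tendsto_add IH c1)
        show "continuous_on UNIV (\<lambda>z. f z + D)" by (intro continuous_intros f)
        show "0 \<le> f z + D \<and> f z + D \<le> 2 * D" if "z \<in> K" for z using D(2)[OF that] by linarith
      qed (use D in simp)
      moreover have "(\<integral>z. (D - f z) * indicator K z \<partial>content_measure) \<le> D * m K - I"
      proof (rule upper[where B="2 * D"])
        show "((\<lambda>k. point_sum (ps k) (\<lambda>z. D - f z)) \<longlongrightarrow> D * m K - I) H"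
          unfolding point_sum_diff by (intro tendsto_diff IH c1)
        show "continuous_on UNIV (\<lambda>z. D - f z)" by (intro continuous_intros f)
        show "0 \<le> D - f z \<and> D - f z \<le> 2 * D" if "z \<in> K" for z using D(2)[OF that] by linarith
      qed (use D in simp)
      moreover have "(\<integral>z. (f z + D) * indicator K z \<partial>content_measure) = (\<integral>z. f z * indicator K z \<partial>content_measure) + D * m K"
        using Bochner_Integration.integral_add[OF if1 i1] iK by (simp add: distrib_right)
      moreover have "(\<integral>z. (D - f z) * indicator K z \<partial>content_measure) = D * m K - (\<integral>z. f z * indicator K z \<partial>content_measure)"
        using Bochner_Integration.integral_diff[OF i1 if1] iK by (simp add: left_diff_distrib)
      ultimately show ?thesis by linarith
    qed
  qed (auto intro: finite_measure_axioms)
qed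

section \<open>Scalars, dual and bidual\<close>

lemma scalar_coordinates:
  obtains \<rho> \<sigma> :: "'k::real_or_complex \<Rightarrow> real" and e :: 'k
  where "bounded_linear \<rho>" "bounded_linear \<sigma>" "\<And>x. x = \<rho> x *\<^sub>R 1 + \<sigma> x *\<^sub>R e"
    "\<And>x. \<bar>\<rho> x\<bar> \<le> norm x" "\<And>x. \<bar>\<sigma> x\<bar> \<le> norm x"
  using real_or_complex[where 'a='k]
proof (elim disjE exE conjE)
  fix h :: "'k \<Rightarrow> real"
  assume h: "bij h" "\<forall>x y. h (x + y) = h x + h y" "\<forall>x y. h (x * y) = h x * h y"
    "\<forall>r. h (r *\<^sub>R 1) = of_real r" "\<forall>x. norm (h x) = norm x"
  have hr: "h (r *\<^sub>R x) = r * h x" for r x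
    using h(3)[rule_format, of "r *\<^sub>R 1" x] h(4) by simp
  show thesis
  proof (rule that[of h "\<lambda>_. 0" 0])
    show "bounded_linear h"
      by (rule bounded_linear_intro[of _ 1]) (use h hr in auto)
    show "x = h x *\<^sub>R 1 + 0 *\<^sub>R 0" for x
      using h(1) h(4)[rule_format, of "h x"] by (simp add: bij_def inj_eq)
  qed (use h in auto)
next
  fix h :: "'k \<Rightarrow> complex"
  assume h: "bij h" "\<forall>x y. h (x + y) = h x + h y" "\<forall>x y. h (x * y) = h x * h y"
    "\<forall>r. h (r *\<^sub>R 1) = of_real r" "\<forall>x. norm (h x) = norm x"
  have hr: "h (r *\<^sub>R x) = r *\<^sub>R h x" for r x
    using h(3)[rule_format, of "r *\<^sub>R 1" x] h(4) by (simp add: scaleR_conv_of_real)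
  have bl: "bounded_linear h"
    by (rule bounded_linear_intro[of _ 1]) (use h hr in auto)
  define e where "e = inv h \<i>"
  have e: "h e = \<i>" using h(1) by (simp add: e_def bij_is_surj surj_f_inv_f)
  show thesis
  proof (rule that[of "\<lambda>x. Re (h x)" "\<lambda>x. Im (h x)" e])
    show "bounded_linear (\<lambda>x. Re (h x))" "bounded_linear (\<lambda>x. Im (h x))"
      using bl by (auto intro: bounded_linear_compose bounded_linear_Re bounded_linear_Im)
    show "x = Re (h x) *\<^sub>R 1 + Im (h x) *\<^sub>R e" for x
    proof -
      have "h x = h (Re (h x) *\<^sub>R 1 + Im (h x) *\<^sub>R e)"
        using h(2,4) by (simp add: hr e complex_eq_iff)
      then show ?thesis using h(1) by (simp add: bij_def inj_eq)
    qed
    show "\<bar>Re (h x)\<bar> \<le> norm x" "\<bar>Im (h x)\<bar> \<le> norm x" for x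
      using abs_Re_le_cmod[of "h x"] abs_Im_le_cmod[of "h x"] h(5) by auto
  qed
qed

lemma compact_scalar_cball: "compact (cball (0::'k::real_or_complex) r)"
proof -
  obtain \<rho> \<sigma> :: "'k \<Rightarrow> real" and e where c: "\<And>x. x = \<rho> x *\<^sub>R 1 + \<sigma> x *\<^sub>R e"
    "\<And>x. \<bar>\<rho> x\<bar> \<le> norm x" "\<And>x. \<bar>\<sigma> x\<bar> \<le> norm x"
    using scalar_coordinates by metis
  let ?g = "\<lambda>(a, b). a *\<^sub>R 1 + b *\<^sub>R e"
  have "compact (?g ` ({-r..r} \<times> {-r..r}))"
    by (intro compact_continuous_image compact_Times compact_Icc)
      (auto intro!: continuous_intros simp: case_prod_beta)
  moreover have "cball 0 r \<subseteq> ?g ` ({-r..r} \<times> {-r..r})"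
  proof
    fix x :: 'k assume "x \<in> cball 0 r"
    then have "\<bar>\<rho> x\<bar> \<le> r" "\<bar>\<sigma> x\<bar> \<le> r" using c(2,3)[of x] by auto
    then show "x \<in> ?g ` ({-r..r} \<times> {-r..r})"
      using c(1)[of x] by (intro image_eqI[of _ _ "(\<rho> x, \<sigma> x)"]) auto
  qed
  ultimately show ?thesis
    using compact_Int_closed[OF _ closed_cball[of 0 r]] by (metis inf.absorb2)
qed

lemma vector_space_scalar: "vector_space ((*) :: 'k::field \<Rightarrow> 'k \<Rightarrow> 'k)"
  by unfold_locales (auto simp: algebra_simps)

lemma dual_scale_apply [simp]: "blinfun_apply (dual_scale c f) x = c * blinfun_apply f x"
  unfolding dual_scale_def
  by (simp add: bounded_linear_Blinfun_apply bounded_linear_mult_right bounded_linear_compose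
      blinfun.bounded_linear_right)

lemma vector_space_dual_scale: "vector_space (dual_scale :: 'k::real_or_complex \<Rightarrow> ('a::banach \<Rightarrow>\<^sub>L 'k) \<Rightarrow> _)"
  by unfold_locales (auto intro!: blinfun_eqI simp: algebra_simps blinfun.bilinear_simps)

interpretation dual: vector_space "dual_scale :: 'k::real_or_complex \<Rightarrow> ('a::banach \<Rightarrow>\<^sub>L 'k) \<Rightarrow> _"
  by (rule vector_space_dual_scale)

lemma dual_scale_of_real: "dual_scale (of_real r) f = r *\<^sub>R f"
  by (rule blinfun_eqI) (simp add: blinfun.bilinear_simps scaleR_conv_of_real)

lemma norm_dual_scale:
  fixes c :: "'k::real_or_complex" and f :: "'a::banach \<Rightarrow>\<^sub>L 'k"
  shows "norm (dual_scale c f) = norm c * norm f"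
proof (rule antisym)
  show le: "norm (dual_scale c f) \<le> norm c * norm f" for c :: 'k and f :: "'a \<Rightarrow>\<^sub>L 'k"
    by (rule norm_blinfun_bound)
      (auto simp: norm_mult mult.assoc intro!: mult_left_mono norm_blinfun)
  show "norm c * norm f \<le> norm (dual_scale c f)"
    using le[of "inverse c" "dual_scale c f"]
    by (cases "c = 0") (auto simp: norm_divide field_simps)
qed

context banach_space_over begin

lemma dual_space_iff:
  "f \<in> dual_space s \<longleftrightarrow> (\<forall>c x. blinfun_apply f (s c x) = c * blinfun_apply f x)"
  unfolding dual_space_def Vector_Spaces.linear_iff
  by (auto simp: blinfun.bilinear_simps vector_space_scalar vector_space_axioms)

lemma dual_apply_scale: "f \<in> dual_space s \<Longrightarrow> blinfun_apply f (s c x) = c * blinfun_apply f x"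
  by (simp add: dual_space_iff)

lemma dual_space_0 [intro, simp]: "0 \<in> dual_space s"
  and dual_space_add [intro]: "f \<in> dual_space s \<Longrightarrow> g \<in> dual_space s \<Longrightarrow> f + g \<in> dual_space s"
  and dual_space_diff [intro]: "f \<in> dual_space s \<Longrightarrow> g \<in> dual_space s \<Longrightarrow> f - g \<in> dual_space s"
  and dual_space_scale [intro]: "f \<in> dual_space s \<Longrightarrow> dual_scale c f \<in> dual_space s"
  by (auto simp: dual_space_iff blinfun.bilinear_simps algebra_simps)

lemma dual_space_scaleR [intro]: "f \<in> dual_space s \<Longrightarrow> r *\<^sub>R f \<in> dual_space s"
  using dual_space_scale[of f "of_real r"] by (simp add: dual_scale_of_real)

lemma dual_space_sum [intro]: "(\<And>i. i \<in> I \<Longrightarrow> f i \<in> dual_space s) \<Longrightarrow> sum f I \<in> dual_space s"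
  by (induction I rule: infinite_finite_induct) auto

lemma bounded_linear_scale: "bounded_linear (s c)"
proof (rule bounded_linear_intro[of _ "norm c"])
  show "s c (r *\<^sub>R x) = r *\<^sub>R s c x" for r x
    by (simp add: scale_of_real[symmetric] mult.commute)
qed (auto simp: scale_right_distrib norm_scale)

lemma bidual_ball_iff:
  "\<xi> \<in> bidual_ball s \<longleftrightarrow>
     (\<forall>f\<in>dual_space s. \<forall>g\<in>dual_space s. \<xi> (f + g) = \<xi> f + \<xi> g) \<and>
     (\<forall>c. \<forall>f\<in>dual_space s. \<xi> (dual_scale c f) = c * \<xi> f) \<and>
     (\<forall>f\<in>dual_space s. norm (\<xi> f) \<le> norm f) \<and>
     (\<forall>f. f \<notin> dual_space s \<longrightarrow> \<xi> f = 0)" (is "?L \<longleftrightarrow> ?A \<and> ?S \<and> ?N \<and> ?Z")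
proof (intro iffI conjI)
  assume L: ?L
  then show A: ?A and S: ?S and Z: ?Z by (auto simp: bidual_ball_def bidual_def)
  obtain C where C: "\<And>f. f \<in> dual_space s \<Longrightarrow> norm (\<xi> f) \<le> C * norm f"
    using L unfolding bidual_ball_def bidual_def by blast
  have bdd: "bdd_above ((\<lambda>f. norm (\<xi> f)) ` {f \<in> dual_space s. norm f \<le> 1})"
  proof (rule bdd_aboveI2)
    fix f :: "'a \<Rightarrow>\<^sub>L 'k" assume f: "f \<in> {f \<in> dual_space s. norm f \<le> 1}"
    then have "norm (\<xi> f) \<le> C * norm f" using C by simp
    also have "\<dots> \<le> \<bar>C\<bar> * 1" using f by (intro mult_mono) auto
    finally show "norm (\<xi> f) \<le> \<bar>C\<bar>" by simp
  qed
  show ?N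
  proof
    fix f assume f: "f \<in> dual_space s"
    show "norm (\<xi> f) \<le> norm f"
    proof (cases "f = 0")
      case True
      then show ?thesis using S[rule_format, of f 0] f by simp
    next
      case False
      let ?r = "inverse (norm f)"
      have "norm (\<xi> (dual_scale (of_real ?r) f)) \<le> bidual_norm s \<xi>"
        unfolding bidual_norm_def using f False bdd
        by (intro cSUP_upper) (auto simp: norm_dual_scale norm_inverse dual_space_scale)
      also have "\<dots> \<le> 1" using L by (simp add: bidual_ball_def)
      finally have "?r * norm (\<xi> f) \<le> 1" using f S by (simp add: norm_mult norm_inverse)
      then show ?thesis using False by (simp add: field_simps)
    qed
  qed
next
  assume *: "?A \<and> ?S \<and> ?N \<and> ?Z"
  then have "\<xi> \<in> bidual s"
    unfolding bidual_def by (auto intro!: exI[of _ 1])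
  moreover have "bidual_norm s \<xi> \<le> 1"
    unfolding bidual_norm_def using *
    by (intro cSUP_least) (auto intro: exI[of _ 0] order_trans)
  ultimately show ?L by (simp add: bidual_ball_def)
qed

lemma bidual_add: "\<xi> \<in> bidual_ball s \<Longrightarrow> f \<in> dual_space s \<Longrightarrow> g \<in> dual_space s \<Longrightarrow> \<xi> (f + g) = \<xi> f + \<xi> g"
  and bidual_scale: "\<xi> \<in> bidual_ball s \<Longrightarrow> f \<in> dual_space s \<Longrightarrow> \<xi> (dual_scale c f) = c * \<xi> f"
  and bidual_le: "\<xi> \<in> bidual_ball s \<Longrightarrow> f \<in> dual_space s \<Longrightarrow> norm (\<xi> f) \<le> norm f"
  unfolding bidual_ball_iff by blast+

lemma bidual_zero: "\<xi> \<in> bidual_ball s \<Longrightarrow> \<xi> 0 = 0"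
  using bidual_le[of \<xi> 0] by simp

lemma bidual_diff:
  "\<xi> \<in> bidual_ball s \<Longrightarrow> f \<in> dual_space s \<Longrightarrow> g \<in> dual_space s \<Longrightarrow> \<xi> (f - g) = \<xi> f - \<xi> g"
  using bidual_add[of \<xi> "f - g" g] by (simp add: dual_space_diff)

lemma bidual_sum:
  "\<xi> \<in> bidual_ball s \<Longrightarrow> (\<And>i. i \<in> I \<Longrightarrow> f i \<in> dual_space s) \<Longrightarrow> \<xi> (sum f I) = (\<Sum>i\<in>I. \<xi> (f i))"
  by (induction I rule: infinite_finite_induct) (auto simp: bidual_zero bidual_add dual_space_sum)

lemma functional_sum_list:
  assumes "\<And>f g. f \<in> dual_space s \<Longrightarrow> g \<in> dual_space s \<Longrightarrow> A (f + g) = A f + A g"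
    and "\<And>c f. f \<in> dual_space s \<Longrightarrow> A (dual_scale c f) = c * (A f :: 'k)"
    and "\<And>i. i \<in> set L \<Longrightarrow> f i \<in> dual_space s"
  shows "(\<Sum>i\<leftarrow>L. f i) \<in> dual_space s \<and> A (\<Sum>i\<leftarrow>L. f i) = (\<Sum>i\<leftarrow>L. A (f i))"
  using assms(3)
proof (induction L)
  case Nil
  then show ?case using assms(2)[of 0 0] by auto
qed (use assms(1) in auto)

lemma bidual_sum_list:
  "\<xi> \<in> bidual_ball s \<Longrightarrow> (\<And>i. i \<in> set L \<Longrightarrow> f i \<in> dual_space s) \<Longrightarrow>
    (\<Sum>i\<leftarrow>L. f i) \<in> dual_space s \<and> \<xi> (\<Sum>i\<leftarrow>L. f i) = (\<Sum>i\<leftarrow>L. \<xi> (f i))"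
  by (rule functional_sum_list) (auto simp: bidual_add bidual_scale)

lemma compact_bidual_ball: "compact (bidual_ball s)"
proof -
  let ?B = "\<lambda>f. cball (0::'k) (norm f)"
  have "compactin (product_topology (\<lambda>i. euclidean) UNIV) (PiE UNIV ?B)"
    by (subst compactin_PiE) (simp add: compact_scalar_cball)
  then have cmp: "compact (PiE UNIV ?B :: (('a \<Rightarrow>\<^sub>L 'k) \<Rightarrow> 'k) set)"
    by (simp add: euclidean_product_topology)
  have eq: "bidual_ball s = PiE UNIV ?B \<inter>
     ((\<Inter>f\<in>dual_space s. \<Inter>g\<in>dual_space s. {\<xi>. \<xi> (f + g) = \<xi> f + \<xi> g}) \<inter>
      (\<Inter>c. \<Inter>f\<in>dual_space s. {\<xi>. \<xi> (dual_scale c f) = c * \<xi> f}) \<inter>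
      (\<Inter>f\<in>- dual_space s. {\<xi>. \<xi> f = 0}))"
    unfolding set_eq_iff bidual_ball_iff by (force simp: PiE_iff)
  show ?thesis
    unfolding eq
    by (intro compact_Int_closed cmp closed_Int closed_INT closed_Collect_eq ballI continuous_intros
        continuous_on_product_coordinates)
qed

text \<open>Reconstruction from finitely many point values. It serves twice: for Helly's lemma, and to
  write a finite-rank operator on the dual with coordinates that are evaluations at points.\<close>

lemma dual_coordinates:
  assumes "finite B" "B \<subseteq> dual_space s"
  shows "\<exists>L. (\<forall>(x, b)\<in>set L. b \<in> dual_space s) \<and>
    (\<forall>g\<in>B. g = (\<Sum>(x, b)\<leftarrow>L. dual_scale (blinfun_apply g x) b))"
  using assms
proof (induction B rule: finite_induct)
  case empty
  then show ?case by (intro exI[of _ "[]"]) auto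
next
  case (insert f B)
  then obtain L where L: "\<And>x b. (x, b) \<in> set L \<Longrightarrow> b \<in> dual_space s"
    "\<And>g. g \<in> B \<Longrightarrow> g = (\<Sum>(x, b)\<leftarrow>L. dual_scale (blinfun_apply g x) b)" by fast
  define S where "S g = (\<Sum>(x, b)\<leftarrow>L. dual_scale (blinfun_apply g x) b)" for g
  have S: "S g \<in> dual_space s" for g
    using L(1) unfolding S_def by (induction L) (auto intro!: dual_space_add dual_space_scale)
  define f0 where "f0 = f - S f"
  show ?case
  proof (cases "f0 = 0")
    case True
    then show ?thesis using L unfolding f0_def S_def by (intro exI[of _ L]) auto
  next
    case False
    then obtain x0 where x0: "blinfun_apply f0 x0 \<noteq> 0" by (metis blinfun_eqI zero_blinfun.rep_eq)
    define b0 where "b0 = dual_scale (inverse (blinfun_apply f0 x0)) f0"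
    have b0: "b0 \<in> dual_space s" using insert.prems S by (auto simp: b0_def f0_def)
    define L' where "L' = (x0, b0) # map (\<lambda>(x, b). (x, b - dual_scale (blinfun_apply b x0) b0)) L"
    have "(\<Sum>(x, b)\<leftarrow>M. dual_scale (blinfun_apply g x) (b - dual_scale (blinfun_apply b x0) b0)) =
        (\<Sum>(x, b)\<leftarrow>M. dual_scale (blinfun_apply g x) b) -
        dual_scale (blinfun_apply (\<Sum>(x, b)\<leftarrow>M. dual_scale (blinfun_apply g x) b) x0) b0" for M g
      by (induction M) (auto intro!: blinfun_eqI simp: blinfun.bilinear_simps algebra_simps)
    then have eq: "(\<Sum>(x, b)\<leftarrow>L'. dual_scale (blinfun_apply g x) b) =
        dual_scale (blinfun_apply g x0) b0 + S g - dual_scale (blinfun_apply (S g) x0) b0" for g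
      by (simp add: L'_def S_def case_prod_unfold o_def)
    have 1: "g = (\<Sum>(x, b)\<leftarrow>L'. dual_scale (blinfun_apply g x) b)" if "g \<in> B" for g
      using L(2)[OF that] unfolding eq by (simp add: S_def)
    have "blinfun_apply f x = blinfun_apply f0 x + blinfun_apply (S f) x" for x
      by (simp add: f0_def blinfun.bilinear_simps)
    then have 2: "f = (\<Sum>(x, b)\<leftarrow>L'. dual_scale (blinfun_apply f x) b)"
      unfolding eq using x0
      by (intro blinfun_eqI) (simp add: b0_def blinfun.bilinear_simps field_simps)
    have "\<forall>(x, b)\<in>set L'. b \<in> dual_space s"
      using L(1) b0 unfolding L'_def by auto
    then show ?thesis using 1 2 by (intro exI[of _ L']) blast
  qed
qed

lemma dual_coordinates_span:
  assumes "finite B" "B \<subseteq> dual_space s"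
  obtains L where "\<And>x b. (x, b) \<in> set L \<Longrightarrow> b \<in> dual_space s"
    "\<And>g. g \<in> dual.span B \<Longrightarrow> g = (\<Sum>(x, b)\<leftarrow>L. dual_scale (blinfun_apply g x) b)"
proof -
  obtain L where L: "\<forall>(x, b)\<in>set L. b \<in> dual_space s"
    "\<And>g. g \<in> B \<Longrightarrow> g = (\<Sum>(x, b)\<leftarrow>L. dual_scale (blinfun_apply g x) b)"
    using dual_coordinates[OF assms] by blast
  define S where "S g = (\<Sum>(x, b)\<leftarrow>L. dual_scale (blinfun_apply g x) b)" for g
  have "S (g + h) = S g + S h" for g h
    unfolding S_def by (induction L) (auto simp: blinfun.bilinear_simps dual.scale_left_distrib)
  moreover have "S (dual_scale c g) = dual_scale c (S g)" for c g
    unfolding S_def by (induction L) (auto simp: dual.scale_right_distrib)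
  moreover have "S 0 = 0"
    unfolding S_def by (induction L) auto
  ultimately have sub: "dual.subspace {g. g = S g}"
    by (auto simp: dual.subspace_def)
  have "g = S g" if "g \<in> dual.span B" for g
    using dual.span_induct[OF that sub] L(2) unfolding S_def by blast
  then show ?thesis using that[of L] L(1) unfolding S_def by blast
qed

lemma bidual_interpolation:
  assumes "\<xi> \<in> bidual_ball s" "finite B" "B \<subseteq> dual_space s"
  obtains x where "\<And>f. f \<in> B \<Longrightarrow> blinfun_apply f x = \<xi> f"
proof -
  obtain L where L: "\<forall>(x, b)\<in>set L. b \<in> dual_space s"
    "\<And>g. g \<in> B \<Longrightarrow> g = (\<Sum>(x, b)\<leftarrow>L. dual_scale (blinfun_apply g x) b)"
    using dual_coordinates[OF assms(2,3)] by blast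
  let ?x = "\<Sum>(x, b)\<leftarrow>L. s (\<xi> b) x"
  have "blinfun_apply f ?x = \<xi> f" if f: "f \<in> B" for f
  proof -
    have fs: "f \<in> dual_space s" using f assms(3) by blast
    have "blinfun_apply f ?x = (\<Sum>(x, b)\<leftarrow>L. \<xi> b * blinfun_apply f x)"
      by (induction L) (auto simp: blinfun.bilinear_simps dual_apply_scale[OF fs])
    also have "\<dots> = (\<Sum>(x, b)\<leftarrow>L. \<xi> (dual_scale (blinfun_apply f x) b))"
      by (intro arg_cong[where f=sum_list] map_cong refl)
        (use L(1) assms(1) in \<open>auto simp: bidual_scale\<close>)
    also have "\<dots> = \<xi> (\<Sum>(x, b)\<leftarrow>L. dual_scale (blinfun_apply f x) b)"
      using bidual_sum_list[OF assms(1), of L "\<lambda>(x, b). dual_scale (blinfun_apply f x) b"] L(1)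
      by (auto simp: case_prod_unfold dual_space_scale)
    also have "\<dots> = \<xi> f" using L(2)[OF f] by simp
    finally show ?thesis .
  qed
  then show ?thesis using that by blast
qed

lemma weak_star_filter_nontrivial:
  assumes "\<xi> \<in> bidual_ball s"
  shows "weak_star_filter s \<xi> \<noteq> bot"
proof
  assume "weak_star_filter s \<xi> = bot"
  then have "eventually (\<lambda>_. False) (weak_star_filter s \<xi>)" by simp
  then obtain X Q where X: "X \<subseteq> dual_space s" "finite X"
      and Q: "\<forall>f\<in>X. eventually (Q f) (filtercomap (blinfun_apply f) (nhds (\<xi> f)))"
        "\<forall>x. \<not> (\<forall>f\<in>X. Q f x)"
    unfolding weak_star_filter_def by (subst (asm) eventually_INF) (auto simp: eventually_INF_finite)
  obtain x where x: "\<And>f. f \<in> X \<Longrightarrow> blinfun_apply f x = \<xi> f"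
    using bidual_interpolation[OF assms X(2,1)] by blast
  have "Q f x" if "f \<in> X" for f
    using Q(1) that x[OF that] by (auto simp: eventually_filtercomap dest!: eventually_nhds_x_imp_x)
  then show False using Q(2) by blast
qed

end

section \<open>The trace under the approximation property\<close>

lemma summable_slow_growth:
  fixes b :: "nat \<Rightarrow> real"
  assumes b: "\<And>n. 0 \<le> b n" "summable b"
  obtains c where "\<And>n. 0 < c n" "filterlim c at_top sequentially" "summable (\<lambda>n. b n * c n)"
proof -
  define d where "d n = b n + (1/2)^n" for n
  have d: "0 < d n" "b n \<le> d n" for n using b(1)[of n] by (auto simp: d_def add_nonneg_pos)
  have sd: "summable d" unfolding d_def using b(2) by (intro summable_add) auto
  define r where "r n = suminf d - sum d {..<n}" for n
  have r: "0 < r n" for n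
    using sum_less_suminf[OF sd, of n] d(1) by (simp add: r_def)
  have rS: "r (Suc n) = r n - d n" for n by (simp add: r_def)
  have r0: "r \<longlonglongrightarrow> 0"
    unfolding r_def using summable_LIMSEQ[OF sd] by (auto intro!: tendsto_eq_intros)
  define c where "c n = inverse (sqrt (r n))" for n
  have "(\<lambda>n. sqrt (r n)) \<longlonglongrightarrow> 0" using tendsto_real_sqrt[OF r0] by simp
  then have "filterlim (\<lambda>n. sqrt (r n)) (at_right 0) sequentially"
    using r by (auto simp: filterlim_at less_imp_neq[symmetric] intro!: always_eventually)
  then have 1: "filterlim c at_top sequentially"
    unfolding c_def by (rule filterlim_compose[OF filterlim_inverse_at_top_right])
  have "summable (\<lambda>n. sqrt (r n) - sqrt (r (Suc n)))"
    using tendsto_real_sqrt[OF r0] by (intro telescope_summable') auto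
  then have "summable (\<lambda>n. 2 * (sqrt (r n) - sqrt (r (Suc n))))"
    by (rule summable_mult)
  then have 2: "summable (\<lambda>n. b n * c n)"
  proof (rule summable_comparison_test'[where N=0])
    fix n :: nat
    have le: "sqrt (r (Suc n)) \<le> sqrt (r n)" using d(1)[of n] by (simp add: rS)
    have "b n \<le> d n" by (rule d)
    also have "d n = (sqrt (r n))\<^sup>2 - (sqrt (r (Suc n)))\<^sup>2"
      using r[of n] r[of "Suc n"] by (simp add: rS)
    also have "\<dots> = (sqrt (r n) - sqrt (r (Suc n))) * (sqrt (r n) + sqrt (r (Suc n)))"
      by (simp add: power2_eq_square algebra_simps)
    also have "\<dots> \<le> (sqrt (r n) - sqrt (r (Suc n))) * (2 * sqrt (r n))"
      using le by (intro mult_left_mono) auto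
    finally have "b n * c n \<le> 2 * (sqrt (r n) - sqrt (r (Suc n)))"
      using r[of n] by (simp add: c_def field_simps)
    moreover have "0 \<le> b n * c n" using b(1)[of n] r[of n] by (simp add: c_def)
    ultimately show "norm (b n * c n) \<le> 2 * (sqrt (r n) - sqrt (r (Suc n)))" by simp
  qed
  show ?thesis by (rule that[OF _ 1 2]) (use r in \<open>simp add: c_def\<close>)
qed

lemma summable_null_factorization:
  fixes e :: "nat \<Rightarrow> 'v::real_normed_vector"
  assumes a: "\<And>n. 0 \<le> a n" and sum: "summable (\<lambda>n. a n * norm (e n))"
  obtains v r where "v \<longlonglongrightarrow> 0" "\<And>n. (0::real) \<le> r n" "\<And>n. e n = r n *\<^sub>R v n"
    "\<And>n. v n = inverse (r n) *\<^sub>R e n" "summable (\<lambda>n. a n * r n)"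
proof -
  obtain c where c: "\<And>n. 0 < c n" "filterlim c at_top sequentially"
      "summable (\<lambda>n. a n * norm (e n) * c n)"
    using summable_slow_growth[of "\<lambda>n. a n * norm (e n)"] a sum by auto
  define r where "r n = c n * norm (e n)" for n
  define v where "v n = inverse (r n) *\<^sub>R e n" for n
  show ?thesis
  proof (rule that[of v r])
    have "(\<lambda>n. inverse (c n)) \<longlonglongrightarrow> 0"
      using c(2) by (rule tendsto_inverse_0_at_top)
    then show "v \<longlonglongrightarrow> 0"
    proof (rule Lim_null_comparison[rotated])
      show "\<forall>\<^sub>F n in sequentially. norm (v n) \<le> inverse (c n)"
        using c(1) by (auto simp: v_def r_def less_imp_le field_simps intro!: always_eventually)
    qed
    show "0 \<le> r n" for n using c(1)[of n] by (simp add: r_def)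
    show "e n = r n *\<^sub>R v n" for n
    proof (cases "e n = 0")
      case False
      then have "r n \<noteq> 0" using c(1)[of n] by (simp add: r_def)
      then show ?thesis by (simp add: v_def)
    qed (simp add: v_def)
    show "summable (\<lambda>n. a n * r n)" using c(3) by (simp add: r_def mult_ac)
  qed (simp add: v_def)
qed

lemma compact_insert_limit_range:
  fixes v :: "nat \<Rightarrow> 'v::topological_space"
  assumes "v \<longlonglongrightarrow> l"
  shows "compact (insert l (range v))"
  unfolding compact_eq_Heine_Borel
proof (intro allI impI)
  fix \<C> assume C: "(\<forall>U\<in>\<C>. open U) \<and> insert l (range v) \<subseteq> \<Union>\<C>"
  then obtain U where U: "U \<in> \<C>" "l \<in> U" "open U" by auto
  then obtain M where M: "\<And>n. n \<ge> M \<Longrightarrow> v n \<in> U"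
    using topological_tendstoD[OF assms] by (auto simp: eventually_sequentially)
  have "\<forall>n. \<exists>W. W \<in> \<C> \<and> v n \<in> W" using C by blast
  then obtain W where W: "\<And>n. W n \<in> \<C>" "\<And>n. v n \<in> W n" by metis
  have "v n \<in> \<Union>(insert U (W ` {..<M}))" for n
    using M[of n] W(2)[of n] by (cases "n < M") auto
  then have "insert l (range v) \<subseteq> \<Union>(insert U (W ` {..<M}))"
    using U(2) by auto
  then show "\<exists>\<D>\<subseteq>\<C>. finite \<D> \<and> insert l (range v) \<subseteq> \<Union>\<D>"
    using U(1) W(1) by (intro exI[of _ "insert U (W ` {..<M})"]) auto
qed

lemma sums_list:
  fixes f :: "'i \<Rightarrow> nat \<Rightarrow> 'b::real_normed_vector"
  shows "(\<And>i. i \<in> set L \<Longrightarrow> f i sums g i) \<Longrightarrow> (\<lambda>n. \<Sum>i\<leftarrow>L. f i n) sums (\<Sum>i\<leftarrow>L. g i)"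
  by (induction L) (auto intro!: sums_add)

context banach_space_over begin

text \<open>The approximation property makes the trace of a nuclear operator on the dual
  depend only on the operator.\<close>

lemma approximation_property_trace:
  fixes A :: "nat \<Rightarrow> ('a \<Rightarrow>\<^sub>L 'k) \<Rightarrow> 'k"
  assumes AP: "approximation_property dual_scale (dual_space s)"
    and e: "\<And>n. e n \<in> dual_space s"
    and A_add: "\<And>n f g. f \<in> dual_space s \<Longrightarrow> g \<in> dual_space s \<Longrightarrow> A n (f + g) = A n f + A n g"
    and A_scale: "\<And>n c f. f \<in> dual_space s \<Longrightarrow> A n (dual_scale c f) = c * A n f"
    and A_le: "\<And>n f. f \<in> dual_space s \<Longrightarrow> norm (A n f) \<le> \<alpha> n * norm f"
    and \<alpha>: "\<And>n. 0 \<le> \<alpha> n" and sum: "summable (\<lambda>n. \<alpha> n * norm (e n))"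
    and zero: "\<And>f x. f \<in> dual_space s \<Longrightarrow> (\<lambda>n. A n f * blinfun_apply (e n) x) sums 0"
  shows "(\<lambda>n. A n (e n)) sums 0"
proof -
  have sumA: "summable (\<lambda>n. A n (e n))"
    using sum by (rule summable_comparison_test'[where N=0]) (use A_le e in auto)
  obtain v r where v: "v \<longlonglongrightarrow> 0" "\<And>n. (0::real) \<le> r n" "\<And>n. e n = r n *\<^sub>R v n"
    "\<And>n. v n = inverse (r n) *\<^sub>R e n" and sr: "summable (\<lambda>n. \<alpha> n * r n)"
    by (rule summable_null_factorization[OF \<alpha> sum]) (blast intro: that)
  have vV: "v n \<in> dual_space s" for n unfolding v(4) using e by auto
  let ?K = "insert 0 (range v)"
  have K: "compact ?K" "?K \<subseteq> dual_space s"
    using compact_insert_limit_range[OF v(1)] vV by auto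
  define R where "R = (\<Sum>n. \<alpha> n * r n)"
  have R: "0 \<le> R" unfolding R_def using \<alpha> v(2) sr by (intro suminf_nonneg) auto
  have "norm (\<Sum>n. A n (e n)) \<le> \<epsilon>" if \<epsilon>: "0 < \<epsilon>" for \<epsilon>
  proof -
    let ?d = "\<epsilon> / (R + 1)"
    have d: "0 < ?d" using \<epsilon> R by simp
    obtain T where T: "T \<in> finite_rank_operators dual_scale (dual_space s)"
        "\<And>x. x \<in> ?K \<Longrightarrow> norm (T x - x) < ?d"
      using AP[unfolded approximation_property_def, rule_format, of ?K ?d] K d by blast
    then have T_add: "\<And>x y. x \<in> dual_space s \<Longrightarrow> y \<in> dual_space s \<Longrightarrow> T (x + y) = T x + T y"
      and T_scale: "\<And>c x. x \<in> dual_space s \<Longrightarrow> T (dual_scale c x) = dual_scale c (T x)"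
      unfolding finite_rank_operators_def by blast+
    obtain C where C: "\<forall>x\<in>dual_space s. norm (T x) \<le> C * norm x"
      using T(1) unfolding finite_rank_operators_def mem_Collect_eq by (elim conjE exE) (rule that)
    obtain B where B: "finite B" "B \<subseteq> dual_space s" "T ` dual_space s \<subseteq> dual.span B"
      using T(1) unfolding finite_rank_operators_def mem_Collect_eq by (elim conjE exE) (rule that)
    obtain L where L: "\<And>x b. (x, b) \<in> set L \<Longrightarrow> b \<in> dual_space s"
        "\<And>g. g \<in> dual.span B \<Longrightarrow> g = (\<Sum>(x, b)\<leftarrow>L. dual_scale (blinfun_apply g x) b)"
      by (rule dual_coordinates_span[OF B(1,2)]) (rule that)
    have Te: "T (e n) = (\<Sum>p\<leftarrow>L. dual_scale (blinfun_apply (T (e n)) (fst p)) (snd p))" for n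
      using L(2)[of "T (e n)"] B(3) e[of n] by (auto simp: case_prod_unfold)
    have LV: "i \<in> set L \<Longrightarrow> dual_scale (blinfun_apply (T (e n)) (fst i)) (snd i) \<in> dual_space s" for n i
      using L(1)[of "fst i" "snd i"] by auto
    have TeV: "T (e n) \<in> dual_space s"
      and ATe: "A n (T (e n)) = (\<Sum>p\<leftarrow>L. blinfun_apply (T (e n)) (fst p) * A n (snd p))" for n
    proof -
      note * = functional_sum_list[of "A n" L "\<lambda>p. dual_scale (blinfun_apply (T (e n)) (fst p)) (snd p)",
          OF A_add A_scale LV]
      show "T (e n) \<in> dual_space s" using * by (subst Te) auto
      have "A n (T (e n)) = (\<Sum>p\<leftarrow>L. A n (dual_scale (blinfun_apply (T (e n)) (fst p)) (snd p)))"
        using * by (subst Te) auto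
      also have "\<dots> = (\<Sum>p\<leftarrow>L. blinfun_apply (T (e n)) (fst p) * A n (snd p))"
        by (intro arg_cong[where f=sum_list] map_cong refl A_scale) (use L(1) in auto)
      finally show "A n (T (e n)) = (\<Sum>p\<leftarrow>L. blinfun_apply (T (e n)) (fst p) * A n (snd p))" .
    qed
    have "(\<lambda>n. blinfun_apply (T (e n)) x * A n b) sums 0" if b: "b \<in> dual_space s" for b x
    proof -
      define G where "G m = (\<Sum>n<m. dual_scale (A n b) (e n))" for m
      have GV: "G m \<in> dual_space s" for m unfolding G_def using e by auto
      have "summable (\<lambda>n. norm (dual_scale (A n b) (e n)))"
      proof (rule summable_comparison_test'[where N=0])
        show "summable (\<lambda>n. norm b * (\<alpha> n * norm (e n)))" using sum by (rule summable_mult)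
        show "norm (norm (dual_scale (A n b) (e n))) \<le> norm b * (\<alpha> n * norm (e n))" for n
          using mult_right_mono[OF A_le[OF b, of n] norm_ge_zero[of "e n"]]
          by (simp add: norm_dual_scale mult_ac)
      qed
      then have "summable (\<lambda>n. dual_scale (A n b) (e n))" by (rule summable_norm_cancel)
      then have lim: "G \<longlonglongrightarrow> (\<Sum>n. dual_scale (A n b) (e n))" (is "_ \<longlonglongrightarrow> ?g")
        unfolding G_def by (rule summable_LIMSEQ)
      have "?g = 0"
      proof (rule blinfun_eqI)
        fix y
        have "(\<lambda>m. blinfun_apply (G m) y) \<longlonglongrightarrow> blinfun_apply ?g y"
          using lim by (intro blinfun.tendsto tendsto_const)
        moreover have "(\<lambda>m. blinfun_apply (G m) y) \<longlonglongrightarrow> 0"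
          using zero[OF b, of y] by (simp add: G_def sums_def blinfun.sum_left)
        ultimately show "blinfun_apply ?g y = blinfun_apply 0 y"
          using LIMSEQ_unique by auto
      qed
      then have G0: "G \<longlonglongrightarrow> 0" using lim by simp
      have T0: "T 0 = 0" using T_scale[of 0 0] by simp
      have TG: "T (G m) = (\<Sum>n<m. dual_scale (A n b) (T (e n)))" for m
      proof (induction m)
        case 0
        then show ?case by (simp add: G_def T0)
      next
        case (Suc m)
        have "G (Suc m) = G m + dual_scale (A m b) (e m)" by (simp add: G_def)
        then show ?case using Suc GV e by (simp add: T_add T_scale dual_space_scale)
      qed
      have "(\<lambda>m. T (G m)) \<longlonglongrightarrow> 0"
      proof (rule Lim_null_comparison)
        show "\<forall>\<^sub>F m in sequentially. norm (T (G m)) \<le> C * norm (G m)" using C GV by auto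
        show "(\<lambda>m. C * norm (G m)) \<longlonglongrightarrow> 0" using tendsto_norm_zero[OF G0] by (rule tendsto_mult_right_zero)
      qed
      then have "(\<lambda>m. blinfun_apply (T (G m)) x) \<longlonglongrightarrow> blinfun_apply 0 x"
        by (intro blinfun.tendsto tendsto_const)
      then show ?thesis by (simp add: TG sums_def blinfun.sum_left mult.commute)
    qed
    then have "(\<lambda>n. blinfun_apply (T (e n)) (fst p) * A n (snd p)) sums 0" if "p \<in> set L" for p
      using L(1)[of "fst p" "snd p"] that by simp
    then have "(\<lambda>n. \<Sum>p\<leftarrow>L. blinfun_apply (T (e n)) (fst p) * A n (snd p)) sums (\<Sum>p\<leftarrow>L. 0)"
      by (rule sums_list)
    then have T0: "(\<lambda>n. A n (T (e n))) sums 0" by (simp add: ATe)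
    have "(\<lambda>n. A n (e n) - A n (T (e n))) sums ((\<Sum>n. A n (e n)) - 0)"
      using summable_sums[OF sumA] T0 by (rule sums_diff)
    moreover have "norm (A n (e n) - A n (T (e n))) \<le> \<alpha> n * r n * ?d" for n
    proof -
      have "A n (e n) = A n (T (e n)) + A n (e n - T (e n))"
        using A_add[of "T (e n)" "e n - T (e n)" n] TeV[of n] e[of n] by (simp add: dual_space_diff)
      then have "norm (A n (e n) - A n (T (e n))) \<le> \<alpha> n * norm (e n - T (e n))"
        using A_le[of "e n - T (e n)" n] TeV[of n] e[of n] by (simp add: dual_space_diff)
      also have "e n - T (e n) = r n *\<^sub>R (v n - T (v n))"
        using T_scale[OF vV, of "of_real (r n)" n] by (subst (1 2) v(3)) (simp add: dual_scale_of_real scaleR_diff_right)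
      also have "norm \<dots> \<le> r n * ?d"
        using mult_left_mono[of "norm (v n - T (v n))" ?d "r n"] T(2)[of "v n"] v(2)[of n]
        by (simp add: norm_minus_commute)
      finally show ?thesis using \<alpha>[of n] by (simp add: mult.assoc mult_left_mono)
    qed
    ultimately have "norm (\<Sum>n. A n (e n)) \<le> (\<Sum>n. \<alpha> n * r n * ?d)"
      using norm_suminf_le[of "\<lambda>n. A n (e n) - A n (T (e n))" "\<lambda>n. \<alpha> n * r n * ?d"]
        summable_mult2[OF sr, of ?d] by (simp add: sums_iff)
    also have "\<dots> = R * ?d" unfolding R_def using sr by (rule suminf_mult2[symmetric])
    also have "\<dots> \<le> \<epsilon>" using R \<epsilon> by (simp add: field_simps)
    finally show ?thesis .
  qed
  then have "norm (\<Sum>n. A n (e n)) \<le> 0" by (intro field_le_epsilon[of _ 0]) simp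
  then show ?thesis using sumA by (simp add: sums_iff)
qed

end

section \<open>Arens extensions\<close>

lemma iterated_limit_cong:
  "(\<And>xs. length xs = length Fs \<Longrightarrow> g xs = h xs) \<Longrightarrow> iterated_limit Fs g = iterated_limit Fs h"
proof (induction Fs arbitrary: g h)
  case (Cons F Fs)
  have "iterated_limit Fs (\<lambda>xs. g (x # xs)) = iterated_limit Fs (\<lambda>xs. h (x # xs))" for x
    by (rule Cons.IH) (simp add: Cons.prems)
  then show ?case by simp
qed simp

context banach_space_over begin

lemma Lim_weak_star_filter:
  assumes "\<xi> \<in> bidual_ball s" "f \<in> dual_space s"
  shows "Lim (weak_star_filter s \<xi>) (blinfun_apply f) = \<xi> f"
proof (rule tendsto_Lim[OF weak_star_filter_nontrivial[OF assms(1)]])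
  show "(blinfun_apply f \<longlongrightarrow> \<xi> f) (weak_star_filter s \<xi>)"
    unfolding filterlim_iff_le_filtercomap weak_star_filter_def
    by (rule INF_lower[OF assms(2)])
qed

fun bounded_form :: "nat \<Rightarrow> real \<Rightarrow> ('a list \<Rightarrow> 'k) \<Rightarrow> bool" where
  "bounded_form 0 C \<phi> \<longleftrightarrow> norm (\<phi> []) \<le> C"
| "bounded_form (Suc M) C \<phi> \<longleftrightarrow>
     (\<forall>x. bounded_form M (C * norm x) (\<lambda>xs. \<phi> (x # xs))) \<and>
     (\<forall>x y xs. length xs = M \<longrightarrow> \<phi> ((x + y) # xs) = \<phi> (x # xs) + \<phi> (y # xs)) \<and>
     (\<forall>c x xs. length xs = M \<longrightarrow> \<phi> (s c x # xs) = c * \<phi> (x # xs))"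

lemma bounded_form_add:
  "bounded_form M C \<phi> \<Longrightarrow> bounded_form M D \<psi> \<Longrightarrow> bounded_form M (C + D) (\<lambda>xs. \<phi> xs + \<psi> xs)"
proof (induction M arbitrary: C D \<phi> \<psi>)
  case 0
  then show ?case using norm_triangle_ineq[of "\<phi> []" "\<psi> []"] by simp
next
  case (Suc M)
  then have "bounded_form M (C * norm x + D * norm x) (\<lambda>xs. \<phi> (x # xs) + \<psi> (x # xs))" for x
    by simp
  then show ?case using Suc.prems by (simp add: distrib_right algebra_simps)
qed

lemma bounded_form_scale:
  "bounded_form M C \<phi> \<Longrightarrow> bounded_form M (norm c * C) (\<lambda>xs. c * \<phi> xs)"
proof (induction M arbitrary: C \<phi>)
  case 0
  then show ?case by (simp add: norm_mult mult_left_mono)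
next
  case (Suc M)
  then have "bounded_form M (norm c * (C * norm x)) (\<lambda>xs. c * \<phi> (x # xs))" for x
    by simp
  then show ?case using Suc.prems by (simp add: mult.assoc algebra_simps)
qed

abbreviation arens :: "(('a \<Rightarrow>\<^sub>L 'k) \<Rightarrow> 'k) list \<Rightarrow> ('a list \<Rightarrow> 'k) \<Rightarrow> 'k" where
  "arens \<xi>s \<phi> \<equiv> iterated_limit (map (weak_star_filter s) \<xi>s) \<phi>"

definition arens_slice :: "(('a \<Rightarrow>\<^sub>L 'k) \<Rightarrow> 'k) list \<Rightarrow> ('a list \<Rightarrow> 'k) \<Rightarrow> 'a \<Rightarrow>\<^sub>L 'k" where
  "arens_slice \<xi>s \<phi> = Blinfun (\<lambda>x. arens \<xi>s (\<lambda>xs. \<phi> (x # xs)))"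

lemma arens_props:
  assumes "set \<xi>s \<subseteq> bidual_ball s"
  shows "(\<forall>C \<phi>. 0 \<le> C \<longrightarrow> bounded_form (length \<xi>s) C \<phi> \<longrightarrow> norm (arens \<xi>s \<phi>) \<le> C) \<and>
    (\<forall>C D \<phi> \<psi>. 0 \<le> C \<longrightarrow> 0 \<le> D \<longrightarrow> bounded_form (length \<xi>s) C \<phi> \<longrightarrow> bounded_form (length \<xi>s) D \<psi> \<longrightarrow>
        arens \<xi>s (\<lambda>xs. \<phi> xs + \<psi> xs) = arens \<xi>s \<phi> + arens \<xi>s \<psi>) \<and>
    (\<forall>C \<phi> c. 0 \<le> C \<longrightarrow> bounded_form (length \<xi>s) C \<phi> \<longrightarrow> arens \<xi>s (\<lambda>xs. c * \<phi> xs) = c * arens \<xi>s \<phi>) \<and>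
    (\<forall>C \<phi>. 0 \<le> C \<longrightarrow> bounded_form (Suc (length \<xi>s)) C \<phi> \<longrightarrow>
      (\<forall>x. blinfun_apply (arens_slice \<xi>s \<phi>) x = arens \<xi>s (\<lambda>xs. \<phi> (x # xs))) \<and>
      arens_slice \<xi>s \<phi> \<in> dual_space s \<and> norm (arens_slice \<xi>s \<phi>) \<le> C)"
  using assms
proof (induction \<xi>s)
  have slice: "(\<forall>x. blinfun_apply (arens_slice \<xi>s \<phi>) x = arens \<xi>s (\<lambda>xs. \<phi> (x # xs))) \<and>
      arens_slice \<xi>s \<phi> \<in> dual_space s \<and> norm (arens_slice \<xi>s \<phi>) \<le> C"
    if le: "\<And>C \<phi>. 0 \<le> C \<Longrightarrow> bounded_form (length \<xi>s) C \<phi> \<Longrightarrow> norm (arens \<xi>s \<phi>) \<le> C"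
    and add: "\<And>C D \<phi> \<psi>. 0 \<le> C \<Longrightarrow> 0 \<le> D \<Longrightarrow> bounded_form (length \<xi>s) C \<phi> \<Longrightarrow> bounded_form (length \<xi>s) D \<psi> \<Longrightarrow>
        arens \<xi>s (\<lambda>xs. \<phi> xs + \<psi> xs) = arens \<xi>s \<phi> + arens \<xi>s \<psi>"
    and sc: "\<And>C \<phi> c. 0 \<le> C \<Longrightarrow> bounded_form (length \<xi>s) C \<phi> \<Longrightarrow> arens \<xi>s (\<lambda>xs. c * \<phi> xs) = c * arens \<xi>s \<phi>"
    and \<phi>: "0 \<le> C" "bounded_form (Suc (length \<xi>s)) C \<phi>"
    for \<xi>s C \<phi>
  proof -
    let ?g = "\<lambda>x. arens \<xi>s (\<lambda>xs. \<phi> (x # xs))"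
    have b: "bounded_form (length \<xi>s) (C * norm x) (\<lambda>xs. \<phi> (x # xs))" for x using \<phi>(2) by simp
    have nn: "0 \<le> C * norm x" for x :: 'a using \<phi>(1) by simp
    have g_add: "?g (x + y) = ?g x + ?g y" for x y
    proof -
      have "?g (x + y) = arens \<xi>s (\<lambda>xs. \<phi> (x # xs) + \<phi> (y # xs))"
        by (rule iterated_limit_cong) (use \<phi>(2) in simp)
      then show ?thesis using add[OF nn nn b b] by simp
    qed
    have g_scale: "?g (s c x) = c * ?g x" for c x
    proof -
      have "?g (s c x) = arens \<xi>s (\<lambda>xs. c * \<phi> (x # xs))"
        by (rule iterated_limit_cong) (use \<phi>(2) in simp)
      then show ?thesis using sc[OF nn b] by simp
    qed
    have g_le: "norm (?g x) \<le> C * norm x" for x by (rule le[OF nn b])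
    have "bounded_linear ?g"
    proof (rule bounded_linear_intro[of _ C])
      show "?g (r *\<^sub>R x) = r *\<^sub>R ?g x" for r x
        using g_scale[of "of_real r" x] by (simp add: scale_of_real scaleR_conv_of_real)
    qed (use g_add g_le in \<open>auto simp: mult.commute\<close>)
    then have ap: "blinfun_apply (arens_slice \<xi>s \<phi>) = ?g"
      unfolding arens_slice_def by (rule bounded_linear_Blinfun_apply)
    then show ?thesis
      using g_scale g_le \<phi>(1) by (auto simp: dual_space_iff intro!: norm_blinfun_bound)
  qed
  {
    case Nil
    have "norm (arens [] \<phi>) \<le> C" if "0 \<le> C" "bounded_form (length []) C \<phi>" for C \<phi>
      using that by simp
    then show ?case using slice[of "[]"] by simp
  next
    case (Cons \<xi> \<xi>s)
    then have \<xi>: "\<xi> \<in> bidual_ball s" and IH: 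
        "\<And>C \<phi>. 0 \<le> C \<Longrightarrow> bounded_form (Suc (length \<xi>s)) C \<phi> \<Longrightarrow>
        (\<forall>x. blinfun_apply (arens_slice \<xi>s \<phi>) x = arens \<xi>s (\<lambda>xs. \<phi> (x # xs))) \<and>
        arens_slice \<xi>s \<phi> \<in> dual_space s \<and> norm (arens_slice \<xi>s \<phi>) \<le> C"
      and IH_add: "\<And>C D \<phi> \<psi>. 0 \<le> C \<Longrightarrow> 0 \<le> D \<Longrightarrow> bounded_form (length \<xi>s) C \<phi> \<Longrightarrow> bounded_form (length \<xi>s) D \<psi> \<Longrightarrow>
        arens \<xi>s (\<lambda>xs. \<phi> xs + \<psi> xs) = arens \<xi>s \<phi> + arens \<xi>s \<psi>"
      and IH_sc: "\<And>C \<phi> c. 0 \<le> C \<Longrightarrow> bounded_form (length \<xi>s) C \<phi> \<Longrightarrow> arens \<xi>s (\<lambda>xs. c * \<phi> xs) = c * arens \<xi>s \<phi>"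
      by simp_all
    have val: "arens (\<xi> # \<xi>s) \<phi> = \<xi> (arens_slice \<xi>s \<phi>)"
      if "0 \<le> C" "bounded_form (Suc (length \<xi>s)) C \<phi>" for C \<phi>
    proof -
      have "blinfun_apply (arens_slice \<xi>s \<phi>) = (\<lambda>x. arens \<xi>s (\<lambda>xs. \<phi> (x # xs)))"
        using IH[OF that] by blast
      then show ?thesis
        using IH[OF that] Lim_weak_star_filter[OF \<xi>, of "arens_slice \<xi>s \<phi>"] by simp
    qed
    have le: "norm (arens (\<xi> # \<xi>s) \<phi>) \<le> C"
      if "0 \<le> C" "bounded_form (Suc (length \<xi>s)) C \<phi>" for C \<phi>
      using val[OF that] IH[OF that] bidual_le[OF \<xi>, of "arens_slice \<xi>s \<phi>"] by simp
    have add: "arens (\<xi> # \<xi>s) (\<lambda>xs. \<phi> xs + \<psi> xs) = arens (\<xi> # \<xi>s) \<phi> + arens (\<xi> # \<xi>s) \<psi>"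
      if C: "0 \<le> C" "0 \<le> D" and \<phi>: "bounded_form (Suc (length \<xi>s)) C \<phi>" and \<psi>: "bounded_form (Suc (length \<xi>s)) D \<psi>"
      for C D \<phi> \<psi>
    proof -
      have \<phi>\<psi>: "bounded_form (Suc (length \<xi>s)) (C + D) (\<lambda>xs. \<phi> xs + \<psi> xs)"
        using bounded_form_add[OF \<phi> \<psi>] .
      have CD: "0 \<le> C + D" using C by simp
      have "arens_slice \<xi>s (\<lambda>xs. \<phi> xs + \<psi> xs) = arens_slice \<xi>s \<phi> + arens_slice \<xi>s \<psi>"
      proof (rule blinfun_eqI)
        fix x
        have "arens \<xi>s (\<lambda>xs. \<phi> (x # xs) + \<psi> (x # xs)) = arens \<xi>s (\<lambda>xs. \<phi> (x # xs)) + arens \<xi>s (\<lambda>xs. \<psi> (x # xs))"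
          by (rule IH_add[of "C * norm x" "D * norm x"]) (use C \<phi> \<psi> in simp_all)
        then show "blinfun_apply (arens_slice \<xi>s (\<lambda>xs. \<phi> xs + \<psi> xs)) x = blinfun_apply (arens_slice \<xi>s \<phi> + arens_slice \<xi>s \<psi>) x"
          using IH[OF C(1) \<phi>] IH[OF C(2) \<psi>] IH[OF CD \<phi>\<psi>] by (simp add: blinfun.bilinear_simps)
      qed
      then show ?thesis
        using val[OF C(1) \<phi>] val[OF C(2) \<psi>] val[OF CD \<phi>\<psi>] IH[OF C(1) \<phi>] IH[OF C(2) \<psi>] bidual_add[OF \<xi>]
        by simp
    qed
    have sc: "arens (\<xi> # \<xi>s) (\<lambda>xs. c * \<phi> xs) = c * arens (\<xi> # \<xi>s) \<phi>"
      if C: "0 \<le> C" and \<phi>: "bounded_form (Suc (length \<xi>s)) C \<phi>" for C \<phi> c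
    proof -
      have \<phi>\<psi>: "bounded_form (Suc (length \<xi>s)) (norm c * C) (\<lambda>xs. c * \<phi> xs)"
        using bounded_form_scale[OF \<phi>] .
      have CD: "0 \<le> norm c * C" using C by simp
      have "arens_slice \<xi>s (\<lambda>xs. c * \<phi> xs) = dual_scale c (arens_slice \<xi>s \<phi>)"
      proof (rule blinfun_eqI)
        fix x
        have "arens \<xi>s (\<lambda>xs. c * \<phi> (x # xs)) = c * arens \<xi>s (\<lambda>xs. \<phi> (x # xs))"
          by (rule IH_sc[of "C * norm x"]) (use C \<phi> in simp_all)
        then show "blinfun_apply (arens_slice \<xi>s (\<lambda>xs. c * \<phi> xs)) x = blinfun_apply (dual_scale c (arens_slice \<xi>s \<phi>)) x"
          using IH[OF C \<phi>] IH[OF CD \<phi>\<psi>] by simp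
      qed
      then show ?thesis
        using val[OF C \<phi>] val[OF CD \<phi>\<psi>] IH[OF C \<phi>] bidual_scale[OF \<xi>]
        by simp
    qed
    show ?case
      using le add sc slice[of "\<xi> # \<xi>s"] by simp
  }
qed

lemma arens_slice:
  assumes "set \<xi>s \<subseteq> bidual_ball s" "length \<xi>s = M" "0 \<le> C" "bounded_form (Suc M) C \<phi>"
  shows "blinfun_apply (arens_slice \<xi>s \<phi>) x = arens \<xi>s (\<lambda>xs. \<phi> (x # xs))"
    and "arens_slice \<xi>s \<phi> \<in> dual_space s" and "norm (arens_slice \<xi>s \<phi>) \<le> C"
  using arens_props[OF assms(1)] assms(2-4) by simp_all

lemma arens_Cons:
  assumes "\<xi> \<in> bidual_ball s" "set \<xi>s \<subseteq> bidual_ball s" "length \<xi>s = M" "0 \<le> C" "bounded_form (Suc M) C \<phi>"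
  shows "arens (\<xi> # \<xi>s) \<phi> = \<xi> (arens_slice \<xi>s \<phi>)"
proof -
  have "blinfun_apply (arens_slice \<xi>s \<phi>) = (\<lambda>x. arens \<xi>s (\<lambda>xs. \<phi> (x # xs)))"
    using arens_slice(1)[OF assms(2-5)] by blast
  then show ?thesis
    using arens_slice(2)[OF assms(2-5)] Lim_weak_star_filter[OF assms(1), of "arens_slice \<xi>s \<phi>"] by simp
qed

end

lemma multilinear_map_iff:
  assumes "vector_space s" "vector_space t"
  shows "multilinear_map s t N \<Phi> \<longleftrightarrow>
    (\<forall>xs i x y. length xs = N \<longrightarrow> i < N \<longrightarrow> \<Phi> (xs[i := x + y]) = \<Phi> (xs[i := x]) + \<Phi> (xs[i := y])) \<and>
    (\<forall>xs i c x. length xs = N \<longrightarrow> i < N \<longrightarrow> \<Phi> (xs[i := s c x]) = t c (\<Phi> (xs[i := x])))"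
  using assms unfolding multilinear_map_def Vector_Spaces.linear_iff by blast

locale banach_pair = X: banach_space_over sX + Y: banach_space_over sY
  for sX :: "'k::real_or_complex \<Rightarrow> 'a::banach \<Rightarrow> 'a" and sY :: "'k \<Rightarrow> 'b::banach \<Rightarrow> 'b"
begin

definition dual_valued :: "nat \<Rightarrow> real \<Rightarrow> ('a list \<Rightarrow> 'b \<Rightarrow>\<^sub>L 'k) \<Rightarrow> bool" where
  "dual_valued M C \<Phi> \<longleftrightarrow> 0 \<le> C \<and> multilinear_map sX dual_scale M \<Phi> \<and>
     (\<forall>xs. length xs = M \<longrightarrow> \<Phi> xs \<in> dual_space sY) \<and>
     (\<forall>xs. length xs = M \<longrightarrow> norm (\<Phi> xs) \<le> C * prod_list (map norm xs))"

lemma continuous_multilinear_map_dual_valued: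
  assumes "continuous_multilinear_map sX dual_scale (dual_space sY) M \<Phi>"
  shows "\<exists>C. dual_valued M C \<Phi>"
proof -
  obtain C where C: "\<And>xs. length xs = M \<Longrightarrow> norm (\<Phi> xs) \<le> C * prod_list (map norm xs)"
    using assms unfolding continuous_multilinear_map_def by blast
  have "norm (\<Phi> xs) \<le> \<bar>C\<bar> * prod_list (map norm xs)" if "length xs = M" for xs
  proof -
    have "0 \<le> prod_list (map norm xs)" by (induction xs) auto
    then have "C * prod_list (map norm xs) \<le> \<bar>C\<bar> * prod_list (map norm xs)"
      by (intro mult_right_mono) auto
    then show ?thesis using C[OF that] by linarith
  qed
  then show ?thesis
    using assms unfolding continuous_multilinear_map_def dual_valued_def
    by (intro exI[of _ "\<bar>C\<bar>"]) auto
qed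

lemma dual_valued_slice:
  assumes "dual_valued (Suc M) C \<Phi>"
  shows "dual_valued M (C * norm x) (\<lambda>xs. \<Phi> (x # xs))"
proof -
  have "multilinear_map sX dual_scale M (\<lambda>xs. \<Phi> (x # xs))"
    unfolding multilinear_map_def
  proof (intro allI impI)
    fix xs :: "'a list" and i assume "length xs = M" "i < M"
    then show "Vector_Spaces.linear sX dual_scale (\<lambda>y. \<Phi> (x # xs[i := y]))"
      using assms[unfolded dual_valued_def multilinear_map_def, THEN conjunct2, THEN conjunct1,
          rule_format, of "x # xs" "Suc i"] by simp
  qed
  moreover have "\<Phi> (x # xs) \<in> dual_space sY"
    "norm (\<Phi> (x # xs)) \<le> C * norm x * prod_list (map norm xs)" if "length xs = M" for xs
    using assms that unfolding dual_valued_def by (auto dest: spec[of _ "x # xs"] simp: mult.assoc)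
  ultimately show ?thesis
    using assms unfolding dual_valued_def by simp
qed

lemma dual_valued_head:
  assumes "dual_valued (Suc M) C \<Phi>" "length xs = M"
  shows "\<Phi> ((x + y) # xs) = \<Phi> (x # xs) + \<Phi> (y # xs)"
    and "\<Phi> (sX c x # xs) = dual_scale c (\<Phi> (x # xs))"
  using assms(1)[unfolded dual_valued_def multilinear_map_def, THEN conjunct2, THEN conjunct1,
      rule_format, of "x # xs" 0] assms(2)
  by (simp_all add: Vector_Spaces.linear_iff)

lemma dual_valued_bounded_form:
  assumes "dual_valued M C \<Phi>" "\<zeta> \<in> bidual_ball sY"
  shows "X.bounded_form M C (\<lambda>xs. \<zeta> (\<Phi> xs))"
  using assms(1)
proof (induction M arbitrary: C \<Phi>)
  case 0
  then show ?case
    using Y.bidual_le[OF assms(2), of "\<Phi> []"] by (auto simp: dual_valued_def)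
next
  case (Suc M)
  have V: "\<Phi> (x # xs) \<in> dual_space sY" if "length xs = M" for x xs
    using Suc.prems that by (simp add: dual_valued_def)
  then show ?case
    using Suc.IH[OF dual_valued_slice[OF Suc.prems]] dual_valued_head[OF Suc.prems] assms(2)
    by (simp add: Y.bidual_add Y.bidual_scale)
qed

end

section \<open>Expansion of maps into a separable dual\<close>

lemma sums_reindex_support:
  fixes f :: "'i \<Rightarrow> 'v::banach" and g :: "nat \<Rightarrow> 'i"
  assumes g: "inj g" and off: "\<And>i. i \<notin> range g \<Longrightarrow> f i = 0"
    and b: "bij (b :: nat \<Rightarrow> 'i)"
    and sums: "(\<lambda>n. f (g n)) sums S" and sn: "summable (\<lambda>n. norm (f (g n)))"
  shows "(\<lambda>k. f (b k)) sums S"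
proof -
  have "((\<lambda>n. f (g n)) has_sum S) UNIV"
    using norm_summable_imp_has_sum[OF sn sums] .
  then have "(f has_sum S) (range g)"
    using has_sum_reindex[OF g, of f S] by (simp add: o_def)
  then have "(f has_sum S) UNIV"
    by (subst has_sum_cong_neutral[of "range g" UNIV f f]) (use off in auto)
  then have "((\<lambda>k. f (b k)) has_sum S) UNIV"
    using has_sum_reindex_bij_betw[of b UNIV UNIV f S] b by simp
  then show ?thesis by (rule has_sum_imp_sums)
qed

context banach_space_over begin

lemma separable_dual_norming:
  fixes d :: "nat \<Rightarrow> 'a \<Rightarrow>\<^sub>L 'k"
  assumes d: "range d \<subseteq> dual_space s" "dual_space s \<subseteq> closure (range d)"
  shows "\<exists>P. countable P \<and> (\<forall>f\<in>dual_space s. \<forall>r\<ge>0.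
    (\<forall>p\<in>P. norm (blinfun_apply f p) \<le> r * norm p) \<longrightarrow> norm f \<le> r)"
proof -
  have ex: "\<exists>p. 0 \<le> q \<longrightarrow> q < norm (d j) \<longrightarrow> norm (blinfun_apply (d j) p) > q * norm p" for j :: nat and q
    using norm_blinfun_bound[of q "d j"] by (meson not_le)
  define p where "p j q = (SOME p. 0 \<le> q \<longrightarrow> q < norm (d j) \<longrightarrow> norm (blinfun_apply (d j) p) > q * norm p)" for j q
  have p: "0 \<le> q \<longrightarrow> q < norm (d j) \<longrightarrow> norm (blinfun_apply (d j) (p j q)) > q * norm (p j q)" for j q
    unfolding p_def by (rule someI_ex[OF ex])
  show ?thesis
  proof (intro exI[of _ "\<Union>j. p j ` \<rat>"] conjI ballI allI impI)
    show "countable (\<Union>j. p j ` \<rat>)" by (intro countable_UN countable_image countable_rat) auto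
    fix f r assume f: "f \<in> dual_space s"
      and le: "\<forall>x\<in>\<Union>j. p j ` \<rat>. norm (blinfun_apply f x) \<le> r * norm x" and r: "0 \<le> r"
    show "norm f \<le> r"
    proof (rule ccontr)
      assume "\<not> norm f \<le> r"
      define \<delta> where "\<delta> = (norm f - r) / 3"
      have \<delta>: "0 < \<delta>" "norm f = r + 3 * \<delta>" using \<open>\<not> norm f \<le> r\<close> by (simp_all add: \<delta>_def field_simps)
      obtain j where j: "norm (d j - f) < \<delta>"
        using closure_approachableD[OF subsetD[OF d(2) f] \<delta>(1)] by (auto simp: dist_norm norm_minus_commute)
      have nd: "norm f - \<delta> < norm (d j)" using norm_triangle_ineq2[of f "d j"] j by (simp add: norm_minus_commute)
      then obtain q where q: "q \<in> \<rat>" "r + \<delta> < q" "q < norm (d j)"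
        using Rats_dense_in_real[of "r + \<delta>" "norm (d j)"] \<delta> by auto
      let ?x = "p j q"
      have "norm (blinfun_apply (d j) ?x) \<le> norm (blinfun_apply f ?x) + norm (blinfun_apply (d j - f) ?x)"
        using norm_triangle_ineq[of "blinfun_apply f ?x" "blinfun_apply (d j - f) ?x"] by (simp add: blinfun.bilinear_simps)
      also have "\<dots> \<le> r * norm ?x + \<delta> * norm ?x"
        using bspec[OF le, of ?x] q(1) norm_blinfun[of "d j - f" ?x] mult_right_mono[OF less_imp_le[OF j] norm_ge_zero[of ?x]]
        by (auto intro!: add_mono)
      also have "\<dots> \<le> q * norm ?x" using mult_right_mono[OF less_imp_le[OF q(2)] norm_ge_zero[of ?x]] by (simp add: distrib_right)
      also have "\<dots> < norm (blinfun_apply (d j) ?x)" using p[of q j] q \<delta> r by simp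
      finally show False by simp
    qed
  qed
qed

lemma separable_dual_enumeration:
  assumes "separable_set (dual_space s)"
  obtains d :: "nat \<Rightarrow> 'a \<Rightarrow>\<^sub>L 'k" where "d 0 = 0" "range d \<subseteq> dual_space s" "dual_space s \<subseteq> closure (range d)"
proof -
  obtain D where D: "countable D" "D \<subseteq> dual_space s" "dual_space s \<subseteq> closure D"
    using assms unfolding separable_set_def by auto
  define d where "d n = (case n of 0 \<Rightarrow> 0 | Suc j \<Rightarrow> from_nat_into (insert 0 D) j)" for n
  have r: "range (from_nat_into (insert 0 D)) = insert 0 D" using D by (intro range_from_nat_into) auto
  have "range d = insert 0 D"
  proof
    show "range d \<subseteq> insert 0 D" using r by (auto simp: d_def split: nat.splits)
    show "insert 0 D \<subseteq> range d"
      using r by (metis (no_types, lifting) d_def image_subset_iff nat.case(2) rangeE rangeI subsetI)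
  qed
  then show ?thesis
    using D closure_mono[of D "insert 0 D"] by (intro that[of d]) (auto simp: d_def)
qed

text \<open>A bounded map into the separable dual that is measurable at every point of the space is
  Bochner integrable, and its integral can be taken termwise in the following expansion.\<close>

lemma dual_valued_expansion:
  fixes F :: "'c \<Rightarrow> 'a \<Rightarrow>\<^sub>L 'k"
  assumes sep: "separable_set (dual_space s)" and M: "finite_measure M"
    and F: "\<And>z. z \<in> space M \<Longrightarrow> F z \<in> dual_space s"
    and F_le: "\<And>z. z \<in> space M \<Longrightarrow> norm (F z) \<le> C"
    and F_meas: "\<And>x. (\<lambda>z. blinfun_apply (F z) x) \<in> borel_measurable M"
  obtains E :: "nat \<Rightarrow> 'c set" and e :: "nat \<Rightarrow> 'a \<Rightarrow>\<^sub>L 'k" where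
    "\<And>n. E n \<in> sets M" "\<And>n. e n \<in> dual_space s"
    "summable (\<lambda>n. measure M (E n) * norm (e n))"
    "\<And>z. z \<in> space M \<Longrightarrow> (\<lambda>n. indicator (E n) z *\<^sub>R e n) sums F z"
    "\<And>z. z \<in> space M \<Longrightarrow> summable (\<lambda>n. norm (indicator (E n) z *\<^sub>R e n))"
proof -
  interpret finite_measure M by (rule M)
  obtain d :: "nat \<Rightarrow> 'a \<Rightarrow>\<^sub>L 'k" where d: "d 0 = 0" "range d \<subseteq> dual_space s" "dual_space s \<subseteq> closure (range d)"
    by (rule separable_dual_enumeration[OF sep])
  obtain P where P: "countable P" "\<forall>f\<in>dual_space s. \<forall>r\<ge>0.
      (\<forall>p\<in>P. norm (blinfun_apply f p) \<le> r * norm p) \<longrightarrow> norm f \<le> r"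
    using separable_dual_norming[OF d(2,3)] by blast
  define q where "q = from_nat_into (insert 0 P)"
  have q: "P \<subseteq> range q" unfolding q_def using P(1) by (subst range_from_nat_into) auto
  have dV: "d j \<in> dual_space s" for j using d(2) by auto
  define C' where "C' = \<bar>C\<bar> + 1"
  have C': "0 < C'" "C < C'" by (auto simp: C'_def)
  have nm: "(\<lambda>z. norm (F z - d j)) \<in> borel_measurable M" for j
  proof (rule borel_measurable_iff_le[THEN iffD2], rule allI)
    fix r :: real
    show "{z \<in> space M. norm (F z - d j) \<le> r} \<in> sets M"
    proof (cases "0 \<le> r")
      case True
      have "{z \<in> space M. norm (F z - d j) \<le> r} =
          {z \<in> space M. \<forall>i. norm (blinfun_apply (F z) (q i) - blinfun_apply (d j) (q i)) \<le> r * norm (q i)}"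
        (is "?A = ?B")
      proof
        show "?B \<subseteq> ?A"
        proof clarify
          fix z assume z: "z \<in> space M"
            and le: "\<forall>i. norm (blinfun_apply (F z) (q i) - blinfun_apply (d j) (q i)) \<le> r * norm (q i)"
          then have "norm (blinfun_apply (F z - d j) p) \<le> r * norm p" if "p \<in> P" for p
            using q that by (auto simp: blinfun.bilinear_simps)
          then show "norm (F z - d j) \<le> r"
            using P(2)[rule_format, of "F z - d j" r] F[OF z] dV True by auto
        qed
        show "?A \<subseteq> ?B"
        proof clarify
          fix z i assume "norm (F z - d j) \<le> r"
          then show "norm (blinfun_apply (F z) (q i) - blinfun_apply (d j) (q i)) \<le> r * norm (q i)"
            using norm_blinfun[of "F z - d j" "q i"] mult_right_mono[of "norm (F z - d j)" r "norm (q i)"]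
            by (simp add: blinfun.bilinear_simps)
        qed
      qed
      also have "\<dots> \<in> sets M"
      proof -
        have [measurable]: "(\<lambda>z. blinfun_apply (F z) p) \<in> borel_measurable M" for p by (rule F_meas)
        show ?thesis by measurable
      qed
      finally show ?thesis .
    next
      case False
      have "\<not> norm (F z - d j) \<le> r" for z
        using False norm_ge_zero[of "F z - d j"] by linarith
      then show ?thesis by simp
    qed
  qed
  define N where "N n z = (LEAST j. norm (F z - d j) < C' * (1/2)^n)" for n :: nat and z
  have N_meas[measurable]: "N n \<in> measurable M (count_space UNIV)" for n
  proof -
    have [measurable]: "(\<lambda>z. norm (F z - d j)) \<in> borel_measurable M" for j by (rule nm)
    show ?thesis unfolding N_def by measurable
  qed
  have N: "norm (F z - d (N n z)) < C' * (1/2)^n" if z: "z \<in> space M" for n z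
  proof -
    have "0 < C' * (1/2)^n" using C' by simp
    then obtain j where "norm (F z - d j) < C' * (1/2)^n"
      using closure_approachableD[OF subsetD[OF d(3) F[OF z]]] by (auto simp: dist_norm norm_minus_commute)
    then show ?thesis unfolding N_def by (rule LeastI)
  qed
  have N0: "N 0 z = 0" if z: "z \<in> space M" for z
    unfolding N_def using F_le[OF z] C' d(1) by (intro Least_eq_0) simp
  define G where "G = (\<lambda>(n, i, j). {z \<in> space M. N n z = i \<and> N (Suc n) z = j})"
  define g where "g = (\<lambda>(n::nat, i, j). d j - d i)"
  define b where "b = from_nat_into (UNIV :: (nat \<times> nat \<times> nat) set)"
  have b: "bij b" unfolding b_def
    by (intro bij_betw_from_nat_into) (auto simp: finite_prod)
  have Gs: "G t \<in> sets M" for t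
    unfolding G_def by (cases t) simp
  have gV: "g t \<in> dual_space s" for t
    unfolding g_def using dV by (cases t) auto
  have S: "(\<lambda>k. indicator (G (b k)) z *\<^sub>R g (b k)) sums F z"
      "summable (\<lambda>k. norm (indicator (G (b k)) z *\<^sub>R g (b k)))"
      "(\<Sum>k. norm (indicator (G (b k)) z *\<^sub>R g (b k))) \<le> 4 * C'" if z: "z \<in> space M" for z
  proof -
    define h where "h n = (n, N n z, N (Suc n) z)" for n
    have h: "inj h" by (auto simp: h_def inj_def)
    have off: "indicator (G t) z *\<^sub>R g t = 0" if "t \<notin> range h" for t
      using that by (cases t) (auto simp: G_def h_def indicator_def)
    have on: "indicator (G (h n)) z *\<^sub>R g (h n) = d (N (Suc n) z) - d (N n z)" for n
      using z by (simp add: G_def g_def h_def)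
    have le: "norm (d (N (Suc n) z) - d (N n z)) \<le> 2 * C' * (1/2)^n" for n
    proof -
      have "norm (d (N (Suc n) z) - d (N n z)) \<le> norm (F z - d (N (Suc n) z)) + norm (F z - d (N n z))"
        using norm_triangle_ineq4[of "F z - d (N n z)" "F z - d (N (Suc n) z)"] by simp
      also have "\<dots> \<le> C' * (1/2)^Suc n + C' * (1/2)^n"
        using N[OF z, of n] N[OF z, of "Suc n"] by simp
      also have "\<dots> \<le> 2 * C' * (1/2)^n" using C' by simp
      finally show ?thesis .
    qed
    have geo: "(\<lambda>n. 2 * C' * (1/2)^n) sums (2 * C' * 2)"
      using geometric_sums[of "1/2::real"] by (intro sums_mult) simp
    have sn: "summable (\<lambda>n. norm (d (N (Suc n) z) - d (N n z)))"
      by (rule summable_comparison_test'[where N=0, OF sums_summable[OF geo]]) (use le in simp)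
    have "(\<lambda>n. F z - d (N n z)) \<longlonglongrightarrow> 0"
    proof (rule Lim_null_comparison)
      show "\<forall>\<^sub>F n in sequentially. norm (F z - d (N n z)) \<le> C' * (1/2)^n"
        using N[OF z] by (intro always_eventually allI less_imp_le)
      show "(\<lambda>n. C' * (1/2)^n) \<longlonglongrightarrow> 0"
        by (intro tendsto_mult_right_zero LIMSEQ_power_zero) simp
    qed
    then have "(\<lambda>n. d (N n z)) \<longlonglongrightarrow> F z"
      using tendsto_diff[OF tendsto_const[of "F z" sequentially], of "\<lambda>n. F z - d (N n z)" 0] by simp
    then have "(\<lambda>n. d (N (Suc n) z) - d (N n z)) sums (F z - d (N 0 z))"
      by (rule telescope_sums)
    then have s1: "(\<lambda>n. d (N (Suc n) z) - d (N n z)) sums F z" using N0[OF z] d(1) by simp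
    show "(\<lambda>k. indicator (G (b k)) z *\<^sub>R g (b k)) sums F z"
      by (rule sums_reindex_support[OF h _ b, where f="\<lambda>t. indicator (G t) z *\<^sub>R g t"])
        (erule off, simp_all only: on s1 sn)
    have s2: "(\<lambda>k. norm (indicator (G (b k)) z *\<^sub>R g (b k))) sums (\<Sum>n. norm (d (N (Suc n) z) - d (N n z)))"
      by (rule sums_reindex_support[OF h _ b, where f="\<lambda>t. norm (indicator (G t) z *\<^sub>R g t)"])
        (simp add: off, simp_all only: on summable_sums[OF sn] sn real_norm_def abs_norm_cancel)
    then show "summable (\<lambda>k. norm (indicator (G (b k)) z *\<^sub>R g (b k)))" by (rule sums_summable)
    have "(\<Sum>n. norm (d (N (Suc n) z) - d (N n z))) \<le> (\<Sum>n. 2 * C' * (1/2)^n)"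
      using le sn sums_summable[OF geo] by (intro suminf_le) auto
    then show "(\<Sum>k. norm (indicator (G (b k)) z *\<^sub>R g (b k))) \<le> 4 * C'"
      using s2 geo by (simp add: sums_iff)
  qed
  show ?thesis
  proof (rule that[of "\<lambda>k. G (b k)" "\<lambda>k. g (b k)"])
    show "summable (\<lambda>k. measure M (G (b k)) * norm (g (b k)))"
    proof (rule summableI_nonneg_bounded)
      fix m
      have "(\<Sum>k<m. measure M (G (b k)) * norm (g (b k)))
          = (\<integral>z. (\<Sum>k<m. indicator (G (b k)) z * norm (g (b k))) \<partial>M)"
        using Gs by (subst Bochner_Integration.integral_sum) (auto simp: less_top[symmetric])
      also have "\<dots> \<le> (\<integral>z. 4 * C' \<partial>M)"
      proof (rule integral_mono)
        show "integrable M (\<lambda>z. \<Sum>k<m. indicator (G (b k)) z * norm (g (b k)))"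
          using Gs by (intro Bochner_Integration.integrable_sum Bochner_Integration.integrable_mult_left integrable_real_indicator)
            (simp_all add: less_top[symmetric])
        fix z assume z: "z \<in> space M"
        have "(\<Sum>k<m. indicator (G (b k)) z * norm (g (b k))) = (\<Sum>k<m. norm (indicator (G (b k)) z *\<^sub>R g (b k)))"
          by (simp add: abs_indicator)
        also have "\<dots> \<le> (\<Sum>k. norm (indicator (G (b k)) z *\<^sub>R g (b k)))"
          using S(2)[OF z] by (intro sum_le_suminf) auto
        finally show "(\<Sum>k<m. indicator (G (b k)) z * norm (g (b k))) \<le> 4 * C'" using S(3)[OF z] by linarith
      qed auto
      finally show "(\<Sum>k<m. measure M (G (b k)) * norm (g (b k))) \<le> (\<integral>z. 4 * C' \<partial>M)" .
    qed auto
  qed (use Gs gV S(1,2) in auto)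
qed

end

section \<open>Completed tensor products\<close>

lemma approx_series:
  fixes f :: "'p \<Rightarrow> 'v::banach" and w :: "'p \<Rightarrow> real"
  assumes f_le: "\<And>p. norm (f p) \<le> w p" and p0: "f p0 = 0" "w p0 = 0"
    and approx: "\<And>u \<epsilon>. 0 < \<epsilon> \<Longrightarrow>
      \<exists>ps. norm (u - (\<Sum>p\<leftarrow>ps. f p)) < \<epsilon> \<and> (\<Sum>p\<leftarrow>ps. w p) \<le> norm u + \<epsilon>"
  shows "\<exists>p. (\<lambda>n::nat. f (p n)) sums u \<and> summable (\<lambda>n. w (p n))"
proof -
  have w0: "0 \<le> w p" for p using f_le[of p] norm_ge_zero[of "f p"] by linarith
  define A where "A u n = (SOME ps. norm (u - (\<Sum>p\<leftarrow>ps. f p)) < (1/2)^n \<and> (\<Sum>p\<leftarrow>ps. w p) \<le> norm u + (1/2)^n)" for u and n :: nat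
  have A: "norm (u - (\<Sum>p\<leftarrow>A u n. f p)) < (1/2)^n \<and> (\<Sum>p\<leftarrow>A u n. w p) \<le> norm u + (1/2)^n" for u n
    unfolding A_def by (rule someI_ex) (rule approx, simp)
  define U where "U = rec_nat u (\<lambda>n v. v - (\<Sum>p\<leftarrow>A v n. f p))"
  have U: "U 0 = u" "U (Suc n) = U n - (\<Sum>p\<leftarrow>A (U n) n. f p)" for n by (simp_all add: U_def)
  have U_le: "norm (U n) \<le> (norm u + 1) * 2 * (1/2)^n" for n
  proof (cases n)
    case 0
    then show ?thesis using U(1) norm_ge_zero[of u] by simp
  next
    case (Suc k)
    have "norm (U n) \<le> 1 * 2 * (1/2)^n" using A[of "U k" k] U(2)[of k] Suc by simp
    also have "\<dots> \<le> (norm u + 1) * 2 * (1/2)^n" by (intro mult_right_mono) auto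
    finally show ?thesis .
  qed
  define L where "L n = A (U n) n" for n
  have L_mass: "(\<Sum>p\<leftarrow>L n. w p) \<le> (2 * norm u + 3) * (1/2)^n" for n
    using A[of "U n" n] U_le[of n] by (simp add: L_def algebra_simps)
  have sL: "(\<lambda>n. \<Sum>p\<leftarrow>L n. f p) sums u"
  proof -
    have "U \<longlonglongrightarrow> 0"
    proof (rule Lim_null_comparison)
      show "\<forall>\<^sub>F n in sequentially. norm (U n) \<le> (norm u + 1) * 2 * (1/2)^n" using U_le by simp
      show "(\<lambda>n. (norm u + 1) * 2 * (1/2)^n) \<longlonglongrightarrow> 0"
        by (intro tendsto_mult_right_zero LIMSEQ_power_zero) simp
    qed
    then have "(\<lambda>n. U n - U (Suc n)) sums (U 0 - 0)" by (rule telescope_sums')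
    then show ?thesis by (simp add: U L_def)
  qed
  define P where "P = (\<lambda>(n, j). if j < length (L n) then L n ! j else p0)"
  let ?S = "Sigma UNIV (\<lambda>n. {..<length (L n)})"
  have fin: "((\<lambda>j. h (P (n, j))) has_sum (\<Sum>p\<leftarrow>L n. h p)) {..<length (L n)}" for h :: "'p \<Rightarrow> 'w::real_normed_vector" and n
  proof -
    have "((\<lambda>j. h (P (n, j))) has_sum (\<Sum>j<length (L n). h (P (n, j)))) {..<length (L n)}"
      by (rule has_sum_finite) simp
    also have "(\<Sum>j<length (L n). h (P (n, j))) = (\<Sum>p\<leftarrow>L n. h p)"
      by (simp add: P_def sum_list_sum_nth atLeast0LessThan)
    finally show ?thesis .
  qed
  have mass0: "0 \<le> (\<Sum>p\<leftarrow>L n. w p)" for n by (rule sum_list_nonneg) (use w0 in auto)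
  have sm: "summable (\<lambda>n. \<Sum>p\<leftarrow>L n. w p)"
  proof (rule summable_comparison_test'[where N=0])
    show "summable (\<lambda>n. (2 * norm u + 3) * (1/2)^n)" by (intro summable_mult summable_geometric) simp
    show "norm (\<Sum>p\<leftarrow>L n. w p) \<le> (2 * norm u + 3) * (1/2)^n" for n
      using L_mass[of n] mass0[of n] by simp
  qed
  have wS: "(\<lambda>t. w (P t)) summable_on ?S"
  proof (rule summable_on_SigmaI)
    show "((\<lambda>j. w (P (n, j))) has_sum (\<Sum>p\<leftarrow>L n. w p)) {..<length (L n)}" for n by (rule fin)
    show "(\<lambda>n. \<Sum>p\<leftarrow>L n. w p) summable_on UNIV"
      using sm mass0 by (subst summable_on_UNIV_nonneg_real_iff) auto
  qed (rule w0)
  then have "(\<lambda>t. f (P t)) abs_summable_on ?S"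
    by (rule summable_on_comparison_test) (use f_le in auto)
  then have fS: "(\<lambda>t. f (P t)) summable_on ?S" by (rule abs_summable_summable)
  have "((\<lambda>n. \<Sum>p\<leftarrow>L n. f p) has_sum u) UNIV"
  proof (rule norm_summable_imp_has_sum[OF _ sL])
    show "summable (\<lambda>n. norm (\<Sum>p\<leftarrow>L n. f p))"
    proof (rule summable_comparison_test'[where N=0, OF sm])
      have "norm (\<Sum>p\<leftarrow>l. f p) \<le> (\<Sum>p\<leftarrow>l. w p)" for l
        by (induction l) (auto intro!: order_trans[OF norm_triangle_ineq] add_mono f_le)
      then show "norm (norm (\<Sum>p\<leftarrow>L n. f p)) \<le> (\<Sum>p\<leftarrow>L n. w p)" for n by simp
    qed
  qed
  then have "((\<lambda>t. f (P t)) has_sum u) ?S"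
    using fS by (intro has_sum_SigmaI[where g="\<lambda>n. \<Sum>p\<leftarrow>L n. f p"] fin) auto
  then have "((\<lambda>t. f (P t)) has_sum u) UNIV"
    by (subst (asm) has_sum_cong_neutral[of UNIV ?S _ "\<lambda>t. f (P t)"]) (auto simp: P_def p0 split: if_splits)
  then have f_sum: "((\<lambda>n. f (P (prod_decode n))) has_sum u) UNIV"
    using has_sum_reindex_bij_betw[of prod_decode UNIV UNIV "\<lambda>t. f (P t)" u] bij_prod_decode by simp
  have "(\<lambda>t. w (P t)) summable_on UNIV"
    using wS by (subst (asm) summable_on_cong_neutral[of UNIV ?S _ "\<lambda>t. w (P t)"])
      (auto simp: P_def p0 split: if_splits)
  then have "(\<lambda>n. w (P (prod_decode n))) summable_on UNIV"
    using summable_on_reindex_bij_betw[of prod_decode UNIV UNIV "\<lambda>t. w (P t)"] bij_prod_decode by simp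
  then show ?thesis
    using has_sum_imp_sums[OF f_sum] summable_on_imp_summable by (intro exI[of _ "\<lambda>n. P (prod_decode n)"]) auto
qed

lemma completion_dense_eq:
  fixes f g :: "'e::banach \<Rightarrow>\<^sub>L 'k::real_or_complex"
  assumes "closure (\<iota> ` V) = UNIV" "\<And>v. v \<in> V \<Longrightarrow> blinfun_apply f (\<iota> v) = blinfun_apply g (\<iota> v)"
  shows "f = g"
proof (rule blinfun_eqI)
  fix x
  have "closed {x. blinfun_apply f x = blinfun_apply g x}"
    by (intro closed_Collect_eq continuous_intros)
  then have "closure (\<iota> ` V) \<subseteq> {x. blinfun_apply f x = blinfun_apply g x}"
    using assms(2) by (intro closure_minimal) auto
  then show "blinfun_apply f x = blinfun_apply g x" using assms(1) by auto
qed

lemma completion_functional: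
  fixes \<iota> :: "('i \<Rightarrow> 'k::real_or_complex) \<Rightarrow> 'e::banach" and \<psi> :: "('i \<Rightarrow> 'k) \<Rightarrow> 'k"
  assumes compl: "is_completion V nrm t \<iota>"
    and V_add: "\<And>u v. u \<in> V \<Longrightarrow> v \<in> V \<Longrightarrow> (\<lambda>i. u i + v i) \<in> V"
    and V_scale: "\<And>c v. v \<in> V \<Longrightarrow> (\<lambda>i. c * v i) \<in> V"
    and \<psi>_add: "\<And>u v. u \<in> V \<Longrightarrow> v \<in> V \<Longrightarrow> \<psi> (\<lambda>i. u i + v i) = \<psi> u + \<psi> v"
    and \<psi>_scale: "\<And>c v. v \<in> V \<Longrightarrow> \<psi> (\<lambda>i. c * v i) = c * \<psi> v"
    and \<psi>_le: "\<And>v. v \<in> V \<Longrightarrow> norm (\<psi> v) \<le> C * nrm v" and C: "0 \<le> C"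
  shows "\<exists>L\<in>dual_space t. norm L \<le> C \<and> (\<forall>v\<in>V. blinfun_apply L (\<iota> v) = \<psi> v)"
proof -
  interpret t: banach_space_over t using compl by (simp add: is_completion_def)
  have \<iota>_add: "\<And>u v. u \<in> V \<Longrightarrow> v \<in> V \<Longrightarrow> \<iota> (\<lambda>i. u i + v i) = \<iota> u + \<iota> v"
    and \<iota>_scale: "\<And>c v. v \<in> V \<Longrightarrow> \<iota> (\<lambda>i. c * v i) = t c (\<iota> v)"
    and \<iota>_norm: "\<And>v. v \<in> V \<Longrightarrow> norm (\<iota> v) = nrm v"
    and dense: "closure (\<iota> ` V) = UNIV"
    using compl unfolding is_completion_def by blast+
  have diff: "(\<lambda>i. u i - v i) \<in> V" "\<iota> (\<lambda>i. u i - v i) = \<iota> u - \<iota> v" "\<psi> (\<lambda>i. u i - v i) = \<psi> u - \<psi> v"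
    if uv: "u \<in> V" "v \<in> V" for u v
  proof -
    have eq: "(\<lambda>i. u i - v i) = (\<lambda>i. u i + (\<lambda>i. (-1) * v i) i)" by auto
    have v': "(\<lambda>i. (-1) * v i) \<in> V" using V_scale[OF uv(2)] .
    show "(\<lambda>i. u i - v i) \<in> V" unfolding eq by (rule V_add[OF uv(1) v'])
    show "\<iota> (\<lambda>i. u i - v i) = \<iota> u - \<iota> v"
      unfolding eq \<iota>_add[OF uv(1) v'] \<iota>_scale[OF uv(2)]
      by (simp add: t.scale_minus_left)
    show "\<psi> (\<lambda>i. u i - v i) = \<psi> u - \<psi> v"
      unfolding eq \<psi>_add[OF uv(1) v'] \<psi>_scale[OF uv(2)] by simp
  qed
  have lip: "norm (\<psi> u - \<psi> v) \<le> C * norm (\<iota> u - \<iota> v)" if "u \<in> V" "v \<in> V" for u v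
    using \<psi>_le[OF diff(1)[OF that]] \<iota>_norm[OF diff(1)[OF that]] diff[OF that] by simp
  define g where "g x = \<psi> (SOME v. v \<in> V \<and> \<iota> v = x)" for x
  have g: "g (\<iota> v) = \<psi> v" if v: "v \<in> V" for v
  proof -
    let ?w = "SOME w. w \<in> V \<and> \<iota> w = \<iota> v"
    have w: "?w \<in> V \<and> \<iota> ?w = \<iota> v" by (rule someI[of _ v]) (use v in blast)
    then have "norm (\<psi> ?w - \<psi> v) \<le> 0" using lip[of ?w v] v by simp
    then show ?thesis by (simp add: g_def)
  qed
  have "(C + 1)-lipschitz_on (\<iota> ` V) g"
  proof (rule lipschitz_onI)
    fix x y assume "x \<in> \<iota> ` V" "y \<in> \<iota> ` V"
    then obtain u v where uv: "u \<in> V" "v \<in> V" "x = \<iota> u" "y = \<iota> v" by auto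
    have "dist (g x) (g y) \<le> C * dist x y" using lip[OF uv(1,2)] uv g by (simp add: dist_norm)
    also have "\<dots> \<le> (C + 1) * dist x y" by (intro mult_right_mono) auto
    finally show "dist (g x) (g y) \<le> (C + 1) * dist x y" .
  qed (use C in simp)
  then have "uniformly_continuous_on (\<iota> ` V) g" by (rule lipschitz_on_uniformly_continuous)
  then obtain h where h: "uniformly_continuous_on UNIV h" "\<And>x. x \<in> \<iota> ` V \<Longrightarrow> g x = h x"
    by (rule uniformly_continuous_on_extension_on_closure) (simp add: dense)
  have hc: "continuous_on UNIV h" using h(1) by (rule uniformly_continuous_imp_continuous)
  have h\<iota>: "h (\<iota> v) = \<psi> v" if "v \<in> V" for v using h(2) g that by auto
  have seq: "\<exists>v. (\<forall>n. v n \<in> V) \<and> (\<lambda>n. \<iota> (v n)) \<longlonglongrightarrow> x" for x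
  proof -
    have "x \<in> closure (\<iota> ` V)" using dense by simp
    then obtain y where y: "\<forall>n. y n \<in> \<iota> ` V" "y \<longlonglongrightarrow> x" unfolding closure_sequential by blast
    then have "\<forall>n. \<exists>v. v \<in> V \<and> y n = \<iota> v" by blast
    then obtain v where v: "\<forall>n. v n \<in> V \<and> y n = \<iota> (v n)" by metis
    then have "y = (\<lambda>n. \<iota> (v n))" by auto
    then show ?thesis using y(2) v by blast
  qed
  have lim: "(\<lambda>n. \<psi> (v n)) \<longlonglongrightarrow> h x" if "\<forall>n. v n \<in> V" "(\<lambda>n. \<iota> (v n)) \<longlonglongrightarrow> x" for v :: "nat \<Rightarrow> _" and x
  proof -
    have "(\<lambda>n. h (\<iota> (v n))) \<longlonglongrightarrow> h x"
      using continuous_on_tendsto_compose[OF hc that(2)] by simp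
    then show ?thesis using h\<iota> that(1) by simp
  qed
  have h_add: "h (x + y) = h x + h y" for x y
  proof -
    obtain u where u: "\<forall>n. u n \<in> V" "(\<lambda>n. \<iota> (u n)) \<longlonglongrightarrow> x" using seq by blast
    obtain v where v: "\<forall>n. v n \<in> V" "(\<lambda>n. \<iota> (v n)) \<longlonglongrightarrow> y" using seq by blast
    have "(\<lambda>n. \<psi> (\<lambda>i. u n i + v n i)) \<longlonglongrightarrow> h (x + y)"
      using u v tendsto_add[OF u(2) v(2)] by (intro lim) (auto simp: V_add \<iota>_add)
    then have "(\<lambda>n. \<psi> (u n) + \<psi> (v n)) \<longlonglongrightarrow> h (x + y)" using u v by (simp add: \<psi>_add)
    moreover have "(\<lambda>n. \<psi> (u n) + \<psi> (v n)) \<longlonglongrightarrow> h x + h y"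
      by (intro tendsto_add lim u v)
    ultimately show ?thesis by (rule LIMSEQ_unique)
  qed
  have h_scale: "h (t c x) = c * h x" for c x
  proof -
    obtain u where u: "\<forall>n. u n \<in> V" "(\<lambda>n. \<iota> (u n)) \<longlonglongrightarrow> x" using seq by blast
    have "(\<lambda>n. \<psi> (\<lambda>i. c * u n i)) \<longlonglongrightarrow> h (t c x)"
      using u bounded_linear.tendsto[OF t.bounded_linear_scale u(2)] by (intro lim) (auto simp: V_scale \<iota>_scale)
    then have "(\<lambda>n. c * \<psi> (u n)) \<longlonglongrightarrow> h (t c x)" using u by (simp add: \<psi>_scale)
    moreover have "(\<lambda>n. c * \<psi> (u n)) \<longlonglongrightarrow> c * h x"
      by (intro tendsto_mult tendsto_const lim u)
    ultimately show ?thesis by (rule LIMSEQ_unique)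
  qed
  have h_le: "norm (h x) \<le> C * norm x" for x
  proof -
    obtain u where u: "\<forall>n. u n \<in> V" "(\<lambda>n. \<iota> (u n)) \<longlonglongrightarrow> x" using seq by blast
    show ?thesis
    proof (rule LIMSEQ_le)
      show "(\<lambda>n. norm (\<psi> (u n))) \<longlonglongrightarrow> norm (h x)" by (intro tendsto_norm lim u)
      show "(\<lambda>n. C * norm (\<iota> (u n))) \<longlonglongrightarrow> C * norm x" by (intro tendsto_mult tendsto_norm tendsto_const u)
      show "\<exists>N. \<forall>n\<ge>N. norm (\<psi> (u n)) \<le> C * norm (\<iota> (u n))" using u \<psi>_le \<iota>_norm by simp
    qed
  qed
  have bl: "bounded_linear h"
  proof (rule bounded_linear_intro[of _ C])
    show "h (r *\<^sub>R x) = r *\<^sub>R h x" for r x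
      using h_scale[of "of_real r" x] by (simp add: t.scale_of_real scaleR_conv_of_real)
  qed (use h_add h_le in \<open>auto simp: mult.commute\<close>)
  show ?thesis
    using h_scale h_le C h\<iota>
    by (intro bexI[of _ "Blinfun h"])
      (auto simp: bounded_linear_Blinfun_apply[OF bl] t.dual_space_iff intro!: norm_blinfun_bound)
qed

locale completed_tensor = banach_pair sX sY
  for sX :: "'k::real_or_complex \<Rightarrow> 'a::banach \<Rightarrow> 'a" and sY :: "'k \<Rightarrow> 'b::banach \<Rightarrow> 'b" +
  fixes N :: nat
    and sE :: "'k \<Rightarrow> 'e::banach \<Rightarrow> 'e" and \<iota> :: "(('a list \<Rightarrow> 'k) \<Rightarrow> 'k) \<Rightarrow> 'e"
    and sG :: "'k \<Rightarrow> 'g::banach \<Rightarrow> 'g" and \<kappa> :: "(('e \<Rightarrow> 'b \<Rightarrow> 'k) \<Rightarrow> 'k) \<Rightarrow> 'g"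
  assumes N: "N \<ge> 1"
    and E: "is_completion (sym_tensors sX N) (sym_proj_norm sX N) sE \<iota>"
    and G: "is_completion (tensors sE sY) (proj_norm sE sY) sG \<kappa>"
begin

sublocale E: banach_space_over sE using E by (simp add: is_completion_def)
sublocale G: banach_space_over sG using G by (simp add: is_completion_def)

lemma \<iota>_add: "u \<in> sym_tensors sX N \<Longrightarrow> v \<in> sym_tensors sX N \<Longrightarrow> \<iota> (\<lambda>i. u i + v i) = \<iota> u + \<iota> v"
  and \<iota>_scale: "v \<in> sym_tensors sX N \<Longrightarrow> \<iota> (\<lambda>i. c * v i) = sE c (\<iota> v)"
  and \<iota>_norm: "v \<in> sym_tensors sX N \<Longrightarrow> norm (\<iota> v) = sym_proj_norm sX N v"
  and \<iota>_dense: "closure (\<iota> ` sym_tensors sX N) = UNIV"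
  using E unfolding is_completion_def by blast+

lemma \<kappa>_add: "u \<in> tensors sE sY \<Longrightarrow> v \<in> tensors sE sY \<Longrightarrow> \<kappa> (\<lambda>i. u i + v i) = \<kappa> u + \<kappa> v"
  and \<kappa>_scale: "v \<in> tensors sE sY \<Longrightarrow> \<kappa> (\<lambda>i. c * v i) = sG c (\<kappa> v)"
  and \<kappa>_norm: "v \<in> tensors sE sY \<Longrightarrow> norm (\<kappa> v) = proj_norm sE sY v"
  and \<kappa>_dense: "closure (\<kappa> ` tensors sE sY) = UNIV"
  using G unfolding is_completion_def by blast+

lemma sym_tensor_sum_simps:
  "sym_tensor_sum s N [] = (\<lambda>_. 0)"
  "sym_tensor_sum s N ((c, x) # ts) = (\<lambda>\<phi>. c * tensor_power s N x \<phi> + sym_tensor_sum s N ts \<phi>)"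
  "sym_tensor_sum s N (ts @ us) = (\<lambda>\<phi>. sym_tensor_sum s N ts \<phi> + sym_tensor_sum s N us \<phi>)"
  "sym_tensor_sum s N (map (\<lambda>(d, x). (c * d, x)) ts) = (\<lambda>\<phi>. c * sym_tensor_sum s N ts \<phi>)"
  by (auto simp: sym_tensor_sum_def case_prod_unfold o_def sum_list_const_mult mult.assoc)

lemma sym_tensors_add: "u \<in> sym_tensors sX N \<Longrightarrow> v \<in> sym_tensors sX N \<Longrightarrow> (\<lambda>i. u i + v i) \<in> sym_tensors sX N"
  unfolding sym_tensors_def by (auto simp: sym_tensor_sum_simps(3)[symmetric])

lemma sym_tensors_scale: "v \<in> sym_tensors sX N \<Longrightarrow> (\<lambda>i. c * v i) \<in> sym_tensors sX N"
  unfolding sym_tensors_def by (auto simp: sym_tensor_sum_simps(4)[symmetric])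

lemma tensor_power_in: "tensor_power sX N x \<in> sym_tensors sX N"
  unfolding sym_tensors_def
  by (rule range_eqI[of _ _ "[(1, x)]"]) (simp add: sym_tensor_sum_simps)

lemma \<iota>_sum: "\<iota> (sym_tensor_sum sX N ts) = (\<Sum>(c, x)\<leftarrow>ts. sE c (\<iota> (tensor_power sX N x)))"
proof (induction ts)
  case Nil
  have "\<iota> (\<lambda>\<phi>. 0 * tensor_power sX N 0 \<phi>) = 0" by (subst \<iota>_scale[OF tensor_power_in]) simp
  then show ?case by (simp add: sym_tensor_sum_simps)
next
  case (Cons a ts)
  obtain c x where a: "a = (c, x)" by (cases a)
  have "\<iota> (\<lambda>\<phi>. c * tensor_power sX N x \<phi> + sym_tensor_sum sX N ts \<phi>) =
      sE c (\<iota> (tensor_power sX N x)) + \<iota> (sym_tensor_sum sX N ts)"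
    by (subst \<iota>_add[OF sym_tensors_scale[OF tensor_power_in]])
      (simp_all add: \<iota>_scale[OF tensor_power_in], simp add: sym_tensors_def)
  then show ?case by (simp add: a sym_tensor_sum_simps Cons.IH)
qed

lemma tensor_sum_simps:
  "tensor_sum s t [] = (\<lambda>_. 0)"
  "tensor_sum s t ((x, y) # ts) = (\<lambda>B. elementary_tensor s t x y B + tensor_sum s t ts B)"
  "tensor_sum s t (ts @ us) = (\<lambda>B. tensor_sum s t ts B + tensor_sum s t us B)"
  by (auto simp: tensor_sum_def)

lemma elementary_tensor_scale:
  "elementary_tensor sE sY (sE c x) y = (\<lambda>B. c * elementary_tensor sE sY x y B)"
  by (auto simp: elementary_tensor_def bilinear_form_def Vector_Spaces.linear_iff)

lemma elementary_tensor_diff: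
  "elementary_tensor sE sY (x - x') y = (\<lambda>B. elementary_tensor sE sY x y B + (-1) * elementary_tensor sE sY x' y B)"
proof (rule ext)
  fix B :: "'e \<Rightarrow> 'b \<Rightarrow> 'k"
  show "elementary_tensor sE sY (x - x') y B = elementary_tensor sE sY x y B + (-1) * elementary_tensor sE sY x' y B"
  proof (cases "bilinear_form sE sY B")
    case True
    then have add: "B (a + b) y = B a y + B b y" for a b
      by (simp add: bilinear_form_def Vector_Spaces.linear_iff)
    have "B (x - x') y = B x y - B x' y" using add[of "x - x'" x'] by simp
    then show ?thesis using True by (simp add: elementary_tensor_def)
  qed (simp add: elementary_tensor_def)
qed

lemma tensors_add: "u \<in> tensors sE sY \<Longrightarrow> v \<in> tensors sE sY \<Longrightarrow> (\<lambda>i. u i + v i) \<in> tensors sE sY"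
  unfolding tensors_def by (auto simp: tensor_sum_simps(3)[symmetric])

lemma tensor_sum_scale:
  "tensor_sum sE sY (map (\<lambda>(x, y). (sE c x, y)) ts) = (\<lambda>B. c * tensor_sum sE sY ts B)"
  by (induction ts) (auto simp: tensor_sum_simps elementary_tensor_scale distrib_left)

lemma tensors_scale: "v \<in> tensors sE sY \<Longrightarrow> (\<lambda>i. c * v i) \<in> tensors sE sY"
  unfolding tensors_def by (auto simp: tensor_sum_scale[symmetric])

lemma elementary_tensor_in: "elementary_tensor sE sY x y \<in> tensors sE sY"
  unfolding tensors_def by (rule range_eqI[of _ _ "[(x, y)]"]) (simp add: tensor_sum_simps)

lemma \<kappa>_sum: "\<kappa> (tensor_sum sE sY ts) = (\<Sum>(x, y)\<leftarrow>ts. \<kappa> (elementary_tensor sE sY x y))"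
proof (induction ts)
  case Nil
  have "\<kappa> (\<lambda>\<phi>. 0 * elementary_tensor sE sY 0 0 \<phi>) = 0" by (subst \<kappa>_scale[OF elementary_tensor_in]) simp
  then show ?case by (simp add: tensor_sum_simps)
next
  case (Cons a ts)
  obtain x y where a: "a = (x, y)" by (cases a)
  have "tensor_sum sE sY ts \<in> tensors sE sY" by (simp add: tensors_def)
  then show ?case by (simp add: a tensor_sum_simps \<kappa>_add[OF elementary_tensor_in] Cons.IH)
qed

lemma \<kappa>_elementary_diff:
  "\<kappa> (elementary_tensor sE sY (x - x') y) = \<kappa> (elementary_tensor sE sY x y) - \<kappa> (elementary_tensor sE sY x' y)"
  unfolding elementary_tensor_diff
  by (subst \<kappa>_add[OF elementary_tensor_in tensors_scale[OF elementary_tensor_in]])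
    (simp only: \<kappa>_scale[OF elementary_tensor_in] G.scale_minus_left G.scale_one diff_conv_add_uminus)

lemma \<kappa>_elementary_scale:
  "\<kappa> (elementary_tensor sE sY (sE c x) y) = sG c (\<kappa> (elementary_tensor sE sY x y))"
  unfolding elementary_tensor_scale by (rule \<kappa>_scale[OF elementary_tensor_in])

lemma norm_\<kappa>_elementary: "norm (\<kappa> (elementary_tensor sE sY x y)) \<le> norm x * norm y"
  unfolding \<kappa>_norm[OF elementary_tensor_in] proj_norm_def
proof (rule cInf_lower)
  show "norm x * norm y \<in> {\<Sum>(x, y)\<leftarrow>ts. norm x * norm y | ts. elementary_tensor sE sY x y = tensor_sum sE sY ts}"
    by (intro CollectI exI[of _ "[(x, y)]"]) (simp add: tensor_sum_simps)
  show "bdd_below {\<Sum>(x, y)\<leftarrow>ts. norm x * norm y | ts. elementary_tensor sE sY x y = tensor_sum sE sY ts}"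
    by (intro bdd_belowI[of _ 0]) (auto intro!: sum_list_nonneg)
qed

lemma norm_\<iota>_tensor_power: "norm (\<iota> (tensor_power sX N x)) \<le> norm x ^ N"
  unfolding \<iota>_norm[OF tensor_power_in] sym_proj_norm_def
proof (rule cInf_lower)
  show "norm x ^ N \<in> {\<Sum>(c, x)\<leftarrow>ts. norm c * norm x ^ N | ts. tensor_power sX N x = sym_tensor_sum sX N ts}"
    by (intro CollectI exI[of _ "[(1, x)]"]) (simp add: sym_tensor_sum_simps)
  show "bdd_below {\<Sum>(c, x)\<leftarrow>ts. norm c * norm x ^ N | ts. tensor_power sX N x = sym_tensor_sum sX N ts}"
    by (intro bdd_belowI[of _ 0]) (auto intro!: sum_list_nonneg)
qed

lemma sym_tensor_functional_le:
  assumes v: "v \<in> sym_tensors sX N" and \<phi>: "multilinear_map sX (*) N \<phi>"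
    and le: "\<And>x. norm (\<phi> (replicate N x)) \<le> C * norm x ^ N" and C: "0 \<le> C"
  shows "norm (v \<phi>) \<le> C * sym_proj_norm sX N v"
proof -
  have *: "norm (v \<phi>) \<le> C * (\<Sum>(c, x)\<leftarrow>ts. norm c * norm x ^ N)" if "v = sym_tensor_sum sX N ts" for ts
  proof -
    have "norm (sym_tensor_sum sX N ts \<phi>) \<le> C * (\<Sum>(c, x)\<leftarrow>ts. norm c * norm x ^ N)" for ts
    proof (induction ts)
      case (Cons a ts)
      obtain c x where a: "a = (c, x)" by (cases a)
      have "norm (c * \<phi> (replicate N x)) \<le> C * (norm c * norm x ^ N)"
        using mult_left_mono[OF le[of x] norm_ge_zero[of c]] by (simp add: norm_mult mult_ac)
      then show ?case
        using Cons norm_triangle_ineq[of "c * \<phi> (replicate N x)" "sym_tensor_sum sX N ts \<phi>"]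
        by (simp add: a sym_tensor_sum_simps tensor_power_def \<phi> distrib_left)
    qed (simp add: sym_tensor_sum_simps)
    then show ?thesis using that by simp
  qed
  obtain ts0 where ts0: "v = sym_tensor_sum sX N ts0" using v by (auto simp: sym_tensors_def)
  show ?thesis
  proof (cases "C = 0")
    case True
    then show ?thesis using *[OF ts0] by simp
  next
    case False
    have "norm (v \<phi>) / C \<le> sym_proj_norm sX N v"
      unfolding sym_proj_norm_def
      by (rule cInf_greatest) (use ts0 * False C in \<open>auto simp: field_simps\<close>)
    then show ?thesis using False C by (simp add: field_simps)
  qed
qed

lemma tensor_functional_le:
  assumes v: "v \<in> tensors sE sY" and B: "bilinear_form sE sY B"
    and le: "\<And>x y. norm (B x y) \<le> C * (norm x * norm y)" and C: "0 \<le> C"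
  shows "norm (v B) \<le> C * proj_norm sE sY v"
proof -
  have *: "norm (v B) \<le> C * (\<Sum>(x, y)\<leftarrow>ts. norm x * norm y)" if "v = tensor_sum sE sY ts" for ts
  proof -
    have "norm (tensor_sum sE sY ts B) \<le> C * (\<Sum>(x, y)\<leftarrow>ts. norm x * norm y)" for ts
    proof (induction ts)
      case (Cons a ts)
      obtain x y where a: "a = (x, y)" by (cases a)
      show ?case
        using Cons norm_triangle_ineq[of "B x y" "tensor_sum sE sY ts B"] le[of x y]
        by (simp add: a tensor_sum_simps elementary_tensor_def B distrib_left)
    qed (simp add: tensor_sum_simps)
    then show ?thesis using that by simp
  qed
  obtain ts0 where ts0: "v = tensor_sum sE sY ts0" using v by (auto simp: tensors_def)
  show ?thesis
  proof (cases "C = 0")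
    case True
    then show ?thesis using *[OF ts0] by simp
  next
    case False
    have "norm (v B) / C \<le> proj_norm sE sY v"
      unfolding proj_norm_def
      by (rule cInf_greatest) (use ts0 * False C in \<open>auto simp: field_simps\<close>)
    then show ?thesis using False C by (simp add: field_simps)
  qed
qed

definition power_tensor :: "'k \<times> 'a \<times> 'b \<Rightarrow> 'g" where
  "power_tensor = (\<lambda>(c, x, y). \<kappa> (elementary_tensor sE sY (sE c (\<iota> (tensor_power sX N x))) y))"

definition weight :: "'k \<times> 'a \<times> 'b \<Rightarrow> real" where
  "weight = (\<lambda>(c, x, y). norm c * norm x ^ N * norm y)"

lemma weight_nonneg: "0 \<le> weight p"
  by (auto simp: weight_def split: prod.splits)

lemma dual_valued_functional:
  assumes \<Phi>: "dual_valued N C \<Phi>"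
  shows "\<exists>L\<in>dual_space sG. \<forall>c x y. blinfun_apply L (power_tensor (c, x, y)) =
    c * blinfun_apply (\<Phi> (replicate N x)) y"
proof -
  have C: "0 \<le> C" using \<Phi> by (simp add: dual_valued_def)
  have ml: "multilinear_map sX (*) N (\<lambda>xs. blinfun_apply (\<Phi> xs) y)" for y
    using \<Phi> unfolding dual_valued_def
    by (simp add: multilinear_map_iff[OF X.vector_space_axioms vector_space_scalar]
        multilinear_map_iff[OF X.vector_space_axioms vector_space_dual_scale] blinfun.bilinear_simps)
  have V: "\<Phi> (replicate N x) \<in> dual_space sY" for x using \<Phi> by (simp add: dual_valued_def)
  have le: "norm (blinfun_apply (\<Phi> (replicate N x)) y) \<le> (C * norm y) * norm x ^ N" for x y
  proof -
    have "norm (\<Phi> (replicate N x)) \<le> C * norm x ^ N"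
      using \<Phi> unfolding dual_valued_def by (auto dest!: spec[of _ "replicate N x"] simp: prod_list_replicate)
    then show ?thesis
      using norm_blinfun[of "\<Phi> (replicate N x)" y] mult_right_mono[of "norm (\<Phi> (replicate N x))" "C * norm x ^ N" "norm y"]
      by (simp add: mult_ac)
  qed
  have ex: "\<exists>L. L \<in> dual_space sE \<and> norm L \<le> C * norm y \<and>
      (\<forall>v\<in>sym_tensors sX N. blinfun_apply L (\<iota> v) = v (\<lambda>xs. blinfun_apply (\<Phi> xs) y))" for y
  proof -
    have "\<exists>L\<in>dual_space sE. norm L \<le> C * norm y \<and>
        (\<forall>v\<in>sym_tensors sX N. blinfun_apply L (\<iota> v) = v (\<lambda>xs. blinfun_apply (\<Phi> xs) y))"
      by (rule completion_functional[OF E sym_tensors_add sym_tensors_scale _ _ sym_tensor_functional_le[OF _ ml le]])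
        (simp_all add: C)
    then show ?thesis by (simp add: Bex_def)
  qed
  define L where "L y = (SOME L. L \<in> dual_space sE \<and> norm L \<le> C * norm y \<and>
      (\<forall>v\<in>sym_tensors sX N. blinfun_apply L (\<iota> v) = v (\<lambda>xs. blinfun_apply (\<Phi> xs) y)))" for y
  have L: "L y \<in> dual_space sE" "norm (L y) \<le> C * norm y"
    "\<And>v. v \<in> sym_tensors sX N \<Longrightarrow> blinfun_apply (L y) (\<iota> v) = v (\<lambda>xs. blinfun_apply (\<Phi> xs) y)" for y
    using someI_ex[OF ex[of y]] unfolding L_def by blast+
  have L_power: "blinfun_apply (L y) (\<iota> (tensor_power sX N x)) = blinfun_apply (\<Phi> (replicate N x)) y" for x y
    by (subst L(3)[OF tensor_power_in]) (simp add: tensor_power_def ml)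
  have L_sum: "blinfun_apply (L y) (\<iota> (sym_tensor_sum sX N ts)) =
      (\<Sum>(c, x)\<leftarrow>ts. c * blinfun_apply (\<Phi> (replicate N x)) y)" for y ts
    unfolding \<iota>_sum
    by (induction ts) (simp_all add: case_prod_unfold blinfun.add_right blinfun.zero_right
        E.dual_apply_scale[OF L(1)] L_power)
  have L_add: "L (y + y') = L y + L y'" for y y'
  proof (rule completion_dense_eq[OF \<iota>_dense])
    fix v assume "v \<in> sym_tensors sX N"
    then obtain ts where "v = sym_tensor_sum sX N ts" by (auto simp: sym_tensors_def)
    then show "blinfun_apply (L (y + y')) (\<iota> v) = blinfun_apply (L y + L y') (\<iota> v)"
      by (simp add: L_sum blinfun.bilinear_simps case_prod_unfold distrib_left sum_list_addf)
  qed
  have L_scale: "L (sY c y) = dual_scale c (L y)" for c y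
  proof (rule completion_dense_eq[OF \<iota>_dense])
    fix v assume "v \<in> sym_tensors sX N"
    then obtain ts where "v = sym_tensor_sum sX N ts" by (auto simp: sym_tensors_def)
    then show "blinfun_apply (L (sY c y)) (\<iota> v) = blinfun_apply (dual_scale c (L y)) (\<iota> v)"
      by (simp add: L_sum Y.dual_apply_scale[OF V] case_prod_unfold sum_list_const_mult mult.left_commute)
  qed
  define B where "B e y = blinfun_apply (L y) e" for e y
  have B: "bilinear_form sE sY B"
    unfolding bilinear_form_def Vector_Spaces.linear_iff B_def
    using E.vector_space_axioms Y.vector_space_axioms vector_space_scalar
    by (simp add: blinfun.bilinear_simps E.dual_apply_scale[OF L(1)] L_add L_scale)
  have B_le: "norm (B e y) \<le> C * (norm e * norm y)" for e y
    using norm_blinfun[of "L y" e] mult_right_mono[OF L(2)[of y] norm_ge_zero[of e]]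
    by (simp add: B_def mult_ac)
  have "\<exists>P\<in>dual_space sG. norm P \<le> C \<and> (\<forall>v\<in>tensors sE sY. blinfun_apply P (\<kappa> v) = v B)"
    by (rule completion_functional[OF G tensors_add tensors_scale _ _ tensor_functional_le[OF _ B B_le C]])
      (simp_all add: C)
  then obtain P where P: "P \<in> dual_space sG" "\<And>v. v \<in> tensors sE sY \<Longrightarrow> blinfun_apply P (\<kappa> v) = v B"
    by auto
  have "blinfun_apply P (power_tensor (c, x, y)) = c * blinfun_apply (\<Phi> (replicate N x)) y" for c x y
  proof -
    have "blinfun_apply P (power_tensor (c, x, y)) = B (sE c (\<iota> (tensor_power sX N x))) y"
      unfolding power_tensor_def prod.case P(2)[OF elementary_tensor_in]
      by (simp add: elementary_tensor_def B)
    then show ?thesis by (simp add: B_def E.dual_apply_scale[OF L(1)] L_power)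
  qed
  then show ?thesis using P(1) by blast
qed

lemma E_approx:
  assumes "0 < \<epsilon>"
  shows "\<exists>cs. norm (e - (\<Sum>(c, x)\<leftarrow>cs. sE c (\<iota> (tensor_power sX N x)))) < \<epsilon> \<and>
    (\<Sum>(c, x)\<leftarrow>cs. norm c * norm x ^ N) \<le> norm e + \<epsilon>"
proof -
  have "e \<in> closure (\<iota> ` sym_tensors sX N)" using \<iota>_dense by simp
  then obtain v where v: "v \<in> sym_tensors sX N" "norm (e - \<iota> v) < \<epsilon>"
    using closure_approachableD[OF _ assms, of e "\<iota> ` sym_tensors sX N"] by (auto simp: dist_norm)
  have "norm (\<iota> v) < norm e + \<epsilon>" using norm_triangle_ineq2[of "\<iota> v" e] v(2) by (simp add: norm_minus_commute)
  then have "Inf {\<Sum>(c, x)\<leftarrow>ts. norm c * norm x ^ N | ts. v = sym_tensor_sum sX N ts} < norm e + \<epsilon>"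
    by (simp add: \<iota>_norm[OF v(1)] sym_proj_norm_def)
  moreover have "{\<Sum>(c, x)\<leftarrow>ts. norm c * norm x ^ N | ts. v = sym_tensor_sum sX N ts} \<noteq> {}"
    using v(1) by (auto simp: sym_tensors_def)
  ultimately have "\<exists>r\<in>{\<Sum>(c, x)\<leftarrow>ts. norm c * norm x ^ N | ts. v = sym_tensor_sum sX N ts}. r < norm e + \<epsilon>"
    by (intro cInf_lessD)
  then obtain ts where ts: "v = sym_tensor_sum sX N ts" "(\<Sum>(c, x)\<leftarrow>ts. norm c * norm x ^ N) < norm e + \<epsilon>"
    by auto
  then show ?thesis using v(2) by (intro exI[of _ ts]) (simp add: \<iota>_sum)
qed

lemma elementary_approx:
  assumes \<epsilon>: "0 < \<epsilon>"
  shows "\<exists>ps. norm (\<kappa> (elementary_tensor sE sY e y) - (\<Sum>p\<leftarrow>ps. power_tensor p)) < \<epsilon> \<and>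
    (\<Sum>p\<leftarrow>ps. weight p) \<le> norm e * norm y + \<epsilon>"
proof -
  let ?d = "\<epsilon> / (norm y + 1)"
  have y1: "0 < norm y + 1" using norm_ge_zero[of y] by linarith
  have "0 < ?d" using \<epsilon> y1 by simp
  then obtain cs where cs: "norm (e - (\<Sum>(c, x)\<leftarrow>cs. sE c (\<iota> (tensor_power sX N x)))) < ?d"
    "(\<Sum>(c, x)\<leftarrow>cs. norm c * norm x ^ N) \<le> norm e + ?d" using E_approx by blast
  have dy: "?d * norm y < \<epsilon>" using \<epsilon> y1 by (simp add: field_simps)
  let ?ps = "map (\<lambda>(c, x). (c, x, y)) cs"
  have sum: "(\<Sum>p\<leftarrow>map (\<lambda>(c, x). (c, x, y)) cs. power_tensor p) =
     \<kappa> (elementary_tensor sE sY (\<Sum>(c, x)\<leftarrow>cs. sE c (\<iota> (tensor_power sX N x))) y)" for cs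
  proof (induction cs)
    case Nil
    then show ?case using \<kappa>_elementary_scale[of 0 0 y] by simp
  next
    case (Cons a cs)
    obtain c x where a: "a = (c, x)" by (cases a)
    let ?u = "sE c (\<iota> (tensor_power sX N x))" and ?s = "\<Sum>(c, x)\<leftarrow>cs. sE c (\<iota> (tensor_power sX N x))"
    have "\<kappa> (elementary_tensor sE sY (?u + ?s) y) = \<kappa> (elementary_tensor sE sY ?u y) + \<kappa> (elementary_tensor sE sY ?s y)"
      using \<kappa>_elementary_diff[of "?u + ?s" ?s y] by simp
    then show ?case using Cons by (simp add: a power_tensor_def)
  qed
  have "norm (\<kappa> (elementary_tensor sE sY e y) - (\<Sum>p\<leftarrow>?ps. power_tensor p)) \<le> ?d * norm y"
    unfolding sum \<kappa>_elementary_diff[symmetric]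
    using norm_\<kappa>_elementary order_trans mult_right_mono[OF less_imp_le[OF cs(1)] norm_ge_zero[of y]] by blast
  moreover have "(\<Sum>p\<leftarrow>?ps. weight p) = (\<Sum>(c, x)\<leftarrow>cs. norm c * norm x ^ N) * norm y"
    by (simp add: weight_def o_def case_prod_unfold sum_list_mult_const)
  moreover have "\<dots> \<le> (norm e + ?d) * norm y" using cs(2) by (rule mult_right_mono) simp
  ultimately show ?thesis using dy by (intro exI[of _ ?ps]) (auto simp: distrib_right)
qed

lemma tensor_sum_approx:
  assumes \<epsilon>: "0 < \<epsilon>"
  shows "\<exists>ps. norm (\<kappa> (tensor_sum sE sY ts) - (\<Sum>p\<leftarrow>ps. power_tensor p)) < \<epsilon> \<and>
    (\<Sum>p\<leftarrow>ps. weight p) \<le> (\<Sum>(e, y)\<leftarrow>ts. norm e * norm y) + \<epsilon>"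
  using \<epsilon>
proof (induction ts arbitrary: \<epsilon>)
  case Nil
  then show ?case by (intro exI[of _ "[]"]) (simp add: \<kappa>_sum)
next
  case (Cons a ts)
  obtain e y where a: "a = (e, y)" by (cases a)
  have h: "0 < \<epsilon> / 2" using Cons.prems by simp
  obtain ps where ps: "norm (\<kappa> (tensor_sum sE sY ts) - (\<Sum>p\<leftarrow>ps. power_tensor p)) < \<epsilon> / 2"
    "(\<Sum>p\<leftarrow>ps. weight p) \<le> (\<Sum>(e, y)\<leftarrow>ts. norm e * norm y) + \<epsilon> / 2" using Cons.IH[OF h] by blast
  obtain qs where qs: "norm (\<kappa> (elementary_tensor sE sY e y) - (\<Sum>p\<leftarrow>qs. power_tensor p)) < \<epsilon> / 2"
    "(\<Sum>p\<leftarrow>qs. weight p) \<le> norm e * norm y + \<epsilon> / 2" using elementary_approx[OF h] by blast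
  show ?case
    using norm_diff_triangle_ineq[of "\<kappa> (elementary_tensor sE sY e y)" "\<kappa> (tensor_sum sE sY ts)"
        "\<Sum>p\<leftarrow>qs. power_tensor p" "\<Sum>p\<leftarrow>ps. power_tensor p"] ps qs
    by (intro exI[of _ "qs @ ps"]) (simp add: a \<kappa>_sum)
qed

lemma power_tensor_approx:
  assumes \<epsilon>: "0 < \<epsilon>"
  shows "\<exists>ps. norm (u - (\<Sum>p\<leftarrow>ps. power_tensor p)) < \<epsilon> \<and> (\<Sum>p\<leftarrow>ps. weight p) \<le> norm u + \<epsilon>"
proof -
  have h: "0 < \<epsilon> / 2" using \<epsilon> by simp
  have "u \<in> closure (\<kappa> ` tensors sE sY)" using \<kappa>_dense by simp
  then obtain v where v: "v \<in> tensors sE sY" "norm (u - \<kappa> v) < \<epsilon> / 2"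
    using closure_approachableD[OF _ h, of u "\<kappa> ` tensors sE sY"] unfolding dist_norm by blast
  have "norm (\<kappa> v) < norm u + \<epsilon> / 2" using norm_triangle_ineq2[of "\<kappa> v" u] v(2) by (simp add: norm_minus_commute)
  then have "Inf {\<Sum>(x, y)\<leftarrow>ts. norm x * norm y | ts. v = tensor_sum sE sY ts} < norm u + \<epsilon> / 2"
    by (simp add: \<kappa>_norm[OF v(1)] proj_norm_def)
  moreover have "{\<Sum>(x, y)\<leftarrow>ts. norm x * norm y | ts. v = tensor_sum sE sY ts} \<noteq> {}"
    using v(1) by (auto simp: tensors_def)
  ultimately have "\<exists>r\<in>{\<Sum>(x, y)\<leftarrow>ts. norm x * norm y | ts. v = tensor_sum sE sY ts}. r < norm u + \<epsilon> / 2"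
    by (intro cInf_lessD)
  then obtain ts where ts: "v = tensor_sum sE sY ts" "(\<Sum>(x, y)\<leftarrow>ts. norm x * norm y) < norm u + \<epsilon> / 2"
    by auto
  obtain ps where ps: "norm (\<kappa> v - (\<Sum>p\<leftarrow>ps. power_tensor p)) < \<epsilon> / 2"
    "(\<Sum>p\<leftarrow>ps. weight p) \<le> (\<Sum>(e, y)\<leftarrow>ts. norm e * norm y) + \<epsilon> / 2"
    using tensor_sum_approx[OF h, of ts, folded ts(1)] by (elim exE conjE) (rule that)
  show ?thesis
    using ps v(2) ts(2) norm_triangle_ineq[of "u - \<kappa> v" "\<kappa> v - (\<Sum>p\<leftarrow>ps. power_tensor p)"]
    by (intro exI[of _ ps]) simp
qed

lemma norm_power_tensor_le: "norm (power_tensor p) \<le> weight p"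
proof -
  obtain c x y where p: "p = (c, x, y)" by (cases p)
  have "norm (power_tensor p) \<le> norm (sE c (\<iota> (tensor_power sX N x))) * norm y"
    unfolding p power_tensor_def by (simp add: norm_\<kappa>_elementary)
  also have "\<dots> \<le> (norm c * norm x ^ N) * norm y"
    by (intro mult_right_mono) (auto simp: E.norm_scale intro!: mult_left_mono norm_\<iota>_tensor_power)
  finally show ?thesis by (simp add: p weight_def)
qed

lemma power_tensor_series:
  "\<exists>p. (\<lambda>n::nat. power_tensor (p n)) sums u \<and> summable (\<lambda>n. weight (p n))"
proof (rule approx_series[of power_tensor weight "(0, 0, 0)"])
  show "norm (power_tensor p) \<le> weight p" for p by (rule norm_power_tensor_le)
  show "power_tensor (0, 0, 0) = 0" using norm_power_tensor_le[of "(0, 0, 0)"] by (simp add: weight_def)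
  show "weight (0, 0, 0) = 0" by (simp add: weight_def)
qed (rule power_tensor_approx)

text \<open>All representations of \<open>u\<close> give the value of one continuous functional at \<open>u\<close>.\<close>

lemma tensor_pairing_eq:
  assumes L: "L \<in> dual_space sG"
    and LP: "\<And>c x y. blinfun_apply L (power_tensor (c, x, y)) = c * blinfun_apply (P x) y"
  shows "tensor_pairing sX sY sE N \<iota> \<kappa> u P = blinfun_apply L u"
  unfolding tensor_pairing_def
proof (rule the_equality)
  obtain p where p: "(\<lambda>n. power_tensor (p n)) sums u" using power_tensor_series by blast
  define c where "c n j = (if j = 0 then fst (p n) else 0)" for n j :: nat
  define x where "x n = fst (snd (p n))" for n
  define y where "y n = snd (snd (p n))" for n
  have pn: "p n = (fst (p n), x n, y n)" for n by (simp add: x_def y_def)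
  have single: "(\<lambda>j. if j = 0 then a else 0) sums a" for a :: "'w::real_normed_vector"
    using sums_single[of 0 "\<lambda>_. a"] by simp
  have "(\<lambda>k. \<kappa> (elementary_tensor sE sY (sE (fst (p k)) (\<iota> (tensor_power sX N (x k)))) (y k))) sums u"
    using p by (subst (asm) pn) (simp add: power_tensor_def)
  moreover have "(\<lambda>j. sE (c k j) (\<iota> (tensor_power sX N (x k)))) sums sE (fst (p k)) (\<iota> (tensor_power sX N (x k)))" for k
    using single[of "sE (fst (p k)) (\<iota> (tensor_power sX N (x k)))"] by (simp add: c_def if_distrib[of "\<lambda>c. sE c _"] cong: if_cong)
  moreover have "(\<lambda>j. c k j * blinfun_apply (P (x k)) (y k)) sums (fst (p k) * blinfun_apply (P (x k)) (y k))" for k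
    using single[of "fst (p k) * blinfun_apply (P (x k)) (y k)"] by (simp add: c_def if_distrib[of "\<lambda>c. c * _"] cong: if_cong)
  moreover have "(\<lambda>k. fst (p k) * blinfun_apply (P (x k)) (y k)) sums blinfun_apply L u"
  proof -
    have "(\<lambda>k. blinfun_apply L (power_tensor (p k))) sums blinfun_apply L u"
      by (rule bounded_linear.sums[OF blinfun.bounded_linear_right p])
    then show ?thesis by (subst (asm) pn) (simp add: LP)
  qed
  ultimately show "\<exists>v y c x w.
     (\<lambda>k. \<kappa> (elementary_tensor sE sY (v k) (y k))) sums u \<and>
     (\<forall>k. (\<lambda>j. sE (c k j) (\<iota> (tensor_power sX N (x k j)))) sums v k) \<and>
     (\<forall>k. (\<lambda>j. c k j * blinfun_apply (P (x k j)) (y k)) sums w k) \<and> w sums blinfun_apply L u"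
    by (intro exI[of _ "\<lambda>k. sE (fst (p k)) (\<iota> (tensor_power sX N (x k)))"] exI[of _ y] exI[of _ c]
        exI[of _ "\<lambda>k j. x k"] exI[of _ "\<lambda>k. fst (p k) * blinfun_apply (P (x k)) (y k)"]) blast
next
  fix r assume "\<exists>v y c x w.
     (\<lambda>k. \<kappa> (elementary_tensor sE sY (v k) (y k))) sums u \<and>
     (\<forall>k. (\<lambda>j. sE (c k j) (\<iota> (tensor_power sX N (x k j)))) sums v k) \<and>
     (\<forall>k. (\<lambda>j. c k j * blinfun_apply (P (x k j)) (y k)) sums w k) \<and> w sums r"
  then obtain v y c x w where
     1: "(\<lambda>k. \<kappa> (elementary_tensor sE sY (v k) (y k))) sums u" and
     2: "\<And>k. (\<lambda>j. sE (c k j) (\<iota> (tensor_power sX N (x k j)))) sums v k" and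
     3: "\<And>k. (\<lambda>j. c k j * blinfun_apply (P (x k j)) (y k)) sums w k" and 4: "w sums r" by blast
  have "blinfun_apply L (\<kappa> (elementary_tensor sE sY (v k) (y k))) = w k" for k
  proof -
    have "bounded_linear (\<lambda>e. \<kappa> (elementary_tensor sE sY e (y k)))"
    proof (rule bounded_linear_intro[of _ "norm (y k)"])
      show "\<kappa> (elementary_tensor sE sY (a + b) (y k)) = \<kappa> (elementary_tensor sE sY a (y k)) + \<kappa> (elementary_tensor sE sY b (y k))" for a b
        using \<kappa>_elementary_diff[of "a + b" b "y k"] by simp
      show "\<kappa> (elementary_tensor sE sY (r *\<^sub>R a) (y k)) = r *\<^sub>R \<kappa> (elementary_tensor sE sY a (y k))" for r a
        using \<kappa>_elementary_scale[of "of_real r" a "y k"] by (simp add: E.scale_of_real G.scale_of_real)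
    qed (rule norm_\<kappa>_elementary)
    then have "bounded_linear (\<lambda>e. blinfun_apply L (\<kappa> (elementary_tensor sE sY e (y k))))"
      by (rule bounded_linear_compose[OF blinfun.bounded_linear_right])
    from bounded_linear.sums[OF this 2]
    have "(\<lambda>j. blinfun_apply L (power_tensor (c k j, x k j, y k))) sums
        blinfun_apply L (\<kappa> (elementary_tensor sE sY (v k) (y k)))"
      by (simp add: power_tensor_def)
    then show ?thesis using 3[of k] by (simp add: LP sums_unique2)
  qed
  then have "w sums blinfun_apply L u"
    using bounded_linear.sums[OF blinfun.bounded_linear_right 1, of L] by simp
  then show "r = blinfun_apply L u" using 4 by (rule sums_unique2[OF _, symmetric])
qed

end

section \<open>The integral of an Aron-Berner extension\<close>

lemma sums_interleave:
  fixes f g :: "nat \<Rightarrow> 'v::real_normed_vector"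
  assumes "f sums x" "g sums y"
  shows "(\<lambda>n. if even n then f (n div 2) else g ((n - 1) div 2)) sums (x + y)"
proof -
  have eq: "(\<Sum>i<n. if even i then f (i div 2) else g ((i - 1) div 2)) =
      (\<Sum>i<(n + 1) div 2. f i) + (\<Sum>i<n div 2. g i)" for n
    by (induction n) (auto elim!: evenE oddE)
  have half: "filterlim (\<lambda>n::nat. (n + k) div 2) sequentially sequentially" for k
    unfolding filterlim_at_top eventually_sequentially
  proof
    fix Z show "\<exists>N. \<forall>n\<ge>N. Z \<le> (n + k) div 2" by (intro exI[of _ "2 * Z"]) auto
  qed
  have "filterlim (\<lambda>n::nat. (n + 1) div 2) sequentially sequentially"
    "filterlim (\<lambda>n::nat. n div 2) sequentially sequentially"
    using half[of 1] half[of 0] by simp_all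
  then show ?thesis
    using assms unfolding sums_def eq
    by (intro tendsto_add) (auto intro: filterlim_compose)
qed

context banach_space_over begin

lemma bidual_scaleR: "\<xi> \<in> bidual_ball s \<Longrightarrow> f \<in> dual_space s \<Longrightarrow> \<xi> (r *\<^sub>R f) = r *\<^sub>R \<xi> f"
  using bidual_scale[of \<xi> f "of_real r"] by (simp add: dual_scale_of_real scaleR_conv_of_real)

lemma bidual_sums:
  assumes \<xi>: "\<xi> \<in> bidual_ball s" and g: "\<And>n. g n \<in> dual_space s" "g sums G" and G: "G \<in> dual_space s"
  shows "(\<lambda>n. \<xi> (g n)) sums \<xi> G"
  unfolding sums_def
proof (rule Lim_transform2)
  show "(\<lambda>_. \<xi> G) \<longlonglongrightarrow> \<xi> G" by simp
  show "(\<lambda>n. \<xi> G - (\<Sum>i<n. \<xi> (g i))) \<longlonglongrightarrow> 0"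
  proof (rule Lim_null_comparison)
    show "\<forall>\<^sub>F n in sequentially. norm (\<xi> G - (\<Sum>i<n. \<xi> (g i))) \<le> norm (G - sum g {..<n})"
    proof (intro always_eventually allI)
      fix n
      have S: "sum g {..<n} \<in> dual_space s" using g(1) by auto
      have "\<xi> G - (\<Sum>i<n. \<xi> (g i)) = \<xi> (G - sum g {..<n})"
        using bidual_diff[OF \<xi> G S] bidual_sum[OF \<xi>, of "{..<n}" g] g(1) by simp
      then show "norm (\<xi> G - (\<Sum>i<n. \<xi> (g i))) \<le> norm (G - sum g {..<n})"
        using bidual_le[OF \<xi> dual_space_diff[OF G S]] by simp
    qed
    show "(\<lambda>n. norm (G - sum g {..<n})) \<longlonglongrightarrow> 0"
      using tendsto_norm_zero[OF tendsto_diff[OF tendsto_const[of G] g(2)[unfolded sums_def], simplified]] by simp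
  qed
qed

lemma approximation_property_trace_eq:
  fixes A B :: "nat \<Rightarrow> ('a \<Rightarrow>\<^sub>L 'k) \<Rightarrow> 'k"
  assumes AP: "approximation_property dual_scale (dual_space s)"
    and A: "\<And>n. e n \<in> dual_space s"
      "\<And>n f g. f \<in> dual_space s \<Longrightarrow> g \<in> dual_space s \<Longrightarrow> A n (f + g) = A n f + A n g"
      "\<And>n c f. f \<in> dual_space s \<Longrightarrow> A n (dual_scale c f) = c * A n f"
      "\<And>n f. f \<in> dual_space s \<Longrightarrow> norm (A n f) \<le> \<alpha> n * norm f"
      "\<And>n. 0 \<le> \<alpha> n" "summable (\<lambda>n. \<alpha> n * norm (e n))"
    and B: "\<And>n. e' n \<in> dual_space s"
      "\<And>n f g. f \<in> dual_space s \<Longrightarrow> g \<in> dual_space s \<Longrightarrow> B n (f + g) = B n f + B n g"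
      "\<And>n c f. f \<in> dual_space s \<Longrightarrow> B n (dual_scale c f) = c * B n f"
      "\<And>n f. f \<in> dual_space s \<Longrightarrow> norm (B n f) \<le> \<beta> n * norm f"
      "\<And>n. 0 \<le> \<beta> n" "summable (\<lambda>n. \<beta> n * norm (e' n))"
    and eq: "\<And>f x. f \<in> dual_space s \<Longrightarrow>
      \<exists>S. (\<lambda>n. A n f * blinfun_apply (e n) x) sums S \<and> (\<lambda>n. B n f * blinfun_apply (e' n) x) sums S"
    and T: "(\<lambda>n. A n (e n)) sums T"
  shows "(\<lambda>n. B n (e' n)) sums T"
proof -
  define D where "D n f = (if even n then A (n div 2) f else - B ((n - 1) div 2) f)" for n f
  define d where "d n = (if even n then e (n div 2) else e' ((n - 1) div 2))" for n
  define \<delta> where "\<delta> n = (if even n then \<alpha> (n div 2) else \<beta> ((n - 1) div 2))" for n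
  have summable_B: "summable (\<lambda>n. B n (e' n))"
    by (rule summable_comparison_test'[where N=0, OF B(6)]) (use B(1,4) in auto)
  have "(\<lambda>n. D n (d n)) sums 0"
  proof (rule approximation_property_trace[OF AP, of d D \<delta>])
    show "d n \<in> dual_space s" for n using A(1) B(1) by (simp add: d_def)
    show "D n (f + g) = D n f + D n g" if "f \<in> dual_space s" "g \<in> dual_space s" for n f g
      using that A(2) B(2) by (simp add: D_def)
    show "D n (dual_scale c f) = c * D n f" if "f \<in> dual_space s" for n c f
      using that A(3) B(3) by (simp add: D_def)
    show "norm (D n f) \<le> \<delta> n * norm f" if "f \<in> dual_space s" for n f
      using that A(4) B(4) by (simp add: D_def \<delta>_def)
    show "0 \<le> \<delta> n" for n using A(5) B(5) by (simp add: \<delta>_def)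
    have "(\<lambda>n. if even n then \<alpha> (n div 2) * norm (e (n div 2)) else \<beta> ((n - 1) div 2) * norm (e' ((n - 1) div 2)))
        sums ((\<Sum>n. \<alpha> n * norm (e n)) + (\<Sum>n. \<beta> n * norm (e' n)))"
      using sums_interleave[OF summable_sums[OF A(6)] summable_sums[OF B(6)]] .
    then show "summable (\<lambda>n. \<delta> n * norm (d n))"
      unfolding \<delta>_def d_def by (rule sums_summable[THEN summable_cong[THEN iffD1, rotated]]) (auto intro!: always_eventually)
    show "(\<lambda>n. D n f * blinfun_apply (d n) x) sums 0" if f: "f \<in> dual_space s" for f x
    proof -
      obtain S where S: "(\<lambda>n. A n f * blinfun_apply (e n) x) sums S" "(\<lambda>n. B n f * blinfun_apply (e' n) x) sums S"
        using eq[OF f] by blast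
      have "(\<lambda>n. if even n then A (n div 2) f * blinfun_apply (e (n div 2)) x
          else - (B ((n - 1) div 2) f * blinfun_apply (e' ((n - 1) div 2)) x)) sums (S + - S)"
        using sums_interleave[OF S(1) sums_minus[OF S(2)]] .
      moreover have "(\<lambda>n. if even n then A (n div 2) f * blinfun_apply (e (n div 2)) x
          else - (B ((n - 1) div 2) f * blinfun_apply (e' ((n - 1) div 2)) x)) = (\<lambda>n. D n f * blinfun_apply (d n) x)"
        by (auto simp: D_def d_def)
      ultimately show ?thesis by simp
    qed
  qed
  moreover have "(\<lambda>n. D n (d n)) sums (T + - (\<Sum>n. B n (e' n)))"
  proof -
    have "(\<lambda>n. if even n then A (n div 2) (e (n div 2)) else - B ((n - 1) div 2) (e' ((n - 1) div 2)))
       = (\<lambda>n. D n (d n))"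
      by (auto simp: D_def d_def)
    then show ?thesis using sums_interleave[OF T sums_minus[OF summable_sums[OF summable_B]]] by simp
  qed
  ultimately have "T = (\<Sum>n. B n (e' n))" using sums_unique2 by fastforce
  then show ?thesis using summable_B by (simp add: summable_sums)
qed

definition evaluation :: "'a \<Rightarrow> ('a \<Rightarrow>\<^sub>L 'k) \<Rightarrow> 'k" where
  "evaluation x f = (if f \<in> dual_space s then blinfun_apply f x else 0)"

lemma evaluation_bidual_ball:
  assumes "norm x \<le> 1"
  shows "evaluation x \<in> bidual_ball s"
proof -
  have "norm (blinfun_apply f x) \<le> norm f" for f :: "'a \<Rightarrow>\<^sub>L 'k"
    using norm_blinfun[of f x] mult_left_mono[OF assms norm_ge_zero[of f]] by simp
  then show ?thesis
    unfolding bidual_ball_iff evaluation_def by (auto simp: blinfun.bilinear_simps)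
qed

end

lemma (in finite_measure) sums_integral_layers:
  fixes q :: "nat \<Rightarrow> 'a \<Rightarrow> 'v::{banach, second_countable_topology}"
  assumes E: "\<And>n. E n \<in> sets M" and q: "\<And>n. q n \<in> borel_measurable M"
    and q_le: "\<And>n z. z \<in> space M \<Longrightarrow> norm (q n z) \<le> B * r n" and r: "\<And>n. 0 \<le> r n" and B: "0 \<le> B"
    and sum: "summable (\<lambda>n. measure M (E n) * r n)"
    and sum_pt: "\<And>z. z \<in> space M \<Longrightarrow> summable (\<lambda>n. indicator (E n) z * r n)"
    and Q: "\<And>z. z \<in> space M \<Longrightarrow> (\<lambda>n. indicator (E n) z *\<^sub>R q n z) sums Q z"
  shows "(\<lambda>n. \<integral>z. indicator (E n) z *\<^sub>R q n z \<partial>M) sums (\<integral>z. Q z \<partial>M)"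
proof -
  have le: "norm (indicator (E n) z *\<^sub>R q n z) \<le> B * (indicator (E n) z * r n)" if "z \<in> space M" for n z
    using q_le[OF that, of n] by (simp add: indicator_def)
  have int_r: "integrable M (\<lambda>z. B * (indicator (E n) z * r n))" for n
    using E[of n] by (intro Bochner_Integration.integrable_mult_right Bochner_Integration.integrable_mult_left integrable_real_indicator)
      (simp_all add: less_top[symmetric])
  have int: "integrable M (\<lambda>z. indicator (E n) z *\<^sub>R q n z)" for n
  proof (rule Bochner_Integration.integrable_bound[OF int_r])
    show "(\<lambda>z. indicator (E n) z *\<^sub>R q n z) \<in> borel_measurable M" using E[of n] q[of n] by measurable
    show "AE z in M. norm (indicator (E n) z *\<^sub>R q n z) \<le> norm (B * (indicator (E n) z * r n))"
      using le by (intro AE_I2) (metis abs_ge_self order_trans real_norm_def)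
  qed
  have "(\<lambda>n. \<integral>z. indicator (E n) z *\<^sub>R q n z \<partial>M) sums (\<integral>z. (\<Sum>n. indicator (E n) z *\<^sub>R q n z) \<partial>M)"
  proof (rule sums_integral[OF int])
    show "AE z in M. summable (\<lambda>n. norm (indicator (E n) z *\<^sub>R q n z))"
    proof (rule AE_I2)
      fix z assume z: "z \<in> space M"
      show "summable (\<lambda>n. norm (indicator (E n) z *\<^sub>R q n z))"
        by (rule summable_comparison_test'[where N=0, OF summable_mult[OF sum_pt[OF z], of B]]) (use le[OF z] in simp)
    qed
    show "summable (\<lambda>n. \<integral>z. norm (indicator (E n) z *\<^sub>R q n z) \<partial>M)"
    proof (rule summable_comparison_test'[where N=0, OF summable_mult[OF sum, of B]])
      fix n
      have "(\<integral>z. norm (indicator (E n) z *\<^sub>R q n z) \<partial>M) \<le> (\<integral>z. B * (indicator (E n) z * r n) \<partial>M)"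
        using le by (intro integral_mono int_r integrable_norm int)
      also have "\<dots> = B * (measure M (E n) * r n)"
        using E[of n] by (simp add: Int_absorb2 sets.sets_into_space)
      finally show "norm (\<integral>z. norm (indicator (E n) z *\<^sub>R q n z) \<partial>M) \<le> B * (measure M (E n) * r n)"
        by simp
    qed
  qed
  moreover have "(\<integral>z. (\<Sum>n. indicator (E n) z *\<^sub>R q n z) \<partial>M) = (\<integral>z. Q z \<partial>M)"
    by (rule Bochner_Integration.integral_cong[OF refl]) (use Q in \<open>simp add: sums_iff\<close>)
  ultimately show ?thesis by simp
qed

lemma continuous_on_fst_apply: "continuous_on UNIV (\<lambda>z :: ('i \<Rightarrow> 'v::topological_space) \<times> 'w::topological_space. fst z f)"
  by (rule continuous_on_product_then_coordinatewise) (intro continuous_intros)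

lemma continuous_on_snd_apply: "continuous_on UNIV (\<lambda>z :: 'w::topological_space \<times> ('i \<Rightarrow> 'v::topological_space). snd z f)"
  by (rule continuous_on_product_then_coordinatewise) (intro continuous_intros)

lemma continuous_on_prod_list_fst:
  "continuous_on UNIV (\<lambda>z :: ('i \<Rightarrow> 'v::real_normed_field) \<times> 'w::topological_space. \<Prod>f\<leftarrow>fs. fst z f)"
  by (induction fs) (auto intro!: continuous_on_mult continuous_on_fst_apply continuous_on_const)

lemma norm_prod_list_le:
  fixes h :: "'i \<Rightarrow> 'v::real_normed_field"
  shows "(\<And>f. f \<in> set fs \<Longrightarrow> norm (h f) \<le> w f) \<Longrightarrow> norm (\<Prod>f\<leftarrow>fs. h f) \<le> (\<Prod>f\<leftarrow>fs. w f) \<and> 0 \<le> (\<Prod>f\<leftarrow>fs. w f)"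
proof (induction fs)
  case (Cons f fs)
  then have "norm (h f) \<le> w f" by simp
  moreover from this have "0 \<le> w f" using norm_ge_zero order_trans by blast
  ultimately show ?case using Cons by (auto simp: norm_mult intro!: mult_mono)
qed simp

context completed_tensor begin

definition aron_berner_form :: "nat \<Rightarrow> ('a list \<Rightarrow> 'b \<Rightarrow>\<^sub>L 'k) \<Rightarrow> (('a \<Rightarrow>\<^sub>L 'k) \<Rightarrow> 'k) \<times> (('b \<Rightarrow>\<^sub>L 'k) \<Rightarrow> 'k) \<Rightarrow> 'k" where
  "aron_berner_form M \<Phi> z = X.arens (replicate M (fst z)) (\<lambda>xs. snd z (\<Phi> xs))"

abbreviation "balls \<equiv> bidual_ball sX \<times> bidual_ball sY"

text \<open>Induction on the number of Arens-extended variables: the outermost one is traded for a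
  functional by applying the approximation property of the dual to the operator whose trace is
  the difference of the two sides.\<close>

lemma aron_berner_integral:
  fixes M :: "((('a \<Rightarrow>\<^sub>L 'k) \<Rightarrow> 'k) \<times> (('b \<Rightarrow>\<^sub>L 'k) \<Rightarrow> 'k)) measure" and p :: "nat \<Rightarrow> 'k \<times> 'a \<times> 'b"
  defines "c n \<equiv> fst (p n)" and "x n \<equiv> fst (snd (p n))" and "y n \<equiv> snd (snd (p n))"
  assumes sep: "separable_set (dual_space sX)"
    and AP: "approximation_property dual_scale (dual_space sX)"
    and M: "finite_measure M" "space M = balls"
    and cont: "\<And>g :: _ \<Rightarrow> 'k. continuous_on UNIV g \<Longrightarrow> g \<in> borel_measurable M"
    and p: "summable (\<lambda>n. weight (p n))"
    and base: "\<And>fs \<phi>. set fs \<subseteq> dual_space sX \<Longrightarrow> length fs = N \<Longrightarrow> \<phi> \<in> dual_space sY \<Longrightarrow>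
      (\<lambda>n. c n * (\<Prod>f\<leftarrow>fs. blinfun_apply f (x n)) * blinfun_apply \<phi> (y n)) sums
        (\<integral>z. (\<Prod>f\<leftarrow>fs. fst z f) * snd z \<phi> \<partial>M)"
  assumes "dual_valued m C \<Phi>" "set fs \<subseteq> dual_space sX" "length fs + m = N"
  shows "aron_berner_form m \<Phi> \<in> borel_measurable M \<and>
    (\<lambda>n. c n * (\<Prod>f\<leftarrow>fs. blinfun_apply f (x n)) * blinfun_apply (\<Phi> (replicate m (x n))) (y n)) sums
        (\<integral>z. (\<Prod>f\<leftarrow>fs. fst z f) * aron_berner_form m \<Phi> z \<partial>M)"
  using assms(11-13)
proof (induction m arbitrary: \<Phi> C fs)
  case 0
  then have "\<Phi> [] \<in> dual_space sY" by (simp add: dual_valued_def)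
  then show ?case
    using base[OF "0.prems"(2), of "\<Phi> []"] "0.prems"(3) cont[OF continuous_on_snd_apply[of "\<Phi> []"]]
    by (simp add: aron_berner_form_def[abs_def])
next
  case (Suc m)
  interpret finite_measure M by (rule M)
  have C: "0 \<le> C" using Suc.prems by (simp add: dual_valued_def)
  note slice = dual_valued_slice[OF Suc.prems(1)]
  define F where "F z = (if z \<in> balls then X.arens_slice (replicate m (fst z)) (\<lambda>xs. snd z (\<Phi> xs)) else 0)" for z
  have F: "F z \<in> dual_space sX" "norm (F z) \<le> C"
    "\<And>v. blinfun_apply (F z) v = aron_berner_form m (\<lambda>xs. \<Phi> (v # xs)) z"
    "aron_berner_form (Suc m) \<Phi> z = fst z (F z)" if z: "z \<in> balls" for z
  proof -
    have \<xi>: "fst z \<in> bidual_ball sX" "snd z \<in> bidual_ball sY" using z by auto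
    have s: "set (replicate m (fst z)) \<subseteq> bidual_ball sX" using \<xi>(1) by auto
    note form = dual_valued_bounded_form[OF Suc.prems(1) \<xi>(2)]
    note sl = X.arens_slice[OF s length_replicate C form]
    show "F z \<in> dual_space sX" "norm (F z) \<le> C"
      "\<And>v. blinfun_apply (F z) v = aron_berner_form m (\<lambda>xs. \<Phi> (v # xs)) z"
      using sl z by (simp_all add: F_def aron_berner_form_def)
    show "aron_berner_form (Suc m) \<Phi> z = fst z (F z)"
      using X.arens_Cons[OF \<xi>(1) s length_replicate C form] z
      by (simp add: F_def aron_berner_form_def)
  qed
  have F_meas: "(\<lambda>z. blinfun_apply (F z) v) \<in> borel_measurable M" for v
  proof -
    have "aron_berner_form m (\<lambda>xs. \<Phi> (v # xs)) \<in> borel_measurable M"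
      using Suc.IH[OF slice, of "0 # fs" v] Suc.prems by simp
    then show ?thesis
      by (subst measurable_cong[where g="aron_berner_form m (\<lambda>xs. \<Phi> (v # xs))"]) (use F(3) M(2) in auto)
  qed
  obtain E e where E: "\<And>n. E n \<in> sets M" and e: "\<And>n. e n \<in> dual_space sX"
    and sum: "summable (\<lambda>n. measure M (E n) * norm (e n))"
    and F_sums: "\<And>z. z \<in> space M \<Longrightarrow> (\<lambda>n. indicator (E n) z *\<^sub>R e n) sums F z"
    and F_abs: "\<And>z. z \<in> space M \<Longrightarrow> summable (\<lambda>n. norm (indicator (E n) z *\<^sub>R e n))"
    by (rule X.dual_valued_expansion[OF sep M(1), of F C]) (use F F_meas M(2) in auto)
  have F_abs': "summable (\<lambda>n. indicator (E n) z * norm (e n))" if "z \<in> space M" for z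
    using F_abs[OF that] by (simp add: abs_indicator)
  define W where "W = (\<Prod>f\<leftarrow>fs. norm f)"
  have W: "0 \<le> W" unfolding W_def using norm_prod_list_le[of fs "\<lambda>_. 0::real" norm] by simp
  define w where "w z = (\<Prod>f\<leftarrow>fs. fst z f)" for z :: "(('a \<Rightarrow>\<^sub>L 'k) \<Rightarrow> 'k) \<times> (('b \<Rightarrow>\<^sub>L 'k) \<Rightarrow> 'k)"
  have w_le: "norm (w z) \<le> W" if "z \<in> space M" for z
    unfolding w_def W_def using that M(2) Suc.prems(2)
    by (intro norm_prod_list_le[THEN conjunct1] X.bidual_le) auto
  have w_meas[measurable]: "w \<in> borel_measurable M"
    unfolding w_def[abs_def] by (intro cont continuous_on_prod_list_fst)
  have ev_meas[measurable]: "(\<lambda>z. fst z f) \<in> borel_measurable M" for f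
    by (intro cont continuous_on_fst_apply)
  have [measurable]: "E n \<in> sets M" for n by (rule E)
  have wf_le: "norm (w z * fst z f) \<le> W * norm f" if "z \<in> space M" "f \<in> dual_space sX" for z f
    using that w_le[OF that(1)] X.bidual_le[of "fst z" f] M(2) W by (auto simp: norm_mult intro!: mult_mono)
  have ball: "fst z \<in> bidual_ball sX" if "z \<in> space M" for z using that M(2) by auto
  have AB_sums: "(\<lambda>n. indicator (E n) z *\<^sub>R fst z (e n)) sums aron_berner_form (Suc m) \<Phi> z" if z: "z \<in> space M" for z
    using X.bidual_sums[OF ball[OF z] _ F_sums[OF z]] e F(1,4)[of z] z M(2)
    by (simp add: X.bidual_scaleR[OF ball[OF z]] X.dual_space_scaleR)
  have AB_meas: "aron_berner_form (Suc m) \<Phi> \<in> borel_measurable M"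
  proof -
    have "(\<lambda>z. \<Sum>n. indicator (E n) z *\<^sub>R fst z (e n)) \<in> borel_measurable M" by measurable
    then show ?thesis
      by (subst measurable_cong[where g="\<lambda>z. \<Sum>n. indicator (E n) z *\<^sub>R fst z (e n)"])
        (use AB_sums in \<open>auto simp: sums_iff\<close>)
  qed
  define A where "A n f = (\<integral>z. indicator (E n) z *\<^sub>R (w z * fst z f) \<partial>M)" for n f
  have A_int: "integrable M (\<lambda>z. indicator (E n) z *\<^sub>R (w z * fst z f))" if "f \<in> dual_space sX" for n f
    using wf_le[OF _ that] W by (intro integrable_const_bound[of _ "W * norm f"]) (auto simp: indicator_def)
  define B where "B n f = c n * (\<Prod>f\<leftarrow>fs. blinfun_apply f (x n)) * blinfun_apply f (x n)" for n f
  define \<psi> where "\<psi> n = Blinfun (\<lambda>v. blinfun_apply (\<Phi> (v # replicate m (x n))) (y n))" for n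
  have \<Phi>_le: "norm (blinfun_apply (\<Phi> (v # replicate m (x n))) (y n)) \<le> norm v * (C * norm (x n) ^ m * norm (y n))" for v n
  proof -
    have "norm (\<Phi> (v # replicate m (x n))) \<le> C * (norm v * norm (x n) ^ m)"
      using Suc.prems(1) unfolding dual_valued_def
      by (auto dest!: spec[of _ "v # replicate m (x n)"] simp: prod_list_replicate)
    then show ?thesis
      using norm_blinfun[of "\<Phi> (v # replicate m (x n))" "y n"]
        mult_right_mono[of "norm (\<Phi> (v # replicate m (x n)))" "C * (norm v * norm (x n) ^ m)" "norm (y n)"]
      by (simp add: mult_ac)
  qed
  have \<psi>_lin: "bounded_linear (\<lambda>v. blinfun_apply (\<Phi> (v # replicate m (x n))) (y n))" for n
  proof (rule bounded_linear_intro[OF _ _ \<Phi>_le])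
    show "blinfun_apply (\<Phi> ((a + b) # replicate m (x n))) (y n) =
        blinfun_apply (\<Phi> (a # replicate m (x n))) (y n) + blinfun_apply (\<Phi> (b # replicate m (x n))) (y n)" for a b
      using dual_valued_head(1)[OF Suc.prems(1)] by (simp add: blinfun.bilinear_simps)
    show "blinfun_apply (\<Phi> ((r *\<^sub>R a) # replicate m (x n))) (y n) = r *\<^sub>R blinfun_apply (\<Phi> (a # replicate m (x n))) (y n)" for r a
      using dual_valued_head(2)[OF Suc.prems(1), of "replicate m (x n)" "of_real r" a]
      by (simp add: X.scale_of_real scaleR_conv_of_real)
  qed
  have \<psi>: "blinfun_apply (\<psi> n) v = blinfun_apply (\<Phi> (v # replicate m (x n))) (y n)" for n v
    unfolding \<psi>_def by (simp add: bounded_linear_Blinfun_apply[OF \<psi>_lin])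
  have \<psi>_dual: "\<psi> n \<in> dual_space sX" for n
    using dual_valued_head(2)[OF Suc.prems(1)] by (simp add: X.dual_space_iff \<psi>)
  have \<psi>_norm: "norm (\<psi> n) \<le> C * norm (x n) ^ m * norm (y n)" for n
    using \<Phi>_le C by (intro norm_blinfun_bound) (auto simp: \<psi> mult_ac)
  define \<beta> where "\<beta> n = norm (c n) * (W * norm (x n) ^ length fs) * norm (x n)" for n
  have \<beta>: "0 \<le> \<beta> n" for n using W by (simp add: \<beta>_def)
  have prod_le: "norm (\<Prod>f\<leftarrow>fs. blinfun_apply f (x n)) \<le> W * norm (x n) ^ length fs" for n
  proof -
    have "norm (\<Prod>f\<leftarrow>fs. blinfun_apply f (x n)) \<le> (\<Prod>f\<leftarrow>fs. norm f * norm (x n))"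
      by (intro norm_prod_list_le[THEN conjunct1] norm_blinfun)
    also have "\<dots> = W * norm (x n) ^ length fs"
      unfolding W_def by (induction fs) auto
    finally show ?thesis .
  qed
  have "(\<lambda>n. A n (e n)) sums (\<integral>z. w z * aron_berner_form (Suc m) \<Phi> z \<partial>M)"
    unfolding A_def
  proof (rule sums_integral_layers[OF E _ _ norm_ge_zero W sum F_abs'])
    show "norm (w z * fst z (e n)) \<le> W * norm (e n)" if "z \<in> space M" for z n by (rule wf_le[OF that e])
    show "(\<lambda>n. indicator (E n) z *\<^sub>R (w z * fst z (e n))) sums (w z * aron_berner_form (Suc m) \<Phi> z)" if "z \<in> space M" for z
      using sums_mult[OF AB_sums[OF that], of "w z"] by simp
  qed measurable
  moreover have "(\<lambda>n. B n (\<psi> n)) sums T" if T: "(\<lambda>n. A n (e n)) sums T" for T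
  proof (rule X.approximation_property_trace_eq[OF AP, of e A "\<lambda>n. W * measure M (E n)" \<psi> B \<beta> T])
    show "A n (f + g) = A n f + A n g" if fg: "f \<in> dual_space sX" "g \<in> dual_space sX" for n f g
    proof -
      have "A n (f + g) = (\<integral>z. indicator (E n) z *\<^sub>R (w z * fst z f) + indicator (E n) z *\<^sub>R (w z * fst z g) \<partial>M)"
        unfolding A_def using fg X.bidual_add[OF ball]
        by (intro Bochner_Integration.integral_cong refl) (simp add: algebra_simps)
      then show ?thesis using A_int fg by (simp add: A_def)
    qed
    show "A n (dual_scale a f) = a * A n f" if f: "f \<in> dual_space sX" for n a f
    proof -
      have "A n (dual_scale a f) = (\<integral>z. a * (indicator (E n) z *\<^sub>R (w z * fst z f)) \<partial>M)"
        unfolding A_def using f X.bidual_scale[OF ball]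
        by (intro Bochner_Integration.integral_cong refl) (simp add: algebra_simps)
      also have "\<dots> = a * A n f" unfolding A_def by (rule integral_mult_right_zero)
      finally show ?thesis .
    qed
    show "norm (A n f) \<le> W * measure M (E n) * norm f" if f: "f \<in> dual_space sX" for n f
    proof -
      have "norm (A n f) \<le> (\<integral>z. norm (indicator (E n) z *\<^sub>R (w z * fst z f)) \<partial>M)"
        unfolding A_def by (rule integral_norm_bound)
      also have "\<dots> \<le> (\<integral>z. indicator (E n) z * (W * norm f) \<partial>M)"
      proof (rule integral_mono)
        show "integrable M (\<lambda>z. indicator (E n) z * (W * norm f))"
          by (intro Bochner_Integration.integrable_mult_left integrable_real_indicator E) (simp add: less_top[symmetric])
        show "norm (indicator (E n) z *\<^sub>R (w z * fst z f)) \<le> indicator (E n) z * (W * norm f)" if "z \<in> space M" for z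
          using wf_le[OF that f] by (simp add: indicator_def)
      qed (use A_int[OF f] in \<open>rule integrable_norm\<close>)
      also have "\<dots> = W * measure M (E n) * norm f"
        using E[of n] by (simp add: Int_absorb2 sets.sets_into_space)
      finally show ?thesis .
    qed
    show "summable (\<lambda>n. W * measure M (E n) * norm (e n))"
      using summable_mult[OF sum, of W] by (simp add: mult.assoc)
    show "B n (f + g) = B n f + B n g" "B n (dual_scale a f) = a * B n f" for n f g a
      by (simp_all add: B_def blinfun.bilinear_simps algebra_simps)
    show "norm (B n f) \<le> \<beta> n * norm f" for n f
    proof -
      have "norm (B n f) \<le> norm (c n) * (W * norm (x n) ^ length fs) * (norm f * norm (x n))"
        unfolding B_def norm_mult by (intro mult_mono prod_le norm_blinfun) (auto simp: W)
      then show ?thesis by (simp add: \<beta>_def mult_ac)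
    qed
    show "summable (\<lambda>n. \<beta> n * norm (\<psi> n))"
    proof (rule summable_comparison_test'[where N=0, OF summable_mult[OF p, of "W * C"]])
      fix n
      have N': "r ^ N = r ^ length fs * r * r ^ m" for r :: real
        unfolding Suc.prems(3)[symmetric] by (simp add: power_add)
      have "\<beta> n * norm (\<psi> n) \<le> \<beta> n * (C * norm (x n) ^ m * norm (y n))"
        using \<psi>_norm \<beta> by (rule mult_left_mono)
      also have "\<dots> = W * C * weight (p n)"
        by (simp add: \<beta>_def weight_def case_prod_unfold c_def x_def y_def N' mult_ac)
      finally show "norm (\<beta> n * norm (\<psi> n)) \<le> W * C * weight (p n)" using \<beta>[of n] by simp
    qed
    show "\<exists>S. (\<lambda>n. A n f * blinfun_apply (e n) v) sums S \<and> (\<lambda>n. B n f * blinfun_apply (\<psi> n) v) sums S"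
      if f: "f \<in> dual_space sX" for f v
    proof (intro exI conjI)
      let ?S = "\<integral>z. (\<Prod>f\<leftarrow>f # fs. fst z f) * aron_berner_form m (\<lambda>xs. \<Phi> (v # xs)) z \<partial>M"
      show "(\<lambda>n. B n f * blinfun_apply (\<psi> n) v) sums ?S"
        using Suc.IH[OF slice, of "f # fs" v] Suc.prems f by (simp add: B_def \<psi> mult_ac)
      have "(\<lambda>n. \<integral>z. indicator (E n) z *\<^sub>R (w z * fst z f * blinfun_apply (e n) v) \<partial>M) sums
          (\<integral>z. w z * fst z f * blinfun_apply (F z) v \<partial>M)"
      proof (rule sums_integral_layers[OF E _ _ norm_ge_zero _ sum F_abs'])
        show "norm (w z * fst z f * blinfun_apply (e n) v) \<le> (W * norm f * norm v) * norm (e n)" if "z \<in> space M" for z n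
          using mult_mono[OF wf_le[OF that f] norm_blinfun[of "e n" v]] W by (simp add: norm_mult mult_ac)
        show "0 \<le> W * norm f * norm v" using W by simp
        show "(\<lambda>n. indicator (E n) z *\<^sub>R (w z * fst z f * blinfun_apply (e n) v)) sums (w z * fst z f * blinfun_apply (F z) v)"
          if "z \<in> space M" for z
          using sums_mult[OF bounded_linear.sums[OF blinfun.bounded_linear_left F_sums[OF that], of v], of "w z * fst z f"]
          by (simp add: blinfun.bilinear_simps)
      qed measurable
      moreover have "(\<integral>z. indicator (E n) z *\<^sub>R (w z * fst z f * blinfun_apply (e n) v) \<partial>M) = A n f * blinfun_apply (e n) v" for n
        unfolding A_def by (subst integral_mult_left_zero[symmetric]) (simp add: mult.assoc)
      moreover have "(\<integral>z. w z * fst z f * blinfun_apply (F z) v \<partial>M) = ?S"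
        by (rule Bochner_Integration.integral_cong[OF refl]) (use F(3) M(2) in \<open>simp add: w_def mult_ac\<close>)
      ultimately show "(\<lambda>n. A n f * blinfun_apply (e n) v) sums ?S" by simp
    qed
  qed (use e \<psi>_dual W \<beta> T in auto)
  ultimately have "(\<lambda>n. B n (\<psi> n)) sums (\<integral>z. w z * aron_berner_form (Suc m) \<Phi> z \<partial>M)" by blast
  then show ?case using AB_meas by (simp add: B_def \<psi> w_def)
qed

end

section \<open>Symmetrization and the representing measure\<close>

lemma Hausdorff_space_by_functions:
  assumes "\<And>x y :: 'c::topological_space. x \<noteq> y \<Longrightarrow> \<exists>g :: 'c \<Rightarrow> 'v::t2_space. continuous_on UNIV g \<and> g x \<noteq> g y"
  shows "Hausdorff_space (euclidean :: 'c topology)"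
  unfolding Hausdorff_space_def
proof (intro allI impI)
  fix x y :: 'c assume "x \<in> topspace euclidean \<and> y \<in> topspace euclidean \<and> x \<noteq> y"
  then obtain g :: "'c \<Rightarrow> 'v" where g: "continuous_on UNIV g" "g x \<noteq> g y" using assms by blast
  then obtain U V where UV: "open U" "open V" "g x \<in> U" "g y \<in> V" "U \<inter> V = {}"
    using hausdorff[OF g(2)] by (elim exE conjE) (rule that)
  have "open (g -` U)" "open (g -` V)"
    by (rule open_vimage[OF UV(1) g(1)], rule open_vimage[OF UV(2) g(1)])
  then show "\<exists>U V. openin euclidean U \<and> openin euclidean V \<and> x \<in> U \<and> y \<in> V \<and> disjnt U V"
    using UV(3-5) by (intro exI[of _ "g -` U"] exI[of _ "g -` V"] conjI) (auto simp: disjnt_iff)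
qed

lemma Hausdorff_space_functions_prod:
  "Hausdorff_space (euclidean :: (('i \<Rightarrow> 'v::t2_space) \<times> ('j \<Rightarrow> 'v)) topology)"
proof (rule Hausdorff_space_by_functions)
  fix z w :: "('i \<Rightarrow> 'v) \<times> ('j \<Rightarrow> 'v)" assume "z \<noteq> w"
  then consider i where "fst z i \<noteq> fst w i" | j where "snd z j \<noteq> snd w j"
    by (metis ext prod_eqI)
  then show "\<exists>g :: _ \<Rightarrow> 'v. continuous_on UNIV g \<and> g z \<noteq> g w"
  proof cases
    case 1
    then show ?thesis by (intro exI[of _ "\<lambda>z. fst z i"] conjI continuous_on_fst_apply)
  next
    case 2
    then show ?thesis by (intro exI[of _ "\<lambda>z. snd z j"] conjI continuous_on_snd_apply)
  qed
qed

lemma integral_eq_of_coordinates: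
  fixes g :: "'c::topological_space \<Rightarrow> 'k::real_or_complex"
  assumes M: "finite_measure M" "sets M = sets borel" and K: "K \<in> sets borel"
    and real: "\<And>(f :: 'c \<Rightarrow> real) I. continuous_on UNIV f \<Longrightarrow> \<forall>z\<in>K. \<bar>f z\<bar> \<le> B \<Longrightarrow>
      (\<lambda>k. point_sum (ps k) f) \<longlonglongrightarrow> I \<Longrightarrow> (\<integral>z. f z * indicator K z \<partial>M) = I"
    and g: "continuous_on UNIV g" "\<And>z. z \<in> K \<Longrightarrow> norm (g z) \<le> B"
    and lim: "(\<lambda>k. point_sum (ps k) g) \<longlonglongrightarrow> I"
  shows "(\<integral>z. indicator K z *\<^sub>R g z \<partial>M) = I"
proof -
  interpret finite_measure M by (rule M)
  obtain \<rho> \<sigma> :: "'k \<Rightarrow> real" and e where c: "bounded_linear \<rho>" "bounded_linear \<sigma>"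
    "\<And>x. x = \<rho> x *\<^sub>R 1 + \<sigma> x *\<^sub>R e" "\<And>x. \<bar>\<rho> x\<bar> \<le> norm x" "\<And>x. \<bar>\<sigma> x\<bar> \<le> norm x"
    by (rule scalar_coordinates) (rule that)
  have gm: "g \<in> borel_measurable M"
    using borel_measurable_continuous_onI[OF g(1)] measurable_cong_sets[OF M(2) refl] by blast
  have KM: "K \<in> sets M" using K M(2) by simp
  have int: "integrable M (\<lambda>z. indicator K z *\<^sub>R g z)"
  proof (rule integrable_const_bound[of _ "\<bar>B\<bar>"])
    show "AE z in M. norm (indicator K z *\<^sub>R g z) \<le> \<bar>B\<bar>"
      using g(2) by (intro AE_I2) (auto simp: indicator_def intro: order_trans[OF _ abs_ge_self])
    show "(\<lambda>z. indicator K z *\<^sub>R g z) \<in> borel_measurable M" using gm KM by measurable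
  qed
  have coord: "l (\<integral>z. indicator K z *\<^sub>R g z \<partial>M) = l I" if l: "bounded_linear l" "\<And>x. \<bar>l x\<bar> \<le> norm x" for l :: "'k \<Rightarrow> real"
  proof -
    interpret l: bounded_linear l by (rule l)
    have "l (\<integral>z. indicator K z *\<^sub>R g z \<partial>M) = (\<integral>z. l (indicator K z *\<^sub>R g z) \<partial>M)"
      using integral_bounded_linear[OF l(1) int] by simp
    also have "\<dots> = (\<integral>z. l (g z) * indicator K z \<partial>M)"
      by (intro Bochner_Integration.integral_cong refl) (simp add: l.scaleR)
    also have "\<dots> = l I"
    proof (rule real)
      show "continuous_on UNIV (\<lambda>z. l (g z))" using l.continuous_on[OF g(1)] .
      show "\<forall>z\<in>K. \<bar>l (g z)\<bar> \<le> B" using order_trans[OF l(2) g(2)] by blast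
      show "(\<lambda>k. point_sum (ps k) (\<lambda>z. l (g z))) \<longlonglongrightarrow> l I"
        using l.tendsto[OF lim] by (simp add: point_sum_linear[OF l.linear])
    qed
    finally show ?thesis .
  qed
  show ?thesis
    using c(3)[of "\<integral>z. indicator K z *\<^sub>R g z \<partial>M"] c(3)[of I] coord[OF c(1,4)] coord[OF c(2,5)] by simp
qed

context banach_pair begin

lemma symmetrization:
  assumes "continuous_multilinear_map sX dual_scale (dual_space sY) N \<Phi>"
  shows "\<exists>\<Psi>. continuous_multilinear_map sX dual_scale (dual_space sY) N \<Psi> \<and>
     (\<forall>xs ys. length xs = N \<and> mset xs = mset ys \<longrightarrow> \<Psi> xs = \<Psi> ys) \<and>
     (\<forall>x. \<Psi> (replicate N x) = \<Phi> (replicate N x))"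
proof -
  obtain C where C: "dual_valued N C \<Phi>" using continuous_multilinear_map_dual_valued[OF assms] by blast
  have add: "\<Phi> (xs[i := x + y]) = \<Phi> (xs[i := x]) + \<Phi> (xs[i := y])"
    and sc: "\<Phi> (xs[i := sX c x]) = dual_scale c (\<Phi> (xs[i := x]))" if "length xs = N" "i < N" for xs i x y c
    using C that unfolding dual_valued_def multilinear_map_iff[OF X.vector_space_axioms vector_space_dual_scale]
    by blast+
  define P where "P = {\<sigma>. \<sigma> permutes {..<N}}"
  have P: "finite P" "card P = fact N" by (simp_all add: P_def finite_permutations card_permutations)
  define \<Psi> where "\<Psi> xs = (1 / fact N) *\<^sub>R (\<Sum>\<sigma>\<in>P. \<Phi> (permute_list \<sigma> xs))" for xs
  have upd: "permute_list \<sigma> (xs[i := x]) = (permute_list \<sigma> xs)[inv \<sigma> i := x]" "inv \<sigma> i < N"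
    if \<sigma>: "\<sigma> \<in> P" and xs: "length xs = N" "i < N" for \<sigma> xs i x
  proof -
    have p: "\<sigma> permutes {..<N}" using \<sigma> by (simp add: P_def)
    show i': "inv \<sigma> i < N" using permutes_in_image[OF permutes_inv[OF p], of i] xs by simp
    show "permute_list \<sigma> (xs[i := x]) = (permute_list \<sigma> xs)[inv \<sigma> i := x]"
    proof (rule nth_equalityI)
      fix j assume "j < length (permute_list \<sigma> (xs[i := x]))"
      then have j: "j < N" using xs by simp
      have "\<sigma> j < N" using permutes_in_image[OF p, of j] j by simp
      moreover have "\<sigma> j = i \<longleftrightarrow> j = inv \<sigma> i" using permutes_inverses[OF p] by metis
      ultimately show "permute_list \<sigma> (xs[i := x]) ! j = (permute_list \<sigma> xs)[inv \<sigma> i := x] ! j"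
        using p xs j by (auto simp: permute_list_nth nth_list_update)
    qed simp
  qed
  have mult: "multilinear_map sX dual_scale N \<Psi>"
    unfolding multilinear_map_iff[OF X.vector_space_axioms vector_space_dual_scale]
  proof (intro conjI allI impI)
    fix xs :: "'a list" and i x y assume xs: "length xs = N" "i < N"
    have "(\<Sum>\<sigma>\<in>P. \<Phi> (permute_list \<sigma> (xs[i := x + y]))) =
        (\<Sum>\<sigma>\<in>P. \<Phi> (permute_list \<sigma> (xs[i := x])) + \<Phi> (permute_list \<sigma> (xs[i := y])))"
    proof (rule sum.cong[OF refl])
      fix \<sigma> assume \<sigma>: "\<sigma> \<in> P"
      show "\<Phi> (permute_list \<sigma> (xs[i := x + y])) = \<Phi> (permute_list \<sigma> (xs[i := x])) + \<Phi> (permute_list \<sigma> (xs[i := y]))"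
        unfolding upd(1)[OF \<sigma> xs] by (rule add) (use upd(2)[OF \<sigma> xs] xs in simp_all)
    qed
    then show "\<Psi> (xs[i := x + y]) = \<Psi> (xs[i := x]) + \<Psi> (xs[i := y])"
      by (simp add: \<Psi>_def sum.distrib scaleR_add_right)
  next
    fix xs :: "'a list" and i c x assume xs: "length xs = N" "i < N"
    have "(\<Sum>\<sigma>\<in>P. \<Phi> (permute_list \<sigma> (xs[i := sX c x]))) = (\<Sum>\<sigma>\<in>P. dual_scale c (\<Phi> (permute_list \<sigma> (xs[i := x]))))"
    proof (rule sum.cong[OF refl])
      fix \<sigma> assume \<sigma>: "\<sigma> \<in> P"
      show "\<Phi> (permute_list \<sigma> (xs[i := sX c x])) = dual_scale c (\<Phi> (permute_list \<sigma> (xs[i := x])))"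
        unfolding upd(1)[OF \<sigma> xs] by (rule sc) (use upd(2)[OF \<sigma> xs] xs in simp_all)
    qed
    also have "\<dots> = dual_scale c (\<Sum>\<sigma>\<in>P. \<Phi> (permute_list \<sigma> (xs[i := x])))"
      by (rule dual.scale_sum_right[symmetric])
    finally show "\<Psi> (xs[i := sX c x]) = dual_scale c (\<Psi> (xs[i := x]))"
      by (auto simp: \<Psi>_def blinfun.bilinear_simps intro!: blinfun_eqI)
  qed
  have V: "\<Psi> xs \<in> dual_space sY" if "length xs = N" for xs
    unfolding \<Psi>_def using C that unfolding dual_valued_def by (intro Y.dual_space_scaleR Y.dual_space_sum) simp
  have norm: "norm (\<Psi> xs) \<le> C * prod_list (map norm xs)" if xs: "length xs = N" for xs
  proof -
    have "norm (\<Phi> (permute_list \<sigma> xs)) \<le> C * prod_list (map norm xs)" if \<sigma>: "\<sigma> \<in> P" for \<sigma>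
    proof -
      have "mset (map norm (permute_list \<sigma> xs)) = mset (map norm xs)"
        using \<sigma> xs mset_permute_list[of \<sigma> xs] by (simp add: P_def)
      then have "prod_list (map norm (permute_list \<sigma> xs)) = prod_list (map norm xs)"
        by (metis prod_mset_prod_list)
      then show ?thesis using C xs unfolding dual_valued_def by (metis length_permute_list)
    qed
    then have "norm (\<Sum>\<sigma>\<in>P. \<Phi> (permute_list \<sigma> xs)) \<le> of_nat (card P) * (C * prod_list (map norm xs))"
      by (rule sum_norm_bound)
    then show ?thesis by (simp add: \<Psi>_def P(2) field_simps)
  qed
  have sym: "\<Psi> xs = \<Psi> ys" if xs: "length xs = N" and eq: "mset xs = mset ys" for xs ys
  proof -
    have "length ys = N" using xs eq by (metis size_mset)
    moreover obtain \<tau> where \<tau>: "\<tau> permutes {..<length ys}" "permute_list \<tau> ys = xs"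
      by (rule mset_eq_permutation[OF eq])
    ultimately have \<tau>': "\<tau> permutes {..<N}" by simp
    have "(\<Sum>\<sigma>\<in>P. \<Phi> (permute_list \<sigma> xs)) = (\<Sum>\<sigma>\<in>P. \<Phi> (permute_list (\<tau> \<circ> \<sigma>) ys))"
      using \<tau> \<open>length ys = N\<close> by (intro sum.cong refl) (auto simp: P_def permute_list_compose)
    also have "\<dots> = (\<Sum>\<sigma>\<in>P. \<Phi> (permute_list \<sigma> ys))"
      unfolding P_def by (rule setum_permutations_compose_left[OF \<tau>', symmetric])
    finally show ?thesis by (simp add: \<Psi>_def)
  qed
  have diag: "\<Psi> (replicate N x) = \<Phi> (replicate N x)" for x
  proof -
    have "permute_list \<sigma> (replicate N x) = replicate N x" if \<sigma>: "\<sigma> \<in> P" for \<sigma>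
    proof (rule nth_equalityI)
      fix j assume "j < length (permute_list \<sigma> (replicate N x))"
      then have j: "j < N" by simp
      then show "permute_list \<sigma> (replicate N x) ! j = replicate N x ! j"
        using \<sigma> permutes_in_image[of \<sigma> "{..<N}" j] by (simp add: P_def permute_list_nth)
    qed simp
    then have "(\<Sum>\<sigma>\<in>P. \<Phi> (permute_list \<sigma> (replicate N x))) = (\<Sum>\<sigma>\<in>P. \<Phi> (replicate N x))"
      by (intro sum.cong refl) simp
    then show ?thesis by (simp add: \<Psi>_def P(2) sum_constant_scaleR)
  qed
  show ?thesis
    unfolding continuous_multilinear_map_def
    by (intro exI[of _ \<Psi>] conjI allI impI mult exI[of _ C] V norm diag) (auto intro: sym)
qed

lemma associated_symmetric_map:
  assumes "P \<in> homogeneous_polynomials sX dual_scale (dual_space sY) N"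
  shows "continuous_multilinear_map sX dual_scale (dual_space sY) N
      (associated_symmetric_map sX dual_scale (dual_space sY) N P)"
    and "P x = associated_symmetric_map sX dual_scale (dual_space sY) N P (replicate N x)"
proof -
  let ?Q = "\<lambda>\<Phi>. continuous_multilinear_map sX dual_scale (dual_space sY) N \<Phi> \<and>
     (\<forall>xs ys. length xs = N \<and> mset xs = mset ys \<longrightarrow> \<Phi> xs = \<Phi> ys) \<and> (\<forall>x. P x = \<Phi> (replicate N x))"
  obtain \<Phi> where \<Phi>: "continuous_multilinear_map sX dual_scale (dual_space sY) N \<Phi>" "\<And>x. P x = \<Phi> (replicate N x)"
    using assms unfolding homogeneous_polynomials_def by blast
  obtain \<Psi> where \<Psi>: "continuous_multilinear_map sX dual_scale (dual_space sY) N \<Psi>"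
     "\<forall>xs ys. length xs = N \<and> mset xs = mset ys \<longrightarrow> \<Psi> xs = \<Psi> ys"
     "\<forall>x. \<Psi> (replicate N x) = \<Phi> (replicate N x)"
    using symmetrization[OF \<Phi>(1)] by (elim exE conjE) (rule that)
  then have "?Q \<Psi>" using \<Phi>(2) by simp
  then have "\<exists>\<Psi>. ?Q \<Psi>" by (rule exI[where P="?Q"])
  then have Q: "?Q (associated_symmetric_map sX dual_scale (dual_space sY) N P)"
    unfolding associated_symmetric_map_def by (rule someI_ex)
  show "continuous_multilinear_map sX dual_scale (dual_space sY) N
      (associated_symmetric_map sX dual_scale (dual_space sY) N P)"
    using Q by (rule conjunct1)
  show "P x = associated_symmetric_map sX dual_scale (dual_space sY) N P (replicate N x)"
    using Q[THEN conjunct2, THEN conjunct2] by (rule spec)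
qed

lemma rank_one_dual_valued:
  assumes fs: "set fs \<subseteq> dual_space sX" and \<phi>: "\<phi> \<in> dual_space sY"
  shows "dual_valued (length fs) ((\<Prod>f\<leftarrow>fs. norm f) * norm \<phi>)
    (\<lambda>xs. dual_scale (prod_list (map2 blinfun_apply fs xs)) \<phi>)"
proof -
  let ?W = "\<lambda>xs. prod_list (map2 blinfun_apply fs xs)"
  have add: "?W (xs[i := x + y]) = ?W (xs[i := x]) + ?W (xs[i := y])"
    if "length xs = length fs" "i < length fs" for xs i x y
    using that
  proof (induction fs xs arbitrary: i rule: list_induct2')
    case (4 f fs a xs)
    then show ?case by (cases i) (auto simp: blinfun.bilinear_simps algebra_simps)
  qed auto
  have sc: "?W (xs[i := sX c x]) = c * ?W (xs[i := x])"
    if "length xs = length fs" "i < length fs" for xs i x c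
    using that fs
  proof (induction fs xs arbitrary: i rule: list_induct2')
    case (4 f fs a xs)
    then show ?case by (cases i) (auto simp: X.dual_apply_scale algebra_simps)
  qed auto
  have nn: "0 \<le> (\<Prod>f\<leftarrow>l. norm f)" for l :: "'w::real_normed_vector list" by (induction l) auto
  have le: "norm (?W xs) \<le> (\<Prod>f\<leftarrow>fs. norm f) * prod_list (map norm xs) \<and> 0 \<le> (\<Prod>f\<leftarrow>fs. norm f) * prod_list (map norm xs)"
    if "length xs = length fs" for xs
    using that
  proof (induction fs xs rule: list_induct2')
    case (4 f fs a xs)
    have "norm (blinfun_apply f a * prod_list (map2 blinfun_apply fs xs)) \<le>
      (norm f * norm a) * ((\<Prod>f\<leftarrow>fs. norm f) * prod_list (map norm xs))"
      unfolding norm_mult using 4 by (intro mult_mono norm_blinfun mult_nonneg_nonneg nn) auto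
    moreover have "0 \<le> (norm f * norm a) * ((\<Prod>f\<leftarrow>fs. norm f) * prod_list (map norm xs))"
      by (intro mult_nonneg_nonneg nn) auto
    ultimately show ?case by (simp add: mult_ac)
  qed auto
  have "0 \<le> (\<Prod>f\<leftarrow>fs. norm f)" using norm_prod_list_le[of fs "\<lambda>_. 0::real" norm] by simp
  moreover have "multilinear_map sX dual_scale (length fs) (\<lambda>xs. dual_scale (?W xs) \<phi>)"
    unfolding multilinear_map_iff[OF X.vector_space_axioms vector_space_dual_scale]
    using add sc by (simp add: dual.scale_left_distrib)
  moreover have "norm (dual_scale (?W xs) \<phi>) \<le> (\<Prod>f\<leftarrow>fs. norm f) * norm \<phi> * prod_list (map norm xs)"
    if "length xs = length fs" for xs
    using mult_right_mono[OF conjunct1[OF le[OF that]] norm_ge_zero[of \<phi>]]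
    by (simp add: norm_dual_scale mult_ac)
  ultimately show ?thesis unfolding dual_valued_def using \<phi> by (simp add: Y.dual_space_scale)
qed

lemma prod_list_map2_replicate:
  "prod_list (map2 blinfun_apply fs (replicate (length fs) x)) = (\<Prod>f\<leftarrow>fs. blinfun_apply f x)"
  by (induction fs) auto

end

context completed_tensor begin

definition point :: "'k \<times> 'a \<times> 'b \<Rightarrow> (('a \<Rightarrow>\<^sub>L 'k) \<Rightarrow> 'k) \<times> (('b \<Rightarrow>\<^sub>L 'k) \<Rightarrow> 'k)" where
  "point = (\<lambda>(c, x, y). (X.evaluation (x /\<^sub>R norm x), Y.evaluation (sY (c /\<^sub>R norm c) (y /\<^sub>R norm y))))"

lemma point_in_balls: "point p \<in> balls"
proof -
  obtain c x y where p: "p = (c, x, y)" by (cases p)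
  have unit: "norm (v /\<^sub>R norm v) \<le> 1" for v :: "'w::real_normed_vector" by (cases "v = 0") auto
  have "norm (sY (c /\<^sub>R norm c) (y /\<^sub>R norm y)) \<le> 1 * 1"
    unfolding Y.norm_scale by (intro mult_mono unit) auto
  then show ?thesis
    unfolding p point_def prod.case by (intro SigmaI X.evaluation_bidual_ball Y.evaluation_bidual_ball unit) simp
qed

lemma weight_point:
  assumes fs: "set fs \<subseteq> dual_space sX" "length fs = N" and \<phi>: "\<phi> \<in> dual_space sY"
  shows "weight (c, x, y) *\<^sub>R ((\<Prod>f\<leftarrow>fs. fst (point (c, x, y)) f) * snd (point (c, x, y)) \<phi>) =
    c * (\<Prod>f\<leftarrow>fs. blinfun_apply f x) * blinfun_apply \<phi> y"
proof -
  have prod: "(\<Prod>f\<leftarrow>fs. fst (point (c, x, y)) f) = inverse (norm x) ^ N *\<^sub>R (\<Prod>f\<leftarrow>fs. blinfun_apply f x)"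
    using fs unfolding fs(2)[symmetric]
    by (induction fs) (auto simp: point_def X.evaluation_def blinfun.bilinear_simps)
  have snd: "snd (point (c, x, y)) \<phi> = (inverse (norm c) * inverse (norm y)) *\<^sub>R (c * blinfun_apply \<phi> y)"
    using \<phi> by (simp add: point_def Y.evaluation_def Y.dual_apply_scale blinfun.bilinear_simps)
  show ?thesis
  proof (cases "c = 0 \<or> y = 0 \<or> x = 0")
    case True
    obtain f fs' where "fs = f # fs'" using fs(2) N by (cases fs) auto
    then show ?thesis unfolding prod snd using True by (elim disjE) simp_all
  next
    case False
    then have "weight (c, x, y) * (inverse (norm x) ^ N * (inverse (norm c) * inverse (norm y))) = 1"
      by (simp add: weight_def power_inverse field_simps)
    then show ?thesis
      unfolding prod snd mult_scaleR_left mult_scaleR_right scaleR_scaleR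
      by (simp add: mult_ac)
  qed
qed

lemma aron_berner_form_le:
  assumes "dual_valued m C \<Phi>" "z \<in> balls"
  shows "norm (aron_berner_form m \<Phi> z) \<le> C"
proof -
  have "set (replicate m (fst z)) \<subseteq> bidual_ball sX" "snd z \<in> bidual_ball sY" using assms(2) by auto
  moreover have "0 \<le> C" using assms(1) by (simp add: dual_valued_def)
  ultimately show ?thesis
    using X.arens_props[of "replicate m (fst z)"] dual_valued_bounded_form[OF assms(1)]
    by (simp add: aron_berner_form_def)
qed

end

lemma scalar_measure_of_measure:
  fixes M :: "'c measure"
  assumes M: "finite_measure M" and sets: "sets M = sets R"
  defines "\<mu> A \<equiv> of_real (measure M A) :: 'k::real_or_complex"
  shows "scalar_measure R \<mu>" and "E \<in> sets R \<Longrightarrow> variation R \<mu> E = emeasure M E"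
    and "variation_measure R \<mu> = M"
proof -
  interpret finite_measure M by (rule M)
  have space: "space R = space M" using sets by (metis sets_eq_imp_space_eq)
  show "scalar_measure R \<mu>"
    unfolding scalar_measure_def \<mu>_def
    using finite_measure_UNION sets by (auto intro!: sums_of_real)
  have var: "variation R \<mu> E = emeasure M E" if E: "E \<in> sets R" for E
  proof -
    let ?P = "{A :: nat \<Rightarrow> 'c set. range A \<subseteq> sets R \<and> disjoint_family A \<and> (\<Union>i. A i) = E}"
    have eq: "(\<Sum>i. ennreal (norm (\<mu> (A i)))) = emeasure M E" if A: "A \<in> ?P" for A
    proof -
      have "(\<Sum>i. ennreal (norm (\<mu> (A i)))) = (\<Sum>i. emeasure M (A i))"
        by (simp add: \<mu>_def emeasure_eq_measure)
      also have "\<dots> = emeasure M E" using A sets suminf_emeasure[of A M] by auto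
      finally show ?thesis .
    qed
    have "(\<lambda>i::nat. if i = 0 then E else {}) \<in> ?P"
      using E by (auto simp: disjoint_family_on_def split: if_splits)
    then have "?P \<noteq> {}" by blast
    moreover have "(SUP A\<in>?P. \<Sum>i. ennreal (norm (\<mu> (A i)))) = (SUP A\<in>?P. emeasure M E)"
      by (rule SUP_cong[OF refl eq])
    ultimately show ?thesis
      unfolding variation_def by simp
  qed
  then show "E \<in> sets R \<Longrightarrow> variation R \<mu> E = emeasure M E" .
  have "measure_of (space R) (sets R) (variation R \<mu>) = measure_of (space R) (sets R) (emeasure M)"
    by (rule measure_of_eq[OF sets.space_closed]) (simp add: sets.sigma_sets_eq var)
  also have "\<dots> = M"
    using measure_of_of_measure[of M] by (simp add: space sets)
  finally show "variation_measure R \<mu> = M" by (simp add: variation_measure_def)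
qed

lemma has_scalar_integral_of_measure:
  fixes M :: "'c measure" and f :: "'c \<Rightarrow> 'k::real_or_complex"
  assumes M: "finite_measure M" and sets: "sets M = sets R"
    and f: "f \<in> borel_measurable M" "\<And>z. z \<in> space M \<Longrightarrow> norm (f z) \<le> C"
  shows "has_scalar_integral R (\<lambda>A. of_real (measure M A)) f (\<integral>z. f z \<partial>M)"
proof -
  interpret finite_measure M by (rule M)
  have int: "integrable M f" using f by (intro integrable_const_bound[of _ C] AE_I2)
  have "of_real (measure M E) = (\<integral>z. indicator E z *\<^sub>R (1::'k) \<partial>M)" if "E \<in> sets R" for E
  proof -
    have "(\<integral>z. indicator E z *\<^sub>R (1::'k) \<partial>M) = measure M E *\<^sub>R 1"
      using that sets by (simp add: has_bochner_integral_integral_eq[OF has_bochner_integral_indicator] less_top[symmetric])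
    then show ?thesis by (simp add: of_real_def)
  qed
  then show ?thesis
    unfolding has_scalar_integral_def scalar_measure_of_measure(3)[OF M sets]
    using int by (intro bexI[of _ "\<lambda>_. 1"]) simp_all
qed

context completed_tensor begin

lemma representing_measure:
  obtains M :: "((('a \<Rightarrow>\<^sub>L 'k) \<Rightarrow> 'k) \<times> (('b \<Rightarrow>\<^sub>L 'k) \<Rightarrow> 'k)) measure" where
    "sets M = sets borel" "finite_measure M" "measure M UNIV \<le> norm u" "balls \<in> sets borel"
    "\<And>A \<epsilon>. A \<in> sets borel \<Longrightarrow> A \<subseteq> balls \<Longrightarrow> 0 < \<epsilon> \<Longrightarrow>
      \<exists>C U. compact C \<and> C \<subseteq> A \<and> open U \<and> A \<subseteq> U \<and> measure M (U - C) < \<epsilon>"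
    "\<And>fs \<phi> L. set fs \<subseteq> dual_space sX \<Longrightarrow> length fs = N \<Longrightarrow> \<phi> \<in> dual_space sY \<Longrightarrow>
      \<forall>c x y. blinfun_apply L (power_tensor (c, x, y)) = c * (\<Prod>f\<leftarrow>fs. blinfun_apply f x) * blinfun_apply \<phi> y \<Longrightarrow>
      (\<integral>z. indicator balls z *\<^sub>R ((\<Prod>f\<leftarrow>fs. fst z f) * snd z \<phi>) \<partial>M) = blinfun_apply L u"
proof -
  have ex: "\<exists>qs. norm (u - (\<Sum>p\<leftarrow>qs. power_tensor p)) < 1 / real (Suc k) \<and>
      (\<Sum>p\<leftarrow>qs. weight p) \<le> norm u + 1 / real (Suc k)" for k
    by (rule power_tensor_approx) simp
  define qs where "qs k = (SOME qs. norm (u - (\<Sum>p\<leftarrow>qs. power_tensor p)) < 1 / real (Suc k) \<and>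
      (\<Sum>p\<leftarrow>qs. weight p) \<le> norm u + 1 / real (Suc k))" for k
  have qs: "norm (u - (\<Sum>p\<leftarrow>qs k. power_tensor p)) < 1 / real (Suc k)"
    "(\<Sum>p\<leftarrow>qs k. weight p) \<le> norm u + 1 / real (Suc k)" for k
    using someI_ex[OF ex[of k]] unfolding qs_def by simp_all
  define ps where "ps k = map (\<lambda>p. (weight p, point p)) (qs k)" for k
  have point_sum: "point_sum (ps k) g = (\<Sum>p\<leftarrow>qs k. weight p *\<^sub>R g (point p))" for k and g :: "_ \<Rightarrow> 'v::real_vector"
    by (simp add: point_sum_def ps_def o_def)
  have lim: "(\<lambda>k. \<Sum>p\<leftarrow>qs k. power_tensor p) \<longlonglongrightarrow> u"
  proof (rule LIMSEQ_I)
    fix r :: real assume "0 < r"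
    then obtain n where n: "1 / real (Suc n) < r" using nat_approx_posE by blast
    have "norm ((\<Sum>p\<leftarrow>qs k. power_tensor p) - u) < r" if "n \<le> k" for k
    proof -
      have "1 / real (Suc k) \<le> 1 / real (Suc n)" using that by (intro divide_left_mono) auto
      then show ?thesis using qs(1)[of k] n by (simp add: norm_minus_commute)
    qed
    then show "\<exists>n. \<forall>k\<ge>n. norm ((\<Sum>p\<leftarrow>qs k. power_tensor p) - u) < r" by blast
  qed
  have K: "compact balls" by (intro compact_Times X.compact_bidual_ball Y.compact_bidual_ball)
  have ps: "0 \<le> a \<and> z \<in> balls" if "(a, z) \<in> set (ps k)" for k a z
    using that point_in_balls weight_nonneg by (auto simp: ps_def simp del: mem_Sigma_iff)
  have mass: "point_sum (ps k) (\<lambda>_. 1) \<le> norm u + 1 / real (Suc k)" for k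
    using qs(2)[of k] by (simp add: point_sum)
  obtain M where M: "sets M = sets borel" "finite_measure M" "measure M UNIV \<le> norm u"
    "emeasure M (- balls) = 0" "balls \<in> sets borel"
    and reg: "\<And>A \<epsilon>. A \<in> sets borel \<Longrightarrow> A \<subseteq> balls \<Longrightarrow> 0 < \<epsilon> \<Longrightarrow>
      \<exists>C U. compact C \<and> C \<subseteq> A \<and> open U \<and> A \<subseteq> U \<and> measure M (U - C) < \<epsilon>"
    and int: "\<And>(f :: _ \<Rightarrow> real) B I. continuous_on UNIV f \<Longrightarrow> \<forall>z\<in>balls. \<bar>f z\<bar> \<le> B \<Longrightarrow>
      (\<lambda>k. point_sum (ps k) f) \<longlonglongrightarrow> I \<Longrightarrow> (\<integral>z. f z * indicator balls z \<partial>M) = I"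
    by (rule weak_star_cluster_measure[where ps=ps, OF Hausdorff_space_functions_prod K ps mass]) (assumption, rule that)
  show ?thesis
  proof (rule that[OF M(1,2,3,5) reg])
    fix fs \<phi> and L :: "'g \<Rightarrow>\<^sub>L 'k"
    assume fs: "set fs \<subseteq> dual_space sX" "length fs = N" and \<phi>: "\<phi> \<in> dual_space sY"
      and L: "\<forall>c x y. blinfun_apply L (power_tensor (c, x, y)) = c * (\<Prod>f\<leftarrow>fs. blinfun_apply f x) * blinfun_apply \<phi> y"
    show "(\<integral>z. indicator balls z *\<^sub>R ((\<Prod>f\<leftarrow>fs. fst z f) * snd z \<phi>) \<partial>M) = blinfun_apply L u"
    proof (rule integral_eq_of_coordinates[OF M(2,1,5) int])
      show "continuous_on UNIV (\<lambda>z. (\<Prod>f\<leftarrow>fs. fst z f) * snd z \<phi> :: 'k)"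
        by (rule continuous_on_mult[OF continuous_on_prod_list_fst continuous_on_snd_apply])
      show "norm ((\<Prod>f\<leftarrow>fs. fst z f) * snd z \<phi>) \<le> (\<Prod>f\<leftarrow>fs. norm f) * norm \<phi>" if "z \<in> balls" for z
      proof -
        have "norm (\<Prod>f\<leftarrow>fs. fst z f) \<le> (\<Prod>f\<leftarrow>fs. norm f) \<and> 0 \<le> (\<Prod>f\<leftarrow>fs. norm f)"
          using that fs(1) by (intro norm_prod_list_le X.bidual_le) auto
        then show ?thesis
          using that \<phi> Y.bidual_le[of "snd z" \<phi>] unfolding norm_mult by (intro mult_mono) auto
      qed
      have "weight p *\<^sub>R ((\<Prod>f\<leftarrow>fs. fst (point p) f) * snd (point p) \<phi>) = blinfun_apply L (power_tensor p)" for p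
        using weight_point[OF fs \<phi>] L by (cases p) simp
      then have "point_sum (ps k) (\<lambda>z. (\<Prod>f\<leftarrow>fs. fst z f) * snd z \<phi>) = blinfun_apply L (\<Sum>p\<leftarrow>qs k. power_tensor p)" for k
        unfolding point_sum by (induction ("qs k")) (simp_all add: blinfun.bilinear_simps)
      then show "(\<lambda>k. point_sum (ps k) (\<lambda>z. (\<Prod>f\<leftarrow>fs. fst z f) * snd z \<phi>)) \<longlonglongrightarrow> blinfun_apply L u"
        using blinfun.tendsto[OF tendsto_const[of L] lim] by simp
    qed
  qed
qed

lemma integral_representation:
  assumes sep: "separable_set (dual_space sX)"
    and AP: "approximation_property dual_scale (dual_space sX)"
  shows "\<exists>\<mu> :: ((('a \<Rightarrow>\<^sub>L 'k) \<Rightarrow> 'k) \<times> (('b \<Rightarrow>\<^sub>L 'k) \<Rightarrow> 'k)) set \<Rightarrow> 'k.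
    regular_borel_measure_on balls \<mu> \<and>
    total_variation_norm (restrict_space borel balls) \<mu> \<le> ennreal (norm u) \<and>
    (\<forall>P \<in> homogeneous_polynomials sX dual_scale (dual_space sY) N.
       has_scalar_integral (restrict_space borel balls) \<mu>
         (\<lambda>(x'', y''). aron_berner sX dual_scale (dual_space sY) N P x'' y'')
         (tensor_pairing sX sY sE N \<iota> \<kappa> u P))"
proof -
  obtain M :: "((('a \<Rightarrow>\<^sub>L 'k) \<Rightarrow> 'k) \<times> (('b \<Rightarrow>\<^sub>L 'k) \<Rightarrow> 'k)) measure" where
    M: "sets M = sets borel" "finite_measure M" "measure M UNIV \<le> norm u" "balls \<in> sets borel"
    and reg: "\<And>A \<epsilon>. A \<in> sets borel \<Longrightarrow> A \<subseteq> balls \<Longrightarrow> 0 < \<epsilon> \<Longrightarrow>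
      \<exists>C U. compact C \<and> C \<subseteq> A \<and> open U \<and> A \<subseteq> U \<and> measure M (U - C) < \<epsilon>"
    and base: "\<And>fs \<phi> L. set fs \<subseteq> dual_space sX \<Longrightarrow> length fs = N \<Longrightarrow> \<phi> \<in> dual_space sY \<Longrightarrow>
      \<forall>c x y. blinfun_apply L (power_tensor (c, x, y)) = c * (\<Prod>f\<leftarrow>fs. blinfun_apply f x) * blinfun_apply \<phi> y \<Longrightarrow>
      (\<integral>z. indicator balls z *\<^sub>R ((\<Prod>f\<leftarrow>fs. fst z f) * snd z \<phi>) \<partial>M) = blinfun_apply L u"
    by (rule representing_measure) (rule that)
  interpret M: finite_measure M by (rule M)
  let ?R = "restrict_space borel balls"
  define M' where "M' = restrict_space M balls"
  have space_M: "space M = UNIV" using M(1) by (metis sets_eq_imp_space_eq space_borel)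
  have sets: "sets M' = sets ?R" using M(1) by (simp add: M'_def sets_restrict_space)
  have space: "space M' = balls" by (simp add: M'_def space_restrict_space space_M)
  have bM: "balls \<inter> space M \<in> sets M" using M(1,4) space_M by simp
  have fin: "finite_measure M'"
    unfolding M'_def
    by (rule finite_measureI) (simp add: emeasure_restrict_space[OF bM] space_restrict_space M.emeasure_eq_measure)
  have M'_eq: "measure M' A = measure M A" if "A \<subseteq> balls" for A
    unfolding M'_def by (rule measure_restrict_space[OF bM that])
  have integral: "(\<integral>z. g z \<partial>M') = (\<integral>z. indicator balls z *\<^sub>R g z \<partial>M)" for g :: "_ \<Rightarrow> 'k"
    unfolding M'_def by (rule integral_restrict_space[OF bM])
  define \<mu> where "\<mu> A = (of_real (measure M' A) :: 'k)" for A
  have \<mu>: "scalar_measure ?R \<mu>" "\<And>E. E \<in> sets ?R \<Longrightarrow> variation ?R \<mu> E = emeasure M' E"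
    using scalar_measure_of_measure[OF fin sets, where 'k='k] unfolding \<mu>_def[abs_def] by blast+
  interpret M': finite_measure M' by (rule fin)
  have regular: "regular_borel_measure_on balls \<mu>"
    unfolding regular_borel_measure_on_def
  proof (intro conjI \<mu>(1) ballI allI impI)
    fix E and \<epsilon> :: real assume E: "E \<in> sets ?R" and \<epsilon>: "0 < \<epsilon>"
    have E': "E \<in> sets borel" "E \<subseteq> balls" using E M(4) by (auto simp: sets_restrict_space)
    then obtain C U where CU: "compact C" "C \<subseteq> E" "open U" "E \<subseteq> U" "measure M (U - C) < \<epsilon>"
      using reg[OF E' \<epsilon>] by blast
    have "closed C" using compactin_imp_closedin[OF Hausdorff_space_functions_prod, of C] CU(1) by simp
    then have bor: "C \<in> sets borel" "U \<in> sets borel" using CU(3) by auto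
    have in_R: "balls \<inter> U - C \<in> sets ?R"
      using bor M(4) by (auto simp: sets_restrict_space intro!: image_eqI[of _ _ "U - C"])
    have "measure M' (balls \<inter> U - C) \<le> measure M (U - C)"
      using bor M(1) by (subst M'_eq) (auto intro!: M.finite_measure_mono)
    then have "variation ?R \<mu> (balls \<inter> U - C) < ennreal \<epsilon>"
      unfolding \<mu>(2)[OF in_R] M'.emeasure_eq_measure using CU(5) \<epsilon> by (intro ennreal_lessI) auto
    then show "\<exists>C U. compact C \<and> C \<subseteq> E \<and> openin (top_of_set balls) U \<and> E \<subseteq> U \<and> variation ?R \<mu> (U - C) < ennreal \<epsilon>"
      using CU E' by (intro exI[of _ C] exI[of _ "balls \<inter> U"]) (auto simp: openin_open_Int)
  qed
  have total: "total_variation_norm ?R \<mu> \<le> ennreal (norm u)"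
  proof -
    have "total_variation_norm ?R \<mu> = emeasure M' balls"
      unfolding total_variation_norm_def using \<mu>(2)[OF sets.top] by (simp add: space_restrict_space)
    also have "\<dots> = ennreal (measure M balls)" by (simp add: M'.emeasure_eq_measure M'_eq)
    also have "\<dots> \<le> ennreal (norm u)"
      using M.bounded_measure[of balls] M(3) space_M by (intro ennreal_leI) simp
    finally show ?thesis .
  qed
  obtain p where p: "(\<lambda>n. power_tensor (p n)) sums u" "summable (\<lambda>n. weight (p n))"
    using power_tensor_series by blast
  have L_sums: "(\<lambda>n. blinfun_apply L (power_tensor (p n))) sums blinfun_apply L u" for L :: "'g \<Rightarrow>\<^sub>L 'k"
    by (rule bounded_linear.sums[OF blinfun.bounded_linear_right p(1)])
  have cont: "g \<in> borel_measurable M'" if "continuous_on UNIV g" for g :: "_ \<Rightarrow> 'k"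
  proof -
    have "g \<in> borel_measurable ?R"
      by (rule measurable_restrict_space1[OF borel_measurable_continuous_onI[OF that]])
    then show ?thesis using measurable_cong_sets[OF sets refl] by blast
  qed
  have base': "(\<lambda>n. fst (p n) * (\<Prod>f\<leftarrow>fs. blinfun_apply f (fst (snd (p n)))) * blinfun_apply \<phi> (snd (snd (p n)))) sums
      (\<integral>z. (\<Prod>f\<leftarrow>fs. fst z f) * snd z \<phi> \<partial>M')"
    if fs: "set fs \<subseteq> dual_space sX" "length fs = N" and \<phi>: "\<phi> \<in> dual_space sY" for fs \<phi>
  proof -
    obtain L :: "'g \<Rightarrow>\<^sub>L 'k" where L: "\<forall>c x y. blinfun_apply L (power_tensor (c, x, y)) =
        c * blinfun_apply (dual_scale (prod_list (map2 blinfun_apply fs (replicate N x))) \<phi>) y"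
      using dual_valued_functional[OF rank_one_dual_valued[OF fs(1) \<phi>, unfolded fs(2)]] by blast
    then have L': "\<forall>c x y. blinfun_apply L (power_tensor (c, x, y)) = c * (\<Prod>f\<leftarrow>fs. blinfun_apply f x) * blinfun_apply \<phi> y"
      using prod_list_map2_replicate[of fs] fs(2) by simp
    have "blinfun_apply L (power_tensor (p n)) =
        fst (p n) * (\<Prod>f\<leftarrow>fs. blinfun_apply f (fst (snd (p n)))) * blinfun_apply \<phi> (snd (snd (p n)))" for n
      using L'[rule_format, of "fst (p n)" "fst (snd (p n))" "snd (snd (p n))"] by simp
    then show ?thesis
      using L_sums[of L] base[OF fs \<phi> L'] by (simp add: integral)
  qed
  have rep: "has_scalar_integral ?R \<mu> (\<lambda>(x'', y''). aron_berner sX dual_scale (dual_space sY) N P x'' y'')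
         (tensor_pairing sX sY sE N \<iota> \<kappa> u P)"
    if P: "P \<in> homogeneous_polynomials sX dual_scale (dual_space sY) N" for P
  proof -
    define \<Phi> where "\<Phi> = associated_symmetric_map sX dual_scale (dual_space sY) N P"
    have \<Phi>: "continuous_multilinear_map sX dual_scale (dual_space sY) N \<Phi>" "\<And>x. P x = \<Phi> (replicate N x)"
      unfolding \<Phi>_def using associated_symmetric_map[OF P] by simp_all
    obtain C where C: "dual_valued N C \<Phi>" using continuous_multilinear_map_dual_valued[OF \<Phi>(1)] by blast
    have AB: "(\<lambda>(x'', y''). aron_berner sX dual_scale (dual_space sY) N P x'' y'') = aron_berner_form N \<Phi>"
      by (auto simp: aron_berner_def arens_extension_def aron_berner_form_def \<Phi>_def)
    have main: "aron_berner_form N \<Phi> \<in> borel_measurable M' \<and>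
      (\<lambda>n. fst (p n) * (\<Prod>f\<leftarrow>[]. blinfun_apply f (fst (snd (p n)))) *
          blinfun_apply (\<Phi> (replicate N (fst (snd (p n))))) (snd (snd (p n)))) sums
        (\<integral>z. (\<Prod>f\<leftarrow>[]. fst z f) * aron_berner_form N \<Phi> z \<partial>M')"
      by (rule aron_berner_integral[OF sep AP fin space cont p(2) base' C]) simp_all
    obtain L :: "'g \<Rightarrow>\<^sub>L 'k" where L: "L \<in> dual_space sG"
      "\<And>c x y. blinfun_apply L (power_tensor (c, x, y)) = c * blinfun_apply (P x) y"
      using dual_valued_functional[OF C] \<Phi>(2) by auto
    have "tensor_pairing sX sY sE N \<iota> \<kappa> u P = blinfun_apply L u"
      by (rule tensor_pairing_eq[OF L])
    also have "\<dots> = (\<integral>z. aron_berner_form N \<Phi> z \<partial>M')"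
    proof (rule sums_unique2[OF L_sums])
      have "blinfun_apply L (power_tensor (p n)) = fst (p n) * blinfun_apply (\<Phi> (replicate N (fst (snd (p n))))) (snd (snd (p n)))" for n
        using L(2)[of "fst (p n)" "fst (snd (p n))" "snd (snd (p n))"] by (simp add: \<Phi>(2))
      then show "(\<lambda>n. blinfun_apply L (power_tensor (p n))) sums (\<integral>z. aron_berner_form N \<Phi> z \<partial>M')"
        using main by simp
    qed
    finally show ?thesis
      unfolding AB \<mu>_def[abs_def]
      using has_scalar_integral_of_measure[OF fin sets conjunct1[OF main], of C] aron_berner_form_le[OF C] space by simp
  qed
  show ?thesis using regular total rep by blast
qed

end

theorem theorem2p2:
  fixes sX :: "'k::real_or_complex \<Rightarrow> 'a::banach \<Rightarrow> 'a"
    and sY :: "'k \<Rightarrow> 'b::banach \<Rightarrow> 'b"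
    and N :: nat
    and sE :: "'k \<Rightarrow> 'e::banach \<Rightarrow> 'e" and \<iota> :: "(('a list \<Rightarrow> 'k) \<Rightarrow> 'k) \<Rightarrow> 'e"
    and sG :: "'k \<Rightarrow> 'g::banach \<Rightarrow> 'g" and \<kappa> :: "(('e \<Rightarrow> 'b \<Rightarrow> 'k) \<Rightarrow> 'k) \<Rightarrow> 'g"
    and u :: 'g
  assumes X: "banach_space_over sX" and Y: "banach_space_over sY" and N: "N \<ge> 1"
    and E: "is_completion (sym_tensors sX N) (sym_proj_norm sX N) sE \<iota>"
    and G: "is_completion (tensors sE sY) (proj_norm sE sY) sG \<kappa>"
    and separable_dual: "separable_set (dual_space sX)"
    and AP: "approximation_property dual_scale (dual_space sX)"
  shows "\<exists>\<mu> :: ((('a \<Rightarrow>\<^sub>L 'k) \<Rightarrow> 'k) \<times> (('b \<Rightarrow>\<^sub>L 'k) \<Rightarrow> 'k)) set \<Rightarrow> 'k.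
    regular_borel_measure_on (bidual_ball sX \<times> bidual_ball sY) \<mu> \<and>
    total_variation_norm (restrict_space borel (bidual_ball sX \<times> bidual_ball sY)) \<mu> \<le> ennreal (norm u) \<and>
    (\<forall>P \<in> homogeneous_polynomials sX dual_scale (dual_space sY) N.
       has_scalar_integral (restrict_space borel (bidual_ball sX \<times> bidual_ball sY)) \<mu>
         (\<lambda>(x'', y''). aron_berner sX dual_scale (dual_space sY) N P x'' y'')
         (tensor_pairing sX sY sE N \<iota> \<kappa> u P))"
proof -
  interpret banach_pair sX sY using X Y by (simp add: banach_pair_def)
  interpret completed_tensor sX sY N sE \<iota> sG \<kappa>
    using N E G by unfold_locales
  show ?thesis by (rule integral_representation[OF separable_dual AP])
qed

end
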